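(* Let $L/K$ be a finite separable extension of local fields and let $M$ be an intermediate field of $L/K$. Then $L/K$ is exceptional if and only if both $L/M$ and $M/K$ are exceptional.
   Context: A local field is a field complete with respect to a discrete valuation with finite residue field. For a finite separable extension $L/K$ of local fields with Galois closure $N$, $L/K$ is exceptional if (a) $L/K$ is totally ramified, and (b) for every $\sigma\in\mathrm{Gal}(N/K)\setminus\mathrm{Gal}(N/L)$ the compositum $L.\sigma(L)$ (inside $N$) is not totally ramified over $K$. *)

theory Defs
  imports "HOL-Algebra.Algebra" "HOL-Algebra.Algebraic_Closure" "HOL-Algebra.Generated_Fields"
    "HOL-Library.FuncSet"
begin

section \<open>Local fields\<close>

text \<open>A discrete valuation is normalised: it maps the nonzero elements onto the integers. The
  convention that zero has infinite valuation is rendered by guards, so the integer assigned to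
  zero is irrelevant.\<close>

locale discrete_valuation = field F for F (structure) +
  fixes v :: "'a \<Rightarrow> int"
  assumes val_mult: "\<lbrakk> x \<in> carrier F - {\<zero>}; y \<in> carrier F - {\<zero>} \<rbrakk> \<Longrightarrow> v (x \<otimes> y) = v x + v y"
    and val_add: "\<lbrakk> x \<in> carrier F - {\<zero>}; y \<in> carrier F - {\<zero>}; x \<oplus> y \<noteq> \<zero> \<rbrakk>
      \<Longrightarrow> min (v x) (v y) \<le> v (x \<oplus> y)"
    and val_surj: "v ` (carrier F - {\<zero>}) = UNIV"
begin

definition valuation_ring :: "'a set"
  where "valuation_ring = {x \<in> carrier F. x = \<zero> \<or> 0 \<le> v x}"

definition valuation_ideal :: "'a set"
  where "valuation_ideal = {x \<in> carrier F. x = \<zero> \<or> 0 < v x}"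

definition residue_field :: "'a set ring"
  where "residue_field = (F\<lparr>carrier := valuation_ring\<rparr>) Quot valuation_ideal"

definition val_close :: "int \<Rightarrow> 'a \<Rightarrow> 'a \<Rightarrow> bool"
  where "val_close B x y \<longleftrightarrow> x = y \<or> B \<le> v (x \<ominus> y)"

definition val_Cauchy :: "(nat \<Rightarrow> 'a) \<Rightarrow> bool"
  where "val_Cauchy s \<longleftrightarrow> (\<forall>B. \<exists>n0. \<forall>m\<ge>n0. \<forall>n\<ge>n0. val_close B (s m) (s n))"

definition val_tendsto :: "(nat \<Rightarrow> 'a) \<Rightarrow> 'a \<Rightarrow> bool"
  where "val_tendsto s a \<longleftrightarrow> (\<forall>B. \<exists>n0. \<forall>n\<ge>n0. val_close B (s n) a)"

end

locale local_valuation = discrete_valuation +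
  assumes complete: "\<lbrakk> range s \<subseteq> carrier F; val_Cauchy s \<rbrakk> \<Longrightarrow> \<exists>a\<in>carrier F. val_tendsto s a"
    and finite_residue_field: "finite (carrier residue_field)"

definition local_field :: "('a, 'b) ring_scheme \<Rightarrow> bool"
  where "local_field F \<longleftrightarrow> (\<exists>v. local_valuation F v)"


section \<open>Extensions inside a fixed ambient field\<close>

text \<open>The fields of an extension \<open>E/K\<close> are subfields of the ambient ring \<open>R\<close>, which in all
  applications is an algebraically closed field; the base field is always the first argument.\<close>

context ring
begin

text \<open>The normalised valuation that makes a field a local field is unique, and for a finite
  extension \<open>E/K\<close> of local fields the one of \<open>E\<close> restricts to a positive multiple of the one of
  \<open>K\<close>; hence the definite description below denotes.\<close>

definition ramification_index :: "'a set \<Rightarrow> 'a set \<Rightarrow> nat"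
  where "ramification_index K E = (THE e. \<exists>v w.
    local_valuation (R\<lparr>carrier := K\<rparr>) v \<and> local_valuation (R\<lparr>carrier := E\<rparr>) w \<and>
    (\<forall>x \<in> K - {\<zero>}. w x = int e * v x))"

definition totally_ramified :: "'a set \<Rightarrow> 'a set \<Rightarrow> bool"
  where "totally_ramified K E \<longleftrightarrow>
    finite_dimension K E \<and> ramification_index K E = (dim over K) E"

text \<open>Multiplicities of roots are counted in the ambient field \<open>R\<close>, so this is separability
  when \<open>R\<close> is algebraically closed.\<close>

definition separable_extension :: "'a set \<Rightarrow> 'a set \<Rightarrow> bool"
  where "separable_extension K E \<longleftrightarrow>
    (\<forall>x\<in>E. (algebraic over K) x \<and> (\<forall>a\<in>carrier R. alg_mult (Irr K x) a \<le> 1))"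

text \<open>The predicate \<open>ring.splitted\<close> is taken in the ring with carrier \<open>E\<close>; the library's
  \<open>splitted_on E\<close> is not usable here, since \<open>mset_set E\<close> is empty for infinite \<open>E\<close>.\<close>

definition normal_extension :: "'a set \<Rightarrow> 'a set \<Rightarrow> bool"
  where "normal_extension K E \<longleftrightarrow>
    (\<forall>x\<in>E. (algebraic over K) x \<and> ring.splitted (R\<lparr>carrier := E\<rparr>) (Irr K x))"

definition galois_extension :: "'a set \<Rightarrow> 'a set \<Rightarrow> bool"
  where "galois_extension K E \<longleftrightarrow>
    finite_dimension K E \<and> normal_extension K E \<and> separable_extension K E"

definition galois_closure :: "'a set \<Rightarrow> 'a set \<Rightarrow> 'a set"
  where "galois_closure K E = \<Inter> {N. subfield N R \<and> E \<subseteq> N \<and> galois_extension K N}"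

text \<open>Extensionality outside \<open>N\<close> makes each automorphism occur exactly once.\<close>

definition galois_group :: "'a set \<Rightarrow> 'a set \<Rightarrow> ('a \<Rightarrow> 'a) set"
  where "galois_group K N =
    {\<tau> \<in> ring_iso (R\<lparr>carrier := N\<rparr>) (R\<lparr>carrier := N\<rparr>) \<inter> extensional N. \<forall>x\<in>K. \<tau> x = x}"

definition compositum :: "'a set \<Rightarrow> 'a set \<Rightarrow> 'a set"
  where "compositum E E' = generate_field R (E \<union> E')"

definition exceptional :: "'a set \<Rightarrow> 'a set \<Rightarrow> bool"
  where "exceptional K L \<longleftrightarrow>
    totally_ramified K L \<and>
    (\<forall>\<tau> \<in> galois_group K (galois_closure K L) - galois_group L (galois_closure K L).
       \<not> totally_ramified K (compositum L (\<tau> ` L)))"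

end

end

theory Submission
  imports Defs
begin

text \<open>A finite extension is totally ramified if and only if it has the same residue field as the base.
  Hence total ramification is transitive in towers, and of the three implications only one is not
  formal: if \<open>L/K\<close> is exceptional, then so is \<open>M/K\<close>.

  Let \<open>N\<close> be a finite Galois extension of \<open>K\<close> containing \<open>L\<close>, and call an automorphism of \<open>N\<close>
  over \<open>K\<close> a Frobenius element if it acts as \<open>x \<mapsto> x\<^sup>q\<close> on the residue field, where \<open>q\<close> is the
  number of elements of the residue field of \<open>K\<close>. An intermediate field is totally ramified over \<open>K\<close>
  if and only if some Frobenius element fixes it. If \<open>L/M\<close> is exceptional, then a Frobenius
  element over \<open>M\<close> fixes at most one conjugate of \<open>L\<close> over \<open>M\<close>, and counting shows that it fixes
  exactly one. Now suppose that \<open>M\<sigma>(M)/K\<close> is totally ramified with \<open>\<sigma>\<close> nontrivial on \<open>M\<close>, and let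
  \<open>g\<close> be a Frobenius element that fixes \<open>M\<sigma>(M)\<close>. Applied to \<open>g\<close> and to \<open>\<sigma>\<^sup>-\<^sup>1g\<sigma>\<close>, the count gives
  conjugates \<open>i(L)\<close> and \<open>\<sigma>j(L)\<close>, with \<open>i\<close> and \<open>j\<close> trivial on \<open>M\<close>, which \<open>g\<close> fixes. So
  \<open>L\<tau>(L)/K\<close> is totally ramified for \<open>\<tau> = i\<^sup>-\<^sup>1\<sigma>j\<close>, which is nontrivial on \<open>M\<close>: a contradiction.

  The valuation of \<open>K\<close> extends to \<open>N\<close> because a subring of \<open>N\<close> that is maximal among those that
  contain the integers of \<open>K\<close> but not the inverse of a uniformiser is a valuation ring. The
  normalised valuation is unique because the principal units are divisible by an integer greater
  than \<open>1\<close>.\<close>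

section \<open>Valued subfields\<close>

text \<open>An extension of \<sigma> from M to L is determined only up to Gal(N/M), and for an
  arbitrary one the compositum L.\<tau>(L) need not be totally ramified even though M.\<sigma>(M)
  is. The count for L/M is what selects suitable choices on both sides. It applies to g and to its
  conjugate because g fixes both M and \<sigma>(M), and because M/K is totally ramified: q, and with
  it the notion of a Frobenius element, is then the same over K and over M.

  The definition refers to a different Galois closure for each of the three extensions. Its
  condition on \<tau> depends only on the restriction of \<tau> to the upper field, which allows all
  three to be tested inside one N.

  \<open>ramification_index\<close> is a definite description over pairs of normalised valuations,
  so total ramification says nothing until existence and uniqueness of these valuations are known.
  Uniqueness, applied to the pullback of the valuation along an automorphism, also shows that
  automorphisms preserve the valuation, without which they would not act on the residue
  field.\<close>

lemma (in ring) a_inv_subring: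
  assumes "subring N R" "x \<in> N"
  shows "\<ominus>\<^bsub>R\<lparr>carrier := N\<rparr>\<^esub> x = \<ominus> x"
proof -
  interpret S: subring N R by fact
  have "subgroup N (add_monoid R)" by (rule S.subgroup_axioms)
  from group.m_inv_consistent[OF add.is_group this assms(2)]
  show ?thesis by (simp add: a_inv_def)
qed

lemma (in ring) minus_subring:
  assumes "subring N R" "x \<in> N" "y \<in> N"
  shows "x \<ominus>\<^bsub>R\<lparr>carrier := N\<rparr>\<^esub> y = x \<ominus> y"
  using assms by (simp add: a_minus_def a_inv_subring)

text \<open>Neither normalised nor nontrivial, so that restrictions to a base field, the unscaled
  extension \<open>lam\<close> and the pullback along an automorphism are all instances.\<close>

locale valued_subfield = field R for R (structure) +
  fixes N :: "'a set" and w :: "'a \<Rightarrow> int"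
  assumes subfieldN: "subfield N R"
    and w_mult: "\<lbrakk> x \<in> N; x \<noteq> \<zero>; y \<in> N; y \<noteq> \<zero> \<rbrakk> \<Longrightarrow> w (x \<otimes> y) = w x + w y"
    and w_add: "\<lbrakk> x \<in> N; x \<noteq> \<zero>; y \<in> N; y \<noteq> \<zero>; x \<oplus> y \<noteq> \<zero> \<rbrakk> \<Longrightarrow> min (w x) (w y) \<le> w (x \<oplus> y)"
begin

text \<open>\<open>B 0\<close> is the valuation ring and \<open>B 1\<close> its maximal ideal.
  Closeness is always expressed as \<open>x \<ominus> y \<in> B k\<close>, which absorbs the case of
  difference zero.\<close>

definition B :: "int \<Rightarrow> 'a set"
  where "B k = {x \<in> N. x = \<zero> \<or> k \<le> w x}"

lemma subringN: "subring N R" by (rule subfieldE(1)[OF subfieldN])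

lemma N_carrier: "x \<in> N \<Longrightarrow> x \<in> carrier R"
  using subfieldE(3)[OF subfieldN] by auto

lemma N_closed [simp, intro]:
  "\<zero> \<in> N" "\<one> \<in> N"
  "x \<in> N \<Longrightarrow> \<ominus> x \<in> N"
  "x \<in> N \<Longrightarrow> y \<in> N \<Longrightarrow> x \<oplus> y \<in> N"
  "x \<in> N \<Longrightarrow> y \<in> N \<Longrightarrow> x \<otimes> y \<in> N"
  using subringE[OF subringN] by auto

lemma N_minus [simp, intro]: "x \<in> N \<Longrightarrow> y \<in> N \<Longrightarrow> x \<ominus> y \<in> N"
  by (simp add: a_minus_def)

lemma N_inv: "x \<in> N \<Longrightarrow> x \<noteq> \<zero> \<Longrightarrow> inv x \<in> N" "x \<in> N \<Longrightarrow> x \<noteq> \<zero> \<Longrightarrow> inv x \<noteq> \<zero>"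
  "x \<in> N \<Longrightarrow> x \<noteq> \<zero> \<Longrightarrow> x \<otimes> inv x = \<one>" "x \<in> N \<Longrightarrow> x \<noteq> \<zero> \<Longrightarrow> inv x \<otimes> x = \<one>"
  using subfield_m_inv[OF subfieldN] by auto

lemma N_pow [simp, intro]: "x \<in> N \<Longrightarrow> x [^] (n::nat) \<in> N"
  by (induction n) auto

lemma N_mult_nz: "\<lbrakk> x \<in> N; x \<noteq> \<zero>; y \<in> N; y \<noteq> \<zero> \<rbrakk> \<Longrightarrow> x \<otimes> y \<noteq> \<zero>"
  using integral_iff N_carrier by auto

lemma N_pow_nz: "x \<in> N \<Longrightarrow> x \<noteq> \<zero> \<Longrightarrow> x [^] (n::nat) \<noteq> \<zero>"
  by (induction n) (auto dest: N_mult_nz[OF N_pow])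

lemma w_one [simp]: "w \<one> = 0"
  using w_mult[of \<one> \<one>] by auto

lemma w_minus_one: "w (\<ominus> \<one>) = 0"
proof -
  have nz: "\<ominus> \<one> \<noteq> \<zero>" by (metis N_closed(2) N_carrier minus_minus minus_zero one_not_zero)
  have "(\<ominus> \<one>) \<otimes> (\<ominus> \<one>) = \<one>" using l_minus r_minus by auto
  then show ?thesis using w_mult[of "\<ominus> \<one>" "\<ominus> \<one>"] nz by auto
qed

lemma w_uminus [simp]: assumes "x \<in> N" shows "w (\<ominus> x) = w x"
proof (cases "x = \<zero>")
  case False
  have nz: "\<ominus> \<one> \<noteq> \<zero>" by (metis N_closed(2) N_carrier minus_minus minus_zero one_not_zero)
  have "\<ominus> x = (\<ominus> \<one>) \<otimes> x" using assms N_carrier l_minus by auto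
  then show ?thesis using w_mult[of "\<ominus> \<one>" x] nz False assms w_minus_one by auto
qed simp

lemma w_inv: assumes "x \<in> N" "x \<noteq> \<zero>" shows "w (inv x) = - w x"
  using w_mult[of x "inv x"] N_inv[OF assms] assms by auto

lemma w_pow: assumes "x \<in> N" "x \<noteq> \<zero>" shows "w (x [^] (n::nat)) = int n * w x"
  by (induction n) (use assms in \<open>auto simp: w_mult N_pow_nz algebra_simps\<close>)

lemma B_N: "x \<in> B k \<Longrightarrow> x \<in> N" by (simp add: B_def)

lemma B_carrier: "x \<in> B k \<Longrightarrow> x \<in> carrier R" by (simp add: B_def N_carrier)

lemma B_zero [simp, intro]: "\<zero> \<in> B k" by (simp add: B_def)

lemma B_one [simp, intro]: "\<one> \<in> B 0" by (simp add: B_def)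

lemma one_notin_B1: "\<one> \<notin> B 1" by (simp add: B_def)

lemma B_mono: "j \<le> k \<Longrightarrow> x \<in> B k \<Longrightarrow> x \<in> B j" by (auto simp: B_def)

lemma B_uminus [intro]: "x \<in> B k \<Longrightarrow> \<ominus> x \<in> B k" by (auto simp: B_def)

lemma B_add [intro]: assumes "x \<in> B k" "y \<in> B k" shows "x \<oplus> y \<in> B k"
proof (cases "x = \<zero> \<or> y = \<zero> \<or> x \<oplus> y = \<zero>")
  case True
  then show ?thesis using assms by (auto simp: B_carrier)
next
  case False
  then show ?thesis using assms w_add[of x y] by (auto simp: B_def)
qed

lemma B_minus [intro]: "x \<in> B k \<Longrightarrow> y \<in> B k \<Longrightarrow> x \<ominus> y \<in> B k"
  by (simp add: a_minus_def B_add B_uminus)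

lemma B_mult: assumes "x \<in> B j" "y \<in> B k" shows "x \<otimes> y \<in> B (j + k)"
proof (cases "x = \<zero> \<or> y = \<zero>")
  case True
  then show ?thesis using assms by (auto simp: B_carrier)
next
  case False
  then show ?thesis using assms w_mult[of x y] by (auto simp: B_def)
qed

lemma B0_mult: "x \<in> B 0 \<Longrightarrow> y \<in> B k \<Longrightarrow> x \<otimes> y \<in> B k" "x \<in> B k \<Longrightarrow> y \<in> B 0 \<Longrightarrow> x \<otimes> y \<in> B k"
  using B_mult[of x 0 y k] B_mult[of x k y 0] by auto

lemma B_pow: "x \<in> B 0 \<Longrightarrow> x [^] (n::nat) \<in> B 0"
  by (induction n) (auto intro: B0_mult)

lemma B_separated: assumes "\<And>k. x \<in> B k" shows "x = \<zero>"
  using assms[of "w x + 1"] by (auto simp: B_def)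

lemma B_minus_sym: assumes "x \<in> N" "y \<in> N" shows "x \<ominus> y \<in> B k \<longleftrightarrow> y \<ominus> x \<in> B k"
proof -
  have "y \<ominus> x = \<ominus> (x \<ominus> y)" "x \<ominus> y = \<ominus> (y \<ominus> x)"
    using assms N_carrier by (auto simp: a_minus_def minus_add a_comm)
  then show ?thesis using B_uminus by metis
qed

lemma B_minus_trans: assumes "x \<ominus> y \<in> B k" "y \<ominus> z \<in> B k" "x \<in> N" "y \<in> N" "z \<in> N"
  shows "x \<ominus> z \<in> B k"
proof -
  have "x \<ominus> z = (x \<ominus> y) \<oplus> (y \<ominus> z)"
    using assms(3-5)[THEN N_carrier] unfolding a_minus_def by algebra
  then show ?thesis using B_add assms by simp
qed

lemma B_pow_cong:
  assumes "x \<in> B 0" "y \<in> B 0" "x \<ominus> y \<in> B k"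
  shows "x [^] (n::nat) \<ominus> y [^] n \<in> B k"
proof (induction n)
  case 0
  show ?case by (simp add: a_minus_def r_neg)
next
  case (Suc n)
  have c: "x \<in> carrier R" "y \<in> carrier R" using assms B_carrier by auto
  have "x [^] Suc n \<ominus> y [^] Suc n = (x [^] n \<ominus> y [^] n) \<otimes> x \<oplus> y [^] n \<otimes> (x \<ominus> y)"
  proof -
    have "x [^] n \<in> carrier R" "y [^] n \<in> carrier R" using c by auto
    then show ?thesis using c unfolding a_minus_def nat_pow_Suc by algebra
  qed
  moreover have "(x [^] n \<ominus> y [^] n) \<otimes> x \<in> B k" using Suc assms B0_mult by blast
  moreover have "y [^] n \<otimes> (x \<ominus> y) \<in> B k" using B_pow assms B0_mult by blast
  ultimately show ?case using B_add by metis
qed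

text \<open>If the value of x + y exceeded that of x, then so would the value of x = (x + y) -
  y.\<close>

lemma w_add_eq:
  assumes "x \<in> N" "x \<noteq> \<zero>" "y \<in> N" "y \<noteq> \<zero>" "w x < w y"
  shows "x \<oplus> y \<noteq> \<zero>" "w (x \<oplus> y) = w x"
proof -
  have c: "x \<in> carrier R" "y \<in> carrier R" using assms N_carrier by auto
  show nz: "x \<oplus> y \<noteq> \<zero>"
  proof
    assume "x \<oplus> y = \<zero>"
    then have "x = \<ominus> y" using c by (simp add: minus_equality a_comm)
    then show False using assms by auto
  qed
  have e: "(x \<oplus> y) \<oplus> \<ominus> y = x" using c by algebra
  have "min (w (x \<oplus> y)) (w (\<ominus> y)) \<le> w ((x \<oplus> y) \<oplus> \<ominus> y)"
    by (rule w_add) (use assms nz e c in \<open>auto simp: \<close>)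
  then have "min (w (x \<oplus> y)) (w y) \<le> w x" using e assms by simp
  moreover have "min (w x) (w y) \<le> w (x \<oplus> y)" using w_add[of x y] assms nz by auto
  ultimately show "w (x \<oplus> y) = w x" using assms(5) by auto
qed

section \<open>Cauchy sequences and completeness\<close>

definition Cauchy :: "(nat \<Rightarrow> 'a) \<Rightarrow> bool"
  where "Cauchy s \<longleftrightarrow> (\<forall>k. \<exists>n0. \<forall>m\<ge>n0. \<forall>n\<ge>n0. s m \<ominus> s n \<in> B k)"

definition tends :: "(nat \<Rightarrow> 'a) \<Rightarrow> 'a \<Rightarrow> bool"
  where "tends s a \<longleftrightarrow> (\<forall>k. \<exists>n0. \<forall>n\<ge>n0. s n \<ominus> a \<in> B k)"

definition complete_set :: "'a set \<Rightarrow> bool"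
  where "complete_set U \<longleftrightarrow> (\<forall>s. range s \<subseteq> U \<longrightarrow> Cauchy s \<longrightarrow> (\<exists>a\<in>U. tends s a))"

lemma tends_unique:
  assumes "tends s a" "tends s b" "range s \<subseteq> N" "a \<in> N" "b \<in> N"
  shows "a = b"
proof -
  have "a \<ominus> b \<in> B k" for k
  proof -
    obtain n1 where n1: "\<forall>n\<ge>n1. s n \<ominus> a \<in> B k" using assms(1) by (auto simp: tends_def)
    obtain n2 where n2: "\<forall>n\<ge>n2. s n \<ominus> b \<in> B k" using assms(2) by (auto simp: tends_def)
    define n where "n = max n1 n2"
    have "s n \<ominus> a \<in> B k" "s n \<ominus> b \<in> B k" using n1 n2 by (auto simp: n_def)
    moreover have "s n \<in> N" using assms(3) by auto
    ultimately show ?thesis using B_minus_sym B_minus_trans assms by metis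
  qed
  then have "a \<ominus> b = \<zero>" by (rule B_separated)
  then show ?thesis using assms N_carrier by simp
qed

text \<open>By the ultrametric inequality it is enough to control consecutive differences.\<close>

lemma Cauchy_stepI:
  assumes "range s \<subseteq> N" "\<And>n. s (Suc n) \<ominus> s n \<in> B (k0 + int n)"
  shows "Cauchy s"
proof -
  have step: "s (n + j) \<ominus> s n \<in> B (k0 + int n)" for n j
  proof (induction j)
    case 0
    have "s n \<in> carrier R" using assms(1) N_carrier by auto
    then show ?case by (simp add: a_minus_def r_neg)
  next
    case (Suc j)
    have "s (Suc (n + j)) \<ominus> s (n + j) \<in> B (k0 + int n)"
      using assms(2)[of "n + j"] B_mono[of "k0 + int n" "k0 + int (n + j)"] by auto
    then show ?case using Suc B_minus_trans assms(1) by (metis add_Suc_right range_subsetD)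
  qed
  show ?thesis unfolding Cauchy_def
  proof
    fix k
    define n0 where "n0 = nat (k - k0)"
    have "s m \<ominus> s n \<in> B k" if "m \<ge> n0" "n \<ge> n0" for m n
    proof -
      have k: "k \<le> k0 + int n0" by (simp add: n0_def)
      have "s m \<ominus> s n0 \<in> B k" using step[of n0 "m - n0"] that B_mono[OF k] by auto
      moreover have "s n \<ominus> s n0 \<in> B k" using step[of n0 "n - n0"] that B_mono[OF k] by auto
      ultimately show ?thesis using B_minus_sym B_minus_trans assms(1) by (metis range_subsetD)
    qed
    then show "\<exists>n0. \<forall>m\<ge>n0. \<forall>n\<ge>n0. s m \<ominus> s n \<in> B k" by blast
  qed
qed

end

locale local_subfield = valued_subfield +
  assumes w_surj: "\<exists>x\<in>N. x \<noteq> \<zero> \<and> w x = k"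
    and completeN: "complete_set N"
    and finite_reps: "\<exists>T. finite T \<and> T \<subseteq> B 0 \<and> (\<forall>x\<in>B 0. \<exists>t\<in>T. x \<ominus> t \<in> B 1)"

section \<open>Comparison with the given notion of local field\<close>

lemma (in field) discrete_valuation_valued:
  assumes "subfield N R" "discrete_valuation (R\<lparr>carrier := N\<rparr>) w"
  shows "valued_subfield R N w"
proof -
  interpret D: discrete_valuation "R\<lparr>carrier := N\<rparr>" w by fact
  show ?thesis
  proof (intro valued_subfield.intro valued_subfield_axioms.intro, rule field_axioms, rule assms(1))
    fix x y assume "x \<in> N" "x \<noteq> \<zero>" "y \<in> N" "y \<noteq> \<zero>"
    then show "w (x \<otimes> y) = w x + w y" using D.val_mult[of x y] by simp
  next
    fix x y assume "x \<in> N" "x \<noteq> \<zero>" "y \<in> N" "y \<noteq> \<zero>" "x \<oplus> y \<noteq> \<zero>"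
    then show "min (w x) (w y) \<le> w (x \<oplus> y)" using D.val_add[of x y] by simp
  qed
qed

text \<open>Trades the quotient ring in \<open>finite_residue_field\<close> for a finite set of
  representatives, and the relative operations for those of R: two cosets of \<open>B 1\<close>
  coincide exactly when their representatives differ by an element of \<open>B 1\<close>.\<close>

lemma (in valued_subfield) local_valuation_iff:
  "local_valuation (R\<lparr>carrier := N\<rparr>) w \<longleftrightarrow> local_subfield R N w"
proof -
  let ?F = "R\<lparr>carrier := N\<rparr>"
  have mi: "x \<ominus>\<^bsub>?F\<^esub> y = x \<ominus> y" if "x \<in> N" "y \<in> N" for x y
    using that minus_subring subringN by auto
  have DV: "discrete_valuation ?F w \<longleftrightarrow> (\<forall>k. \<exists>x\<in>N. x \<noteq> \<zero> \<and> w x = k)"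
  proof
    assume "discrete_valuation ?F w"
    then interpret D: discrete_valuation ?F w .
    show "\<forall>k. \<exists>x\<in>N. x \<noteq> \<zero> \<and> w x = k"
    proof
      fix k
      have "k \<in> w ` (N - {\<zero>})" using D.val_surj by simp
      then show "\<exists>x\<in>N. x \<noteq> \<zero> \<and> w x = k" by auto
    qed
  next
    assume s: "\<forall>k. \<exists>x\<in>N. x \<noteq> \<zero> \<and> w x = k"
    interpret F: field ?F using subfield_iff(2)[OF subfieldN] .
    have "w ` (N - {\<zero>}) = UNIV"
    proof (rule Set.set_eqI)
      fix k
      obtain x where "x \<in> N" "x \<noteq> \<zero>" "w x = k" using s by blast
      then show "k \<in> w ` (N - {\<zero>}) \<longleftrightarrow> k \<in> UNIV" by blast
    qed
    then show "discrete_valuation ?F w"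
      unfolding discrete_valuation_def discrete_valuation_axioms_def
      using F.field_axioms w_mult w_add by simp
  qed
  have LV: "local_valuation ?F w \<longleftrightarrow> complete_set N \<and>
      (\<exists>T. finite T \<and> T \<subseteq> B 0 \<and> (\<forall>x\<in>B 0. \<exists>t\<in>T. x \<ominus> t \<in> B 1))" if dv: "discrete_valuation ?F w"
  proof -
    interpret D: discrete_valuation ?F w by fact
    have close: "D.val_close k x y \<longleftrightarrow> x \<ominus> y \<in> B k" if "x \<in> N" "y \<in> N" for k x y
      using that mi N_carrier by (auto simp: D.val_close_def B_def)
    have C: "D.val_Cauchy s \<longleftrightarrow> Cauchy s" if "range s \<subseteq> N" for s
      using that close by (simp add: D.val_Cauchy_def Cauchy_def range_subsetD)
    have T: "D.val_tendsto s a \<longleftrightarrow> tends s a" if "range s \<subseteq> N" "a \<in> N" for s a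
      using that close by (simp add: D.val_tendsto_def tends_def range_subsetD)
    have O: "D.valuation_ring = B 0" by (simp add: D.valuation_ring_def B_def)
    have I: "D.valuation_ideal = B 1" by (auto simp: D.valuation_ideal_def B_def)
    let ?c = "\<lambda>x. (\<lambda>i. i \<oplus> x) ` B 1"
    have car: "carrier D.residue_field = ?c ` B 0"
      by (auto simp: D.residue_field_def O I FactRing_def A_RCOSETS_def RCOSETS_def r_coset_def image_def) 
    have ceq: "?c x = ?c y \<longleftrightarrow> x \<ominus> y \<in> B 1" if "x \<in> B 0" "y \<in> B 0" for x y
    proof
      have cx: "x \<in> carrier R" "y \<in> carrier R" using that B_carrier by auto
      assume "?c x = ?c y"
      moreover have "x \<in> ?c x" using cx by (intro image_eqI[of _ _ \<zero>]) auto
      ultimately obtain i where i: "i \<in> B 1" "x = i \<oplus> y" by auto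
      then have "x \<ominus> y = i" using cx B_carrier[OF i(1)] unfolding a_minus_def by algebra
      then show "x \<ominus> y \<in> B 1" using i by simp
    next
      have cx: "x \<in> carrier R" "y \<in> carrier R" using that B_carrier by auto
      have sub: "?c u \<subseteq> ?c v" if "u \<ominus> v \<in> B 1" "u \<in> carrier R" "v \<in> carrier R" for u v
      proof
        fix z assume "z \<in> ?c u"
        then obtain i where i: "i \<in> B 1" "z = i \<oplus> u" by auto
        have "i \<oplus> (u \<ominus> v) \<in> B 1" using i that by auto
        moreover have "z = (i \<oplus> (u \<ominus> v)) \<oplus> v" using that i B_carrier[OF i(1)]
          unfolding a_minus_def by algebra
        ultimately show "z \<in> ?c v" by blast
      qed
      assume "x \<ominus> y \<in> B 1"
      moreover then have "y \<ominus> x \<in> B 1" using that B_minus_sym B_N by blast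
      ultimately show "?c x = ?c y" using sub[OF _ cx] sub[OF _ cx(2,1)] by (intro subset_antisym) simp_all
    qed
    have fin: "finite (carrier D.residue_field) \<longleftrightarrow>
      (\<exists>T. finite T \<and> T \<subseteq> B 0 \<and> (\<forall>x\<in>B 0. \<exists>t\<in>T. x \<ominus> t \<in> B 1))"
    proof
      assume "finite (carrier D.residue_field)"
      then have "finite (?c ` B 0)" by (simp add: car)
      then obtain T where T: "finite T" "T \<subseteq> B 0" "?c ` B 0 = ?c ` T"
        by (meson finite_subset_image subset_refl)
      have "\<exists>t\<in>T. x \<ominus> t \<in> B 1" if x: "x \<in> B 0" for x
      proof -
        have "?c x \<in> ?c ` T" using x T(3) by blast
        then obtain t where t: "t \<in> T" "?c x = ?c t" by blast
        then have "t \<in> B 0" using T(2) by blast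
        then have "x \<ominus> t \<in> B 1" using iffD1[OF ceq[OF x]] t(2) by simp
        then show ?thesis using t(1) by blast
      qed
      then show "\<exists>T. finite T \<and> T \<subseteq> B 0 \<and> (\<forall>x\<in>B 0. \<exists>t\<in>T. x \<ominus> t \<in> B 1)" using T by blast
    next
      assume "\<exists>T. finite T \<and> T \<subseteq> B 0 \<and> (\<forall>x\<in>B 0. \<exists>t\<in>T. x \<ominus> t \<in> B 1)"
      then obtain T where T: "finite T" "T \<subseteq> B 0" "\<forall>x\<in>B 0. \<exists>t\<in>T. x \<ominus> t \<in> B 1" by blast
      have "?c ` B 0 \<subseteq> ?c ` T"
      proof
        fix z assume "z \<in> ?c ` B 0"
        then obtain x where x: "x \<in> B 0" "z = ?c x" by blast
        then obtain t where t: "t \<in> T" "x \<ominus> t \<in> B 1" using T(3) by blast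
        have "t \<in> B 0" using t T(2) by blast
        have "?c x = ?c t" by (rule iffD2[OF ceq[OF x(1) \<open>t \<in> B 0\<close>] t(2)])
        then show "z \<in> ?c ` T" unfolding x(2) by (rule image_eqI[OF _ t(1)])
      qed
      then show "finite (carrier D.residue_field)" unfolding car using T(1) finite_subset by (meson finite_imageI)
    qed
    have comp: "(\<forall>s. range s \<subseteq> carrier ?F \<longrightarrow> D.val_Cauchy s \<longrightarrow> (\<exists>a\<in>carrier ?F. D.val_tendsto s a)) \<longleftrightarrow> complete_set N"
    proof -
      have "(D.val_Cauchy s \<longrightarrow> (\<exists>a\<in>N. D.val_tendsto s a)) \<longleftrightarrow> (Cauchy s \<longrightarrow> (\<exists>a\<in>N. tends s a))"
        if "range s \<subseteq> N" for s
        using C[OF that] T[OF that] by simp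
      then show ?thesis unfolding complete_set_def by simp
    qed
    show ?thesis
      unfolding local_valuation_def local_valuation_axioms_def comp[symmetric] fin[symmetric]
      using dv by blast
  qed
  have dv: "discrete_valuation ?F w" if "local_valuation ?F w"
    using that by (rule local_valuation.axioms(1))
  have LS: "local_subfield R N w \<longleftrightarrow> discrete_valuation ?F w \<and> complete_set N \<and>
      (\<exists>T. finite T \<and> T \<subseteq> B 0 \<and> (\<forall>x\<in>B 0. \<exists>t\<in>T. x \<ominus> t \<in> B 1))"
    unfolding local_subfield_def local_subfield_axioms_def DV using valued_subfield_axioms by simp
  show ?thesis
  proof (cases "discrete_valuation ?F w")
    case True
    show ?thesis unfolding LS LV[OF True] using True by (simp only: simp_thms)
  next
    case False
    then have "\<not> local_valuation ?F w" using dv by (rule contrapos_nn)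
    then show ?thesis unfolding LS using False by (simp only: simp_thms)
  qed
qed

section \<open>Uniqueness of the valuation\<close>

context valued_subfield begin

lemma add_pow_B: "x \<in> B k \<Longrightarrow> (add_pow R (n::nat) x) \<in> B k"
proof (induction n)
  case 0
  then show ?case by simp
next
  case (Suc n)
  then show ?case using B_carrier by (simp add: B_add)
qed

text \<open>The terms of degree at least two in the binomial expansion of (1 + x)^n lie in
  \<open>B (k + k)\<close>.\<close>

lemma one_plus_pow:
  assumes "x \<in> B k" "0 \<le> k"
  shows "((\<one> \<oplus> x) [^] (n::nat) \<ominus> \<one>) \<ominus> (add_pow R n x) \<in> B (k + k)"
proof (induction n)
  case 0
  show ?case by (simp add: a_minus_def r_neg)
next
  case (Suc n)
  have c: "x \<in> carrier R" using assms B_carrier by auto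
  define p where "p = (\<one> \<oplus> x) [^] n"
  define m where "m = (add_pow R n x)"
  have cp: "p \<in> carrier R" "m \<in> carrier R" using c by (auto simp: p_def m_def)
  have x0: "x \<in> B 0" using assms B_mono by blast
  have "((\<one> \<oplus> x) [^] Suc n \<ominus> \<one>) \<ominus> (add_pow R (Suc n) x) = ((p \<ominus> \<one>) \<ominus> m) \<otimes> (\<one> \<oplus> x) \<oplus> m \<otimes> x"
    using c cp unfolding nat_pow_Suc add.nat_pow_Suc p_def[symmetric] m_def[symmetric] a_minus_def by algebra
  moreover have "((p \<ominus> \<one>) \<ominus> m) \<otimes> (\<one> \<oplus> x) \<in> B (k + k)"
    using Suc x0 B0_mult(2) B_add B_one unfolding p_def m_def by blast
  moreover have "m \<otimes> x \<in> B (k + k)" using add_pow_B assms B_mult unfolding m_def by blast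
  ultimately show ?case using B_add by metis
qed

text \<open>With u = 1 + x the difference u^Q - 1 is Q x up to \<open>B (k + k)\<close>. The factor
  Q.1 gains one level, and k + k is at least k + 1 because k is positive.\<close>

lemma pow_raises_level:
  assumes Q: "(add_pow R (Q::nat) \<one>) \<in> B 1" and u: "u \<in> N" "u \<ominus> \<one> \<in> B k" and k: "1 \<le> k"
  shows "u [^] Q \<ominus> \<one> \<in> B (k + 1)"
proof -
  define x where "x = u \<ominus> \<one>"
  have c: "u \<in> carrier R" "x \<in> carrier R" using u N_carrier by (auto simp: x_def)
  have ux: "u = \<one> \<oplus> x" unfolding x_def a_minus_def using c by algebra
  have x: "x \<in> B k" using u by (simp add: x_def)
  have "(u [^] Q \<ominus> \<one>) \<ominus> (add_pow R Q x) \<in> B (k + k)" unfolding ux by (rule one_plus_pow) (use x k in auto)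
  then have 1: "(u [^] Q \<ominus> \<one>) \<ominus> (add_pow R Q x) \<in> B (k + 1)" by (rule B_mono[rotated]) (use k in simp)
  have "(add_pow R Q x) = ((add_pow R Q \<one>)) \<otimes> x" using add_pow_ldistr[of \<one> x Q] c by simp
  then have 2: "(add_pow R Q x) \<in> B (k + 1)" using B_mult[OF Q x] by (simp add: add.commute)
  have "u [^] Q \<ominus> \<one> = ((u [^] Q \<ominus> \<one>) \<ominus> (add_pow R Q x)) \<oplus> (add_pow R Q x)"
    using c by (simp add: a_minus_def a_assoc l_neg)
  then show ?thesis using B_add[OF 1 2] by simp
qed

lemma pow_pow_level:
  assumes Q: "(add_pow R (Q::nat) \<one>) \<in> B 1" and u: "u \<in> N" "u \<ominus> \<one> \<in> B 1"
  shows "u [^] (Q ^ n) \<ominus> \<one> \<in> B (1 + int n)"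
proof (induction n)
  case 0
  then show ?case using u N_carrier by simp
next
  case (Suc n)
  have "u [^] (Q ^ Suc n) = (u [^] (Q ^ n)) [^] Q"
    using u N_carrier by (simp add: nat_pow_pow mult.commute)
  moreover have "(u [^] (Q ^ n)) [^] Q \<ominus> \<one> \<in> B ((1 + int n) + 1)"
    by (rule pow_raises_level[OF Q _ Suc]) (use u in auto)
  ultimately show ?case by (simp add: add.commute)
qed

end

context local_subfield begin

text \<open>Two natural numbers have the same image in the finite residue field, so their difference
  d lies in the maximal ideal. It is tripled to ensure Q - 1 \<ge> 2, which drives the descent in
  \<open>valuation_unique\<close>.\<close>

lemma exists_small_multiple: "\<exists>Q::nat. 3 \<le> Q \<and> (add_pow R Q \<one>) \<in> B 1"
proof -
  obtain T where T: "finite T" "T \<subseteq> B 0" "\<forall>x\<in>B 0. \<exists>t\<in>T. x \<ominus> t \<in> B 1" using finite_reps by blast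
  have "\<forall>n::nat. \<exists>t\<in>T. (add_pow R n \<one>) \<ominus> t \<in> B 1" using T(3) add_pow_B[OF B_one] by blast
  then obtain f where f: "\<And>n::nat. f n \<in> T" "\<And>n::nat. (add_pow R n \<one>) \<ominus> f n \<in> B 1" by metis
  have "\<not> inj f"
  proof
    assume "inj f"
    then have "finite (UNIV :: nat set)" using f(1) T(1)
      by (metis (no_types) finite_imageD finite_subset image_subsetI)
    then show False by simp
  qed
  then obtain i j where ij: "f i = f j" "i < j" unfolding inj_def by (metis linorder_neqE_nat)
  have fN: "f i \<in> N" using f(1) T(2) B_N by blast
  have "(add_pow R j \<one>) \<ominus> (add_pow R i \<one>) \<in> B 1"
    using f(2)[of i] f(2)[of j] ij fN add_pow_B[OF B_one] B_N B_minus_sym B_minus_trans by metis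
  moreover have "(add_pow R j \<one>) = (add_pow R (j - i) \<one>) \<oplus> (add_pow R i \<one>)"
    using add.nat_pow_mult[of \<one> "j - i" i] ij by simp
  moreover have "((add_pow R (j - i) \<one>) \<oplus> (add_pow R i \<one>)) \<ominus> (add_pow R i \<one>) = (add_pow R (j - i) \<one>)"
    by (simp add: a_minus_def a_assoc r_neg)
  ultimately have d: "(add_pow R (j - i) \<one>) \<in> B 1" by simp
  define d where "d = j - i"
  have "(add_pow R (d + d + d) \<one>) = (add_pow R d \<one>) \<oplus> (add_pow R d \<one>) \<oplus> (add_pow R d \<one>)"
    using add.nat_pow_mult[of \<one> d d] add.nat_pow_mult[of \<one> "d + d" d] by simp
  then have "(add_pow R (d + d + d) \<one>) \<in> B 1" using d B_add unfolding d_def by auto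
  moreover have "3 \<le> d + d + d" using ij by (simp add: d_def)
  ultimately show ?thesis by blast
qed

text \<open>The root is a limit of powers of \<open>u\<close>: the exponents \<open>1 + Q + \<dots> + Q\<^sup>n\<close> converge
  \<open>Q\<close>-adically to \<open>1 / (1 - Q)\<close>.\<close>

lemma principal_unit_root:
  assumes Q: "(add_pow R (Q::nat) \<one>) \<in> B 1" "1 \<le> Q" and u: "u \<in> N" "u \<ominus> \<one> \<in> B 1"
  shows "\<exists>y\<in>N. y \<ominus> \<one> \<in> B 1 \<and> y [^] (Q - 1) \<otimes> u = \<one>"
proof -
  define a where "a n = (\<Sum>i<n. Q ^ i)" for n
  define s where "s n = u [^] a n" for n
  have uc: "u \<in> carrier R" using u N_carrier by simp
  have u0: "u \<in> B 0"
  proof -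
    have "u = (u \<ominus> \<one>) \<oplus> \<one>" using uc unfolding a_minus_def by algebra
    moreover have "u \<ominus> \<one> \<in> B 0" using u B_mono[of 0 1] by simp
    ultimately show ?thesis using B_add B_one by metis
  qed
  have s0: "s n \<in> B 0" for n unfolding s_def using B_pow u0 by simp
  have sN: "range s \<subseteq> N" using s0 B_N by blast
  have s1: "s n \<ominus> \<one> \<in> B 1" for n
    unfolding s_def using B_pow_cong[OF u0 B_one u(2), of "a n"] by simp
  \<comment> \<open>The finite form of 1 + Q + ... = 1 / (1 - Q). It turns
    \<open>s n [^] (Q - 1) \<otimes> u\<close> into \<open>u [^] (Q ^ n)\<close>, which tends to 1
    by \<open>pow_pow_level\<close>.\<close>
  have aQ: "a n * (Q - 1) + 1 = Q ^ n" for n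
  proof (induction n)
    case (Suc n)
    have "a (Suc n) * (Q - 1) + 1 = (a n * (Q - 1) + 1) + Q ^ n * (Q - 1)"
      by (simp add: a_def algebra_simps)
    also have "\<dots> = Q ^ n * (1 + (Q - 1))" unfolding Suc by (simp only: distrib_left mult_1_right)
    finally show ?case using Q(2) by simp
  qed (simp add: a_def)
  have "Cauchy s"
  proof (rule Cauchy_stepI[OF sN])
    fix n
    have "s (Suc n) = s n \<otimes> u [^] (Q ^ n)"
      using uc by (simp add: s_def a_def nat_pow_mult)
    then have "s (Suc n) \<ominus> s n = s n \<otimes> (u [^] (Q ^ n) \<ominus> \<one>)"
      using uc unfolding a_minus_def s_def by (simp add: r_distr r_minus)
    then show "s (Suc n) \<ominus> s n \<in> B (1 + int n)"
      using B0_mult(1)[OF s0 pow_pow_level[OF Q(1) u]] by metis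
  qed
  then obtain y where y: "y \<in> N" "tends s y"
    using completeN sN unfolding complete_set_def by blast
  have near: "\<exists>n\<ge>m. y \<ominus> s n \<in> B k" for m k
  proof -
    obtain n0 where "\<forall>n\<ge>n0. s n \<ominus> y \<in> B k" using y(2) unfolding tends_def by blast
    then have "s (max m n0) \<ominus> y \<in> B k" by simp
    then have "y \<ominus> s (max m n0) \<in> B k" using B_minus_sym y(1) sN by blast
    then show ?thesis by (intro exI[of _ "max m n0"]) simp
  qed
  have y1: "y \<ominus> \<one> \<in> B 1"
  proof -
    obtain n where "y \<ominus> s n \<in> B 1" using near by blast
    then show ?thesis using B_minus_trans[OF _ s1] y(1) sN by blast
  qed
  have yc: "y \<in> carrier R" using y N_carrier by simp
  have y0: "y \<in> B 0"
  proof -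
    have "y = (y \<ominus> \<one>) \<oplus> \<one>" using yc unfolding a_minus_def by algebra
    moreover have "y \<ominus> \<one> \<in> B 0" using y1 B_mono[of 0 1] by simp
    ultimately show ?thesis using B_add B_one by metis
  qed
  have "y [^] (Q - 1) \<otimes> u \<ominus> \<one> \<in> B k" for k
  proof -
    obtain n where n: "n \<ge> nat k" "y \<ominus> s n \<in> B k" using near by blast
    have sc: "s n \<in> carrier R" using s0 B_carrier by blast
    have "y [^] (Q - 1) \<ominus> s n [^] (Q - 1) \<in> B k" by (rule B_pow_cong[OF y0 s0 n(2)])
    then have 1: "(y [^] (Q - 1) \<ominus> s n [^] (Q - 1)) \<otimes> u \<in> B k" using u0 B0_mult(2) by simp
    have "s n [^] (Q - 1) \<otimes> u = u [^] (a n * (Q - 1) + 1)"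
      using uc by (simp add: s_def nat_pow_pow nat_pow_mult[symmetric])
    then have e: "s n [^] (Q - 1) \<otimes> u = u [^] (Q ^ n)" unfolding aQ .
    have "u [^] (Q ^ n) \<ominus> \<one> \<in> B k"
      by (rule B_mono[OF _ pow_pow_level[OF Q(1) u]]) (use n(1) in linarith)
    then have 2: "s n [^] (Q - 1) \<otimes> u \<ominus> \<one> \<in> B k" unfolding e .
    define p where "p = y [^] (Q - 1)"
    define q where "q = s n [^] (Q - 1)"
    have pq: "p \<in> carrier R" "q \<in> carrier R" using yc sc by (auto simp: p_def q_def)
    have "p \<otimes> u \<ominus> \<one> = (p \<ominus> q) \<otimes> u \<oplus> (q \<otimes> u \<ominus> \<one>)"
      using pq uc unfolding a_minus_def by algebra
    then show ?thesis using B_add[OF 1 2] unfolding p_def q_def by metis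
  qed
  then have "y [^] (Q - 1) \<otimes> u \<ominus> \<one> = \<zero>" by (rule B_separated)
  then have "y [^] (Q - 1) \<otimes> u = \<one>" using yc uc by simp
  then show ?thesis using y(1) y1 by blast
qed

text \<open>By the preceding lemma the value of a principal unit is divisible by every power of
  \<open>Q - 1\<close>, hence zero.\<close>

theorem valuation_unique:
  assumes "valued_subfield R N w'"
  shows "\<exists>c\<ge>0. \<forall>x\<in>N. x \<noteq> \<zero> \<longrightarrow> w' x = c * w x"
proof -
  interpret V: valued_subfield R N w' by fact
  obtain Q :: nat where Q: "3 \<le> Q" "(add_pow R Q \<one>) \<in> B 1" using exists_small_multiple by blast
  have nz: "u \<noteq> \<zero>" if "u \<ominus> \<one> \<in> B 1" for u
  proof
    assume "u = \<zero>"
    then have "\<ominus> (u \<ominus> \<one>) = \<one>" by (simp add: a_minus_def)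
    then show False using B_uminus[OF that] one_notin_B1 by simp
  qed
  have S: "w' u = 0" if "u \<in> N" "u \<ominus> \<one> \<in> B 1" for u
    using that
  proof (induction "nat \<bar>w' u\<bar>" arbitrary: u rule: less_induct)
    case less
    obtain y where y: "y \<in> N" "y \<ominus> \<one> \<in> B 1" "y [^] (Q - 1) \<otimes> u = \<one>"
      using principal_unit_root[OF Q(2) _ less(2,3)] Q(1) by auto
    have nzy: "y \<noteq> \<zero>" "u \<noteq> \<zero>" using nz y less by auto
    have "w' (y [^] (Q - 1) \<otimes> u) = 0" unfolding y(3) by (rule V.w_one)
    then have eq: "int (Q - 1) * w' y + w' u = 0"
      using nzy y(1) less(2) by (simp add: V.w_mult V.w_pow V.N_pow_nz)
    show ?case
    proof (rule ccontr)
      assume "w' u \<noteq> 0"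
      then have "w' y \<noteq> 0" using eq by auto
      have "\<bar>w' u\<bar> = int (Q - 1) * \<bar>w' y\<bar>" using eq by (metis abs_minus abs_mult abs_of_nat add_eq_0_iff)
      moreover have "int (Q - 1) * \<bar>w' y\<bar> \<ge> 2 * \<bar>w' y\<bar>" using Q(1) by (intro mult_right_mono) auto
      ultimately have "\<bar>w' y\<bar> < \<bar>w' u\<bar>" using \<open>w' y \<noteq> 0\<close> by linarith
      then have "nat \<bar>w' y\<bar> < nat \<bar>w' u\<bar>" by linarith
      from less(1)[OF this y(1,2)] have "w' y = 0" .
      then show False using \<open>w' y \<noteq> 0\<close> by simp
    qed
  qed
  \<comment> \<open>x is the difference of 1 + x and 1, both of value 0 under w'.\<close>
  have pos1: "0 \<le> w' x" if x: "x \<in> B 1" "x \<noteq> \<zero>" for x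
  proof -
    have xN: "x \<in> N" and xc: "x \<in> carrier R" using x B_N B_carrier by auto
    have e: "(\<one> \<oplus> x) \<ominus> \<one> = x" using xc unfolding a_minus_def by algebra
    then have e1: "(\<one> \<oplus> x) \<ominus> \<one> \<in> B 1" using x by simp
    have e2: "(\<one> \<oplus> x) \<oplus> \<ominus> \<one> = x" using e by (simp add: a_minus_def)
    have o: "\<ominus> \<one> \<noteq> \<zero>" by (metis N_closed(2) N_carrier minus_minus minus_zero one_not_zero)
    have "min (w' (\<one> \<oplus> x)) (w' (\<ominus> \<one>)) \<le> w' ((\<one> \<oplus> x) \<oplus> \<ominus> \<one>)"
      by (rule V.w_add) (use xN nz[OF e1] e2 x o in auto)
    then show ?thesis using S[OF _ e1] xN e2 V.w_minus_one by simp
  qed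
  obtain p where p: "p \<in> N" "p \<noteq> \<zero>" "w p = 1" using w_surj by blast
  \<comment> \<open>If w' y were negative, a high power of y would outweigh p:
    \<open>y [^] n \<otimes> p\<close> still lies in \<open>B 1\<close>, but for n = |w' p| + 1 its
    value under w' is negative.\<close>
  have pos0: "0 \<le> w' y" if y: "y \<in> N" "y \<noteq> \<zero>" "0 \<le> w y" for y
  proof (rule ccontr)
    assume neg: "\<not> 0 \<le> w' y"
    define n where "n = nat (\<bar>w' p\<bar> + 1)"
    have "y [^] n \<otimes> p \<in> B 1"
      using y p by (simp add: B_def w_mult w_pow N_pow_nz)
    then have "0 \<le> w' (y [^] n \<otimes> p)" using pos1 y p by (simp add: N_mult_nz N_pow_nz)
    then have "0 \<le> int n * w' y + w' p" using y p by (simp add: V.w_mult V.w_pow V.N_pow_nz)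
    moreover have "int n * w' y \<le> int n * (-1)" using neg by (intro mult_left_mono) auto
    moreover have "int n = \<bar>w' p\<bar> + 1" by (simp add: n_def)
    ultimately show False by linarith
  qed
  have unit: "w' y = 0" if y: "y \<in> N" "y \<noteq> \<zero>" "w y = 0" for y
  proof -
    have "0 \<le> w' y" using pos0 y by simp
    moreover have "0 \<le> w' (inv y)" using pos0[of "inv y"] N_inv[OF y(1,2)] w_inv[OF y(1,2)] y(3) by simp
    ultimately show ?thesis using V.w_inv[OF y(1,2)] by simp
  qed
  \<comment> \<open>Dividing x by a power of the uniformiser p leaves a unit, on which w' vanishes;
    so the factor is w' p.\<close>
  have pos: "w' x = w' p * w x" if x: "x \<in> N" "x \<noteq> \<zero>" "0 \<le> w x" for x
  proof -
    obtain n where n: "w x = int n" using x(3) nonneg_int_cases by blast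
    have pn: "p [^] n \<in> N" "p [^] n \<noteq> \<zero>" using p N_pow_nz by auto
    define z where "z = x \<otimes> inv (p [^] n)"
    have z: "z \<in> N" "z \<noteq> \<zero>" using x pn N_inv N_mult_nz by (auto simp: z_def)
    have "w z = 0"
      using x p N_inv[OF pn] w_inv[OF pn] by (simp add: z_def w_mult w_pow n)
    then have "w' z = 0" using unit z by simp
    then have "w' x - int n * w' p = 0"
      using x p N_inv[OF pn] V.w_inv[OF pn] by (simp add: z_def V.w_mult V.w_pow)
    then show ?thesis by (simp add: n)
  qed
  have "w' x = w' p * w x" if x: "x \<in> N" "x \<noteq> \<zero>" for x
  proof (cases "0 \<le> w x")
    case False
    then have "w' (inv x) = w' p * w (inv x)"
      using pos N_inv[OF x] w_inv[OF x] by simp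
    then show ?thesis using w_inv[OF x] V.w_inv[OF x] by simp
  qed (use pos x in simp)
  moreover have "0 \<le> w' p" using pos0 p by simp
  ultimately show ?thesis by blast
qed

end

section \<open>Finite-dimensional subspaces\<close>

context valued_subfield begin

lemma tends_add:
  assumes "tends s a" "tends t b" "range s \<subseteq> N" "range t \<subseteq> N" "a \<in> N" "b \<in> N"
  shows "tends (\<lambda>n. s n \<oplus> t n) (a \<oplus> b)"
  unfolding tends_def
proof
  fix k
  obtain n1 where n1: "\<forall>n\<ge>n1. s n \<ominus> a \<in> B k" using assms(1) by (auto simp: tends_def)
  obtain n2 where n2: "\<forall>n\<ge>n2. t n \<ominus> b \<in> B k" using assms(2) by (auto simp: tends_def)
  have "(s n \<oplus> t n) \<ominus> (a \<oplus> b) \<in> B k" if "n \<ge> max n1 n2" for n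
  proof -
    have c: "s n \<in> carrier R" "t n \<in> carrier R" "a \<in> carrier R" "b \<in> carrier R"
      using assms N_carrier by auto
    have "(s n \<oplus> t n) \<ominus> (a \<oplus> b) = (s n \<ominus> a) \<oplus> (t n \<ominus> b)"
      using c unfolding a_minus_def by algebra
    then show ?thesis using n1 n2 that B_add by auto
  qed
  then show "\<exists>n0. \<forall>n\<ge>n0. (s n \<oplus> t n) \<ominus> (a \<oplus> b) \<in> B k" by blast
qed

lemma exists_level: "b \<in> N \<Longrightarrow> \<exists>D. b \<in> B D"
  by (auto simp: B_def)

lemma tends_mult_const:
  assumes "tends s a" "range s \<subseteq> N" "a \<in> N" "b \<in> N"
  shows "tends (\<lambda>n. s n \<otimes> b) (a \<otimes> b)"
  unfolding tends_def
proof
  fix k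
  obtain D where D: "b \<in> B D" using exists_level assms by blast
  obtain n1 where n1: "\<forall>n\<ge>n1. s n \<ominus> a \<in> B (k - D)" using assms(1) by (auto simp: tends_def)
  have "s n \<otimes> b \<ominus> a \<otimes> b \<in> B k" if "n \<ge> n1" for n
  proof -
    have c: "s n \<in> carrier R" "a \<in> carrier R" "b \<in> carrier R"
      using assms N_carrier by auto
    have "s n \<otimes> b \<ominus> a \<otimes> b = (s n \<ominus> a) \<otimes> b"
      using c unfolding a_minus_def by algebra
    moreover have "(s n \<ominus> a) \<otimes> b \<in> B ((k - D) + D)" using B_mult n1 that D by blast
    ultimately show ?thesis by simp
  qed
  then show "\<exists>n0. \<forall>n\<ge>n0. s n \<otimes> b \<ominus> a \<otimes> b \<in> B k" by blast
qed

lemma tends_Cauchy: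
  assumes "tends s a" "range s \<subseteq> N" "a \<in> N"
  shows "Cauchy s"
  unfolding Cauchy_def
proof
  fix k
  obtain n1 where n1: "\<forall>n\<ge>n1. s n \<ominus> a \<in> B k" using assms(1) by (auto simp: tends_def)
  then have "s m \<ominus> s n \<in> B k" if "m \<ge> n1" "n \<ge> n1" for m n
    using that B_minus_sym B_minus_trans assms by (metis range_subsetD)
  then show "\<exists>n0. \<forall>m\<ge>n0. \<forall>n\<ge>n0. s m \<ominus> s n \<in> B k" by blast
qed

lemma Cauchy_minus:
  assumes "Cauchy s" "Cauchy t" "range s \<subseteq> N" "range t \<subseteq> N"
  shows "Cauchy (\<lambda>n. s n \<ominus> t n)"
  unfolding Cauchy_def
proof
  fix k
  obtain n1 where n1: "\<forall>m\<ge>n1. \<forall>n\<ge>n1. s m \<ominus> s n \<in> B k" using assms(1) unfolding Cauchy_def by blast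
  obtain n2 where n2: "\<forall>m\<ge>n2. \<forall>n\<ge>n2. t m \<ominus> t n \<in> B k" using assms(2) unfolding Cauchy_def by blast
  have "(s m \<ominus> t m) \<ominus> (s n \<ominus> t n) \<in> B k" if "m \<ge> max n1 n2" "n \<ge> max n1 n2" for m n
  proof -
    have c: "s n \<in> carrier R" "t n \<in> carrier R" "s m \<in> carrier R" "t m \<in> carrier R"
      using assms N_carrier by auto
    have "(s m \<ominus> t m) \<ominus> (s n \<ominus> t n) = (s m \<ominus> s n) \<ominus> (t m \<ominus> t n)"
      using c unfolding a_minus_def by algebra
    then show ?thesis using n1 n2 that B_minus by auto
  qed
  then show "\<exists>n0. \<forall>m\<ge>n0. \<forall>n\<ge>n0. (s m \<ominus> t m) \<ominus> (s n \<ominus> t n) \<in> B k" by blast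
qed

lemma complete_setD:
  "complete_set U \<Longrightarrow> range s \<subseteq> U \<Longrightarrow> Cauchy s \<Longrightarrow> \<exists>a\<in>U. tends s a"
  by (simp add: complete_set_def)

text \<open>A complete set is closed: if elements of U approximated b to every level, they would
  form a Cauchy sequence with limit b, and the limit lies in U.\<close>

lemma complete_set_gap:
  assumes "complete_set U" "U \<subseteq> N" "b \<in> N" "b \<notin> U"
  shows "\<exists>C. \<forall>u\<in>U. b \<ominus> u \<notin> B C"
proof (rule ccontr)
  assume "\<not> ?thesis"
  then have "\<forall>n::nat. \<exists>u\<in>U. b \<ominus> u \<in> B (int n)" by blast
  then obtain s where s: "\<And>n. s n \<in> U" "\<And>n. b \<ominus> s n \<in> B (int n)" by metis
  have sN: "range s \<subseteq> N" using s assms(2) by blast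
  have tb: "tends s b" unfolding tends_def
  proof
    fix k
    have "s n \<ominus> b \<in> B k" if "n \<ge> nat k" for n
    proof -
      have "k \<le> int n" using that by linarith
      then have "b \<ominus> s n \<in> B k" using s(2) B_mono by blast
      then show ?thesis using B_minus_sym assms(3) sN by blast
    qed
    then show "\<exists>n0. \<forall>n\<ge>n0. s n \<ominus> b \<in> B k" by blast
  qed
  then have "Cauchy s" using tends_Cauchy sN assms(3) by blast
  then obtain a where a: "a \<in> U" "tends s a"
    using assms(1) s(1) unfolding complete_set_def by blast
  then have "a = b" using tends_unique tb sN assms by blast
  then show False using a assms by simp
qed

end

text \<open>One more digit at a time: representatives of the residue field, scaled by an element z
  of value k + j, refine the approximation by one level. This is the form of finiteness of the
  residue field that passes to finite-dimensional spaces.\<close>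

lemma (in local_subfield) totally_bounded:
  "\<exists>T. finite T \<and> T \<subseteq> N \<and> (\<forall>x\<in>B k. \<exists>t\<in>T. x \<ominus> t \<in> B (k + int j))"
proof (induction j)
  case 0
  have "x \<ominus> \<zero> \<in> B (k + int 0)" if "x \<in> B k" for x
    using that B_carrier[OF that] by (simp add: a_minus_def)
  then show ?case by (intro exI[of _ "{\<zero>}"]) auto
next
  case (Suc j)
  then obtain T where T: "finite T" "T \<subseteq> N" "\<forall>x\<in>B k. \<exists>t\<in>T. x \<ominus> t \<in> B (k + int j)" by blast
  obtain S where S: "finite S" "S \<subseteq> B 0" "\<forall>x\<in>B 0. \<exists>t\<in>S. x \<ominus> t \<in> B 1" using finite_reps by blast
  obtain z where z: "z \<in> N" "z \<noteq> \<zero>" "w z = k + int j" using w_surj by blast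
  define T' where "T' = (\<lambda>(t, r). t \<oplus> r \<otimes> z) ` (T \<times> S)"
  have "\<exists>t\<in>T'. x \<ominus> t \<in> B (k + int (Suc j))" if x: "x \<in> B k" for x
  proof -
    obtain t where t: "t \<in> T" "x \<ominus> t \<in> B (k + int j)" using T x by blast
    have zi: "inv z \<in> B (- (k + int j))" using w_inv[OF z(1,2)] z N_inv[OF z(1,2)] by (simp add: B_def)
    have "(x \<ominus> t) \<otimes> inv z \<in> B 0" using B_mult[OF t(2) zi] by simp
    then obtain r where r: "r \<in> S" "(x \<ominus> t) \<otimes> inv z \<ominus> r \<in> B 1" using S by blast
    have c: "x \<in> carrier R" "t \<in> carrier R" "r \<in> carrier R" "z \<in> carrier R" "inv z \<in> carrier R"
      using x t T(2) r S(2) z N_inv[OF z(1,2)] N_carrier B_carrier by blast+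
    have iz: "inv z \<otimes> z = \<one>" using N_inv z by blast
    have "((x \<ominus> t) \<otimes> inv z \<ominus> r) \<otimes> z = (x \<ominus> t) \<otimes> (inv z \<otimes> z) \<ominus> r \<otimes> z"
      using c unfolding a_minus_def by algebra
    also have "\<dots> = x \<ominus> (t \<oplus> r \<otimes> z)" unfolding iz using c unfolding a_minus_def by algebra
    finally have "((x \<ominus> t) \<otimes> inv z \<ominus> r) \<otimes> z = x \<ominus> (t \<oplus> r \<otimes> z)" .
    moreover have "z \<in> B (k + int j)" using z by (simp add: B_def)
    ultimately have "x \<ominus> (t \<oplus> r \<otimes> z) \<in> B (1 + (k + int j))" using B_mult[OF r(2)] by metis
    then show ?thesis using t r unfolding T'_def by (auto simp: add_ac)
  qed
  moreover have "finite T'" using T S by (simp add: T'_def)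
  moreover have "T' \<subseteq> N" using T(2) S(2) z(1) B_N unfolding T'_def by (auto simp: subset_iff)
  ultimately show ?case by blast
qed

text \<open>e becomes the ramification index once w is normalised; its positivity says that w is not
  trivial on K.\<close>

locale local_base = valued_subfield R N w + K: local_subfield R K v
  for R (structure) and N w K v +
  fixes e :: int
  assumes KN: "K \<subseteq> N" and e_pos: "0 < e"
    and w_base: "\<lbrakk> x \<in> K; x \<noteq> \<zero> \<rbrakk> \<Longrightarrow> w x = e * v x"
begin

lemma base_B: "x \<in> K.B j \<Longrightarrow> x \<in> B (e * j)"
  using e_pos KN w_base by (auto simp: B_def K.B_def)

lemma B_base: "x \<in> K \<Longrightarrow> x \<in> B k \<Longrightarrow> x \<in> K.B (k div e)"
proof -
  assume x: "x \<in> K" "x \<in> B k"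
  show ?thesis
  proof (cases "x = \<zero>")
    case False
    then have "k \<le> e * v x" using x w_base by (simp add: B_def)
    then have "k div e \<le> (e * v x) div e" using e_pos by (intro zdiv_mono1) auto
    then show ?thesis using e_pos x by (simp add: K.B_def)
  qed simp
qed

lemma base_covered:
  "\<exists>T. finite T \<and> T \<subseteq> K \<and> (\<forall>x\<in>K \<inter> B k. \<exists>t\<in>T. x \<ominus> t \<in> B l)"
proof -
  \<comment> \<open>Makes \<open>k div e + int j\<close> at least |l|; since e \<ge> 1, the level e
    * (k div e + j) in N is then at least l.\<close>
  define j where "j = nat (\<bar>l\<bar> + \<bar>k div e\<bar>)"
  obtain T where T: "finite T" "T \<subseteq> K" "\<forall>x\<in>K.B (k div e). \<exists>t\<in>T. x \<ominus> t \<in> K.B (k div e + int j)"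
    using K.totally_bounded[of "k div e" j] by blast
  have "\<bar>l\<bar> \<le> k div e + int j" by (simp add: j_def)
  moreover have "1 * \<bar>l\<bar> \<le> e * \<bar>l\<bar>" using e_pos by (intro mult_right_mono) auto
  ultimately have le: "l \<le> e * (k div e + int j)"
    using e_pos by (smt (verit) mult_left_mono)
  have "\<exists>t\<in>T. x \<ominus> t \<in> B l" if "x \<in> K \<inter> B k" for x
  proof -
    have "x \<in> K.B (k div e)" using that B_base by blast
    then obtain t where t: "t \<in> T" "x \<ominus> t \<in> K.B (k div e + int j)" using T by blast
    then show ?thesis using base_B B_mono le by blast
  qed
  then show ?thesis using T by blast
qed

lemma base_complete: "complete_set K"
  unfolding complete_set_def
proof (intro allI impI)
  fix s assume s: "range s \<subseteq> K" "Cauchy s"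
  have "K.Cauchy s" unfolding K.Cauchy_def
  proof
    fix k
    obtain n0 where "\<forall>m\<ge>n0. \<forall>n\<ge>n0. s m \<ominus> s n \<in> B (e * k)" using s(2) unfolding Cauchy_def by blast
    then have "s m \<ominus> s n \<in> K.B k" if "m \<ge> n0" "n \<ge> n0" for m n
      using that B_base[of "s m \<ominus> s n" "e * k"] s(1) e_pos by (simp add: K.N_minus range_subsetD)
    then show "\<exists>n0. \<forall>m\<ge>n0. \<forall>n\<ge>n0. s m \<ominus> s n \<in> K.B k" by blast
  qed
  then obtain a where a: "a \<in> K" "K.tends s a" using K.completeN s(1) unfolding K.complete_set_def by blast
  have "tends s a" unfolding tends_def
  proof
    fix k
    obtain n0 where n0: "\<forall>n\<ge>n0. s n \<ominus> a \<in> K.B \<bar>k\<bar>" using a(2) unfolding K.tends_def by blast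
    have "1 * \<bar>k\<bar> \<le> e * \<bar>k\<bar>" using e_pos by (intro mult_right_mono) auto
    then have "k \<le> e * \<bar>k\<bar>" by linarith
    then have "\<forall>n\<ge>n0. s n \<ominus> a \<in> B k" using n0 base_B B_mono by blast
    then show "\<exists>n0. \<forall>n\<ge>n0. s n \<ominus> a \<in> B k" by blast
  qed
  then show "\<exists>a\<in>K. tends s a" using a by blast
qed

lemma Span_sub: "set Us \<subseteq> N \<Longrightarrow> Span K Us \<subseteq> N"
proof (induction Us)
  case (Cons b Us)
  then show ?case using KN by (auto simp: line_extension_mem_iff subset_iff)
qed simp

text \<open>Induction on the spanning list. If b is not in the complete space U, it keeps a positive
  distance from U, so that a bound on c b + u bounds the scalar c. Completeness and covering then
  both split into a statement about c in K and one about u in U. The two are proved together because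
  the distance comes from the completeness of U.\<close>

lemma Span_complete_bounded:
  assumes "set Us \<subseteq> N"
  shows "complete_set (Span K Us) \<and>
    (\<forall>k l. \<exists>T. finite T \<and> T \<subseteq> N \<and> (\<forall>x\<in>Span K Us \<inter> B k. \<exists>t\<in>T. x \<ominus> t \<in> B l))"
  using assms
proof (induction Us)
  case Nil
  have "complete_set {\<zero>}" unfolding complete_set_def
  proof (intro allI impI)
    fix s :: "nat \<Rightarrow> 'a" assume "range s \<subseteq> {\<zero>}"
    then have "s n = \<zero>" for n by blast
    then have "tends s \<zero>" by (simp add: tends_def a_minus_def)
    then show "\<exists>a\<in>{\<zero>}. tends s a" by blast
  qed
  moreover have "\<exists>T. finite T \<and> T \<subseteq> N \<and> (\<forall>x\<in>{\<zero>} \<inter> B k. \<exists>t\<in>T. x \<ominus> t \<in> B l)" for k l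
    by (intro exI[of _ "{\<zero>}"]) (auto simp: a_minus_def)
  ultimately show ?case by simp
next
  case (Cons b Us)
  define U where "U = Span K Us"
  have bN: "b \<in> N" and UsN: "set Us \<subseteq> N" using Cons by auto
  have Usc: "set Us \<subseteq> carrier R" and bc: "b \<in> carrier R" using UsN bN N_carrier by auto
  have UN: "U \<subseteq> N" using Span_sub UsN by (simp add: U_def)
  have sf: "subfield K R" by (rule K.subfieldN)
  note sp = Span_subgroup_props[OF sf Usc, folded U_def] Span_smult_closed[OF sf Usc, folded U_def]
  have IH: "complete_set U" "\<And>k l. \<exists>T. finite T \<and> T \<subseteq> N \<and> (\<forall>x\<in>U \<inter> B k. \<exists>t\<in>T. x \<ominus> t \<in> B l)"
    using Cons UsN by (auto simp: U_def)
  have Sp: "x \<in> Span K (b # Us) \<longleftrightarrow> (\<exists>c\<in>K. \<exists>u\<in>U. x = c \<otimes> b \<oplus> u)" for x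
    by (simp add: line_extension_mem_iff U_def)
  show ?case
  proof (cases "b \<in> U")
    case True
    have "Span K (b # Us) = U"
    proof
      show "Span K (b # Us) \<subseteq> U"
      proof
        fix x assume "x \<in> Span K (b # Us)"
        then obtain c u where "c \<in> K" "u \<in> U" "x = c \<otimes> b \<oplus> u" unfolding Sp by blast
        then show "x \<in> U" using sp(3)[OF sp(5)] True by simp
      qed
      show "U \<subseteq> Span K (b # Us)" using mono_Span[OF sf Usc bc] by (simp add: U_def)
    qed
    then show ?thesis using IH by simp
  next
    case False
    obtain C where C: "\<forall>u\<in>U. b \<ominus> u \<notin> B C" using complete_set_gap IH(1) UN bN False by blast
    obtain D where D: "b \<in> B D" using exists_level bN by blast
    \<comment> \<open>Division by c gives b + c^-1 u, the difference of b and an element of U, which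
      is therefore not in \<open>B C\<close>.\<close>
    have L: "c \<in> B (k - C)" if c: "c \<in> K" and u: "u \<in> U" and x: "c \<otimes> b \<oplus> u \<in> B k" for c u k
    proof (cases "c = \<zero>")
      case nz: False
      have cN: "c \<in> N" using c KN by blast
      have ic: "inv c \<in> K" "inv c \<otimes> c = \<one>" using K.N_inv c nz by auto
      have icN: "inv c \<in> N" using ic KN by blast
      have cc: "c \<in> carrier R" "u \<in> carrier R" "inv c \<in> carrier R" using cN icN u UN N_carrier by auto
      have "inv c \<otimes> u \<in> U" by (rule sp(5)[OF ic(1) u])
      then have "\<ominus> (inv c \<otimes> u) \<in> U" by (rule sp(4))
      then have "b \<ominus> (\<ominus> (inv c \<otimes> u)) \<notin> B C" using C by blast
      moreover have "b \<ominus> (\<ominus> (inv c \<otimes> u)) = inv c \<otimes> (c \<otimes> b \<oplus> u)"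
      proof -
        have "inv c \<otimes> (c \<otimes> b \<oplus> u) = (inv c \<otimes> c) \<otimes> b \<oplus> inv c \<otimes> u" using cc bc by algebra
        then show ?thesis using ic cc bc by (simp add: a_minus_def)
      qed
      ultimately have n: "inv c \<otimes> (c \<otimes> b \<oplus> u) \<notin> B C" by simp
      have "inv c \<in> B (- w c)" using icN w_inv[OF cN nz] by (simp add: B_def)
      then have "inv c \<otimes> (c \<otimes> b \<oplus> u) \<in> B (- w c + k)" using B_mult x by blast
      then have "\<not> C \<le> - w c + k" using n B_mono by blast
      then show ?thesis using cN by (simp add: B_def)
    qed simp
    have comp: "complete_set (Span K (b # Us))" unfolding complete_set_def
    proof (intro allI impI)
      fix s assume s: "range s \<subseteq> Span K (b # Us)" "Cauchy s"
      have "\<forall>n. \<exists>c u. c \<in> K \<and> u \<in> U \<and> s n = c \<otimes> b \<oplus> u" using s(1) Sp by blast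
      then obtain c u where cu: "\<And>n. c n \<in> K" "\<And>n. u n \<in> U" "\<And>n. s n = c n \<otimes> b \<oplus> u n" by metis
      have cN: "range c \<subseteq> N" "range u \<subseteq> N" "range c \<subseteq> K" "range u \<subseteq> U" using cu KN UN by auto
      have cc: "c n \<in> carrier R" "u n \<in> carrier R" for n using cN N_carrier by blast+
      have cN': "c n \<in> N" "u n \<in> N" for n using cN by blast+
      have sN: "range s \<subseteq> N" using cu(3) cN' bN by auto
      have "Cauchy c" unfolding Cauchy_def
      proof
        fix k
        obtain n0 where n0: "\<forall>m\<ge>n0. \<forall>n\<ge>n0. s m \<ominus> s n \<in> B (k + C)" using s(2) unfolding Cauchy_def by blast
        have "c m \<ominus> c n \<in> B k" if "m \<ge> n0" "n \<ge> n0" for m n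
        proof -
          have "s m \<ominus> s n = (c m \<ominus> c n) \<otimes> b \<oplus> (u m \<ominus> u n)"
            using cc[of m] cc[of n] bc unfolding cu(3) a_minus_def by algebra
          moreover have "s m \<ominus> s n \<in> B (k + C)" using n0 that by blast
          ultimately have "(c m \<ominus> c n) \<otimes> b \<oplus> (u m \<ominus> u n) \<in> B (k + C)" by simp
          moreover have "c m \<ominus> c n \<in> K" using cu by auto
          moreover have "u m \<ominus> u n \<in> U" using cu(2) sp(3)[OF _ sp(4)] by (simp add: a_minus_def)
          ultimately have "c m \<ominus> c n \<in> B (k + C - C)" using L by blast
          then show ?thesis by simp
        qed
        then show "\<exists>n0. \<forall>m\<ge>n0. \<forall>n\<ge>n0. c m \<ominus> c n \<in> B k" by blast
      qed
      from complete_setD[OF base_complete cN(3) this]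
      obtain c0 where c0: "c0 \<in> K" "tends c c0" by blast
      have c0N: "c0 \<in> N" using c0 KN by blast
      have t1: "tends (\<lambda>n. c n \<otimes> b) (c0 \<otimes> b)" by (rule tends_mult_const[OF c0(2) cN(1) c0N bN])
      have r1: "range (\<lambda>n. c n \<otimes> b) \<subseteq> N" using cN'(1) bN by auto
      have "Cauchy (\<lambda>n. c n \<otimes> b)" using tends_Cauchy[OF t1 r1] c0N bN by simp
      then have "Cauchy (\<lambda>n. s n \<ominus> c n \<otimes> b)" using Cauchy_minus[OF s(2) _ sN r1] by blast
      moreover have "s n \<ominus> c n \<otimes> b = u n" for n
        using cc[of n] bc unfolding cu(3) a_minus_def by algebra
      ultimately have "Cauchy u" by simp
      from complete_setD[OF IH(1) cN(4) this]
      obtain u0 where u0: "u0 \<in> U" "tends u u0" by blast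
      have "tends (\<lambda>n. c n \<otimes> b \<oplus> u n) (c0 \<otimes> b \<oplus> u0)"
        using tends_add[OF t1 u0(2) r1 cN(2)] c0N bN u0(1) UN by blast
      then have "tends s (c0 \<otimes> b \<oplus> u0)" by (simp add: cu(3)[symmetric])
      then show "\<exists>a\<in>Span K (b # Us). tends s a" using Sp c0 u0 by blast
    qed
    moreover have "\<exists>T. finite T \<and> T \<subseteq> N \<and> (\<forall>x\<in>Span K (b # Us) \<inter> B k. \<exists>t\<in>T. x \<ominus> t \<in> B l)" for k l
    proof -
      obtain T1 where T1: "finite T1" "T1 \<subseteq> K" "\<forall>x\<in>K \<inter> B (k - C). \<exists>t\<in>T1. x \<ominus> t \<in> B (l - D)"
        using base_covered[of "k - C" "l - D"] by blast
      \<comment> \<open>A level for u = x - c b: the smaller of the level k of x and the level (k -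
        C) + D of c b.\<close>
      define k' where "k' = min k (k - C + D)"
      obtain T2 where T2: "finite T2" "T2 \<subseteq> N" "\<forall>x\<in>U \<inter> B k'. \<exists>t\<in>T2. x \<ominus> t \<in> B l"
        using IH(2)[of k' l] by blast
      define T where "T = (\<lambda>(t, r). t \<otimes> b \<oplus> r) ` (T1 \<times> T2)"
      have "\<exists>t\<in>T. x \<ominus> t \<in> B l" if x: "x \<in> Span K (b # Us)" "x \<in> B k" for x
      proof -
        obtain c u where cu: "c \<in> K" "u \<in> U" "x = c \<otimes> b \<oplus> u" using Sp x by blast
        have cB: "c \<in> B (k - C)" by (rule L[OF cu(1,2) x(2)[unfolded cu(3)]])
        obtain t where t: "t \<in> T1" "c \<ominus> t \<in> B (l - D)" using T1 cu cB by blast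
        have cc: "c \<in> carrier R" "u \<in> carrier R" "t \<in> carrier R"
          using cu KN UN N_carrier t T1 by blast+
        have "u = x \<ominus> c \<otimes> b" unfolding cu(3) a_minus_def using cc bc by algebra
        moreover have "c \<otimes> b \<in> B k'" using B_mult[OF cB D] B_mono[of k' "k - C + D"] by (simp add: k'_def)
        moreover have "x \<in> B k'" using x B_mono[of k' k] by (simp add: k'_def)
        ultimately have "u \<in> B k'" by (metis B_minus)
        then obtain r where r: "r \<in> T2" "u \<ominus> r \<in> B l" using T2 cu by blast
        have rc: "r \<in> carrier R" using r T2 N_carrier by blast
        have "x \<ominus> (t \<otimes> b \<oplus> r) = (c \<ominus> t) \<otimes> b \<oplus> (u \<ominus> r)"
          unfolding cu(3) a_minus_def using cc bc rc by algebra
        moreover have "(c \<ominus> t) \<otimes> b \<in> B l" using B_mult[OF t(2) D] by simp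
        ultimately have "x \<ominus> (t \<otimes> b \<oplus> r) \<in> B l" using r B_add by metis
        then show ?thesis using t r unfolding T_def by auto
      qed
      moreover have "finite T" using T1 T2 by (simp add: T_def)
      moreover have "T \<subseteq> N" using T1(2) T2(2) KN bN unfolding T_def by (auto simp: subset_iff)
      ultimately show ?thesis by blast
    qed
    ultimately show ?thesis by blast
  qed
qed

end

section \<open>Extension of valuations\<close>

text \<open>The absence of 1/p keeps p a nonunit of V, which makes V dominate the valuation ring of
  K. Maximality, as obtained from Zorn's lemma, is stated for a single adjoined element:
  \<open>simple_extension V x\<close> is the ring V[x].\<close>

locale dominating_ring = K: local_subfield R K v
  for R (structure) and K v +
  fixes N :: "'a set" and p :: 'a and V :: "'a set"
  assumes subfield_top: "subfield N R" and K_le_N: "K \<subseteq> N"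
    and p: "p \<in> K" "p \<noteq> \<zero>" "v p = 1"
    and subringV: "subring V R" and base_le_V: "K.B 0 \<subseteq> V" and V_le_N: "V \<subseteq> N"
    and inv_p_notin: "inv p \<notin> V"
    and maximal: "\<lbrakk> x \<in> N; x \<notin> V \<rbrakk> \<Longrightarrow> inv p \<in> ring.simple_extension R V x"
begin

lemma N_carrier: "x \<in> N \<Longrightarrow> x \<in> carrier R"
  using subfieldE(3)[OF subfield_top] by auto

lemma V_carrier: "x \<in> V \<Longrightarrow> x \<in> carrier R"
  using V_le_N N_carrier by auto

lemma K_carrier: "x \<in> K \<Longrightarrow> x \<in> carrier R"
  using K_le_N N_carrier by auto

lemma N_inv: "x \<in> N \<Longrightarrow> x \<noteq> \<zero> \<Longrightarrow> inv x \<in> N" "x \<in> N \<Longrightarrow> x \<noteq> \<zero> \<Longrightarrow> inv x \<noteq> \<zero>"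
  "x \<in> N \<Longrightarrow> x \<noteq> \<zero> \<Longrightarrow> x \<otimes> inv x = \<one>" "x \<in> N \<Longrightarrow> x \<noteq> \<zero> \<Longrightarrow> inv x \<otimes> x = \<one>"
  using K.subfield_m_inv[OF subfield_top] by auto

lemma inv_invN: assumes "x \<in> N" "x \<noteq> \<zero>" shows "inv (inv x) = x"
  using N_inv[OF assms] N_carrier[OF assms(1)] N_carrier[OF N_inv(1)[OF assms]]
  by (metis K.comm_inv_char)

lemma N_closed: "\<zero> \<in> N" "\<one> \<in> N" "x \<in> N \<Longrightarrow> \<ominus> x \<in> N"
  "x \<in> N \<Longrightarrow> y \<in> N \<Longrightarrow> x \<oplus> y \<in> N" "x \<in> N \<Longrightarrow> y \<in> N \<Longrightarrow> x \<otimes> y \<in> N"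
  using subringE[OF subfieldE(1)[OF subfield_top]] by auto

lemma V_closed: "\<zero> \<in> V" "\<one> \<in> V" "x \<in> V \<Longrightarrow> \<ominus> x \<in> V"
  "x \<in> V \<Longrightarrow> y \<in> V \<Longrightarrow> x \<oplus> y \<in> V" "x \<in> V \<Longrightarrow> y \<in> V \<Longrightarrow> x \<otimes> y \<in> V"
  using subringE[OF subringV] by auto

lemma N_pow: "x \<in> N \<Longrightarrow> x [^] (n::nat) \<in> N"
  by (induction n) (auto simp: N_closed)

lemma V_pow: "x \<in> V \<Longrightarrow> x [^] (n::nat) \<in> V"
  by (induction n) (auto simp: V_closed)

lemma N_mult_nz: "\<lbrakk> x \<in> N; x \<noteq> \<zero>; y \<in> N; y \<noteq> \<zero> \<rbrakk> \<Longrightarrow> x \<otimes> y \<noteq> \<zero>"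
  using K.integral_iff N_carrier by auto

lemma N_pow_nz: "x \<in> N \<Longrightarrow> x \<noteq> \<zero> \<Longrightarrow> x [^] (n::nat) \<noteq> \<zero>"
  by (induction n) (auto dest: N_mult_nz[OF N_pow])

lemma p_facts: "p \<in> N" "p \<in> V" "p \<in> carrier R" "inv p \<in> carrier R" "p \<otimes> inv p = \<one>" "inv p \<otimes> p = \<one>"
proof -
  show 1: "p \<in> N" using p K_le_N by auto
  have "p \<in> K.B 0" using p by (simp add: K.B_def)
  then show "p \<in> V" using base_le_V by auto
  show "p \<in> carrier R" "inv p \<in> carrier R" "p \<otimes> inv p = \<one>" "inv p \<otimes> p = \<one>"
    using 1 N_inv[OF 1 p(2)] N_carrier by auto
qed

text \<open>The principal ideal p V. It can be smaller than the maximal ideal of V, but it is the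
  ideal that the relations coming from maximality produce.\<close>

definition J :: "'a set" where "J = {p \<otimes> a | a. a \<in> V}"

lemma J_V: "x \<in> J \<Longrightarrow> x \<in> V" using p_facts V_closed by (auto simp: J_def)

lemma J_zero: "\<zero> \<in> J" unfolding J_def using V_closed(1) p_facts by force

lemma J_add: "x \<in> J \<Longrightarrow> y \<in> J \<Longrightarrow> x \<oplus> y \<in> J"
proof -
  assume "x \<in> J" "y \<in> J"
  then obtain a b where ab: "a \<in> V" "b \<in> V" "x = p \<otimes> a" "y = p \<otimes> b" by (auto simp: J_def)
  then have "x \<oplus> y = p \<otimes> (a \<oplus> b)" using p_facts V_carrier by (simp add: K.r_distr)
  then show ?thesis using ab V_closed by (auto simp: J_def)
qed

lemma J_mult: "a \<in> V \<Longrightarrow> x \<in> J \<Longrightarrow> a \<otimes> x \<in> J"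
proof -
  assume a: "a \<in> V" and "x \<in> J"
  then obtain b where b: "b \<in> V" "x = p \<otimes> b" by (auto simp: J_def)
  then have "a \<otimes> x = p \<otimes> (a \<otimes> b)" using a p_facts V_carrier by (simp add: K.m_lcomm)
  then show ?thesis using a b V_closed by (auto simp: J_def)
qed

lemma one_notin_J: "\<one> \<notin> J"
proof
  assume "\<one> \<in> J"
  then obtain a where a: "a \<in> V" "\<one> = p \<otimes> a" by (auto simp: J_def)
  have "inv p = inv p \<otimes> (p \<otimes> a)" unfolding a(2)[symmetric] using p_facts by simp
  also have "\<dots> = a" using p_facts(3,4,6) a(1) V_carrier by (simp add: K.m_assoc[symmetric])
  finally show False using a inv_p_notin by simp
qed

text \<open>If the inverse of u = 1 - d were missing from V, maximality would make 1/p a polynomial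
  in u^-1 over V. Multiplication by a power u^n that clears denominators puts u^n into J, whereas
  every power of u lies in 1 - J.\<close>

lemma one_minus_J_unit:
  assumes d: "d \<in> J"
  shows "\<one> \<ominus> d \<noteq> \<zero>" "inv (\<one> \<ominus> d) \<in> V"
proof -
  define u where "u = \<one> \<ominus> d"
  have dV: "d \<in> V" and dc: "d \<in> carrier R" using d J_V V_carrier by auto
  have uV: "u \<in> V" unfolding u_def a_minus_def using dV V_closed by simp
  have uN: "u \<in> N" and uc: "u \<in> carrier R" using uV V_le_N V_carrier by auto
  have u0: "u \<noteq> \<zero>"
  proof
    assume "u = \<zero>"
    then have "\<one> = d" using dc by (simp add: u_def)
    then show False using d one_notin_J by simp
  qed
  then show "\<one> \<ominus> d \<noteq> \<zero>" by (simp add: u_def)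
  have pw: "\<exists>c\<in>J. u [^] (n::nat) = \<one> \<ominus> c" for n
  proof (induction n)
    case 0
    show ?case by (intro bexI[OF _ J_zero]) (simp add: a_minus_def)
  next
    case (Suc n)
    then obtain c where c: "c \<in> J" "u [^] n = \<one> \<ominus> c" by blast
    have cc: "c \<in> carrier R" "c \<in> V" using c J_V V_carrier by auto
    have "u [^] Suc n = (\<one> \<ominus> c) \<otimes> (\<one> \<ominus> d)" using c by (simp add: u_def)
    also have "\<dots> = \<one> \<ominus> (c \<oplus> (\<one> \<ominus> c) \<otimes> d)" using cc dc unfolding a_minus_def by algebra
    finally have "u [^] Suc n = \<one> \<ominus> (c \<oplus> (\<one> \<ominus> c) \<otimes> d)" .
    moreover have "c \<oplus> (\<one> \<ominus> c) \<otimes> d \<in> J"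
      using c d cc V_closed by (intro J_add J_mult) (auto simp: a_minus_def)
    ultimately show ?case by blast
  qed
  have "inv u \<in> V"
  proof (rule ccontr)
    assume "inv u \<notin> V"
    then have "inv p \<in> K.simple_extension V (inv u)" using maximal N_inv(1)[OF uN u0] by simp
    moreover have iu: "inv u \<in> carrier R" "inv u \<otimes> u = \<one>" using N_inv[OF uN u0] N_carrier by auto
    have "\<exists>n::nat. y \<otimes> u [^] n \<in> V" if "y \<in> K.simple_extension V (inv u)" for y
      using that
    proof (induction rule: K.simple_extension.induct)
      case zero
      then show ?case using V_closed uc by (intro exI[of _ 0]) simp
    next
      case (lin k1 k2)
      then obtain n :: nat where n: "k1 \<otimes> u [^] n \<in> V" by blast
      have k1: "k1 \<in> carrier R"
        using lin(1) K.simple_extension_in_carrier[of V "inv u"] V_carrier iu by blast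
      have k2: "k2 \<in> carrier R" using lin V_carrier by simp
      have un: "u [^] n \<in> carrier R" using uc by simp
      have "(k1 \<otimes> inv u \<oplus> k2) \<otimes> u [^] Suc n = (k1 \<otimes> u [^] n) \<otimes> (inv u \<otimes> u) \<oplus> k2 \<otimes> (u [^] n \<otimes> u)"
        unfolding nat_pow_Suc using k1 k2 uc iu(1) un by algebra
      also have "\<dots> = (k1 \<otimes> u [^] n) \<oplus> k2 \<otimes> (u [^] n \<otimes> u)" using iu k1 un by simp
      also have "\<dots> \<in> V" using n lin(2) uV V_pow[OF uV] V_closed by simp
      finally show ?case by blast
    qed
    ultimately obtain n :: nat where n: "inv p \<otimes> u [^] n \<in> V" by blast
    have "u [^] n = p \<otimes> (inv p \<otimes> u [^] n)" using p_facts uc by (simp add: K.m_assoc[symmetric])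
    then have "u [^] n \<in> J" using n by (auto simp: J_def)
    moreover obtain c where c: "c \<in> J" "u [^] n = \<one> \<ominus> c" using pw by blast
    ultimately have "(\<one> \<ominus> c) \<oplus> c \<in> J" using J_add by simp
    moreover have "(\<one> \<ominus> c) \<oplus> c = \<one>" using J_V[OF c(1)] V_carrier unfolding a_minus_def by (simp add: K.a_assoc K.l_neg)
    ultimately show False using one_notin_J by simp
  qed
  then show "inv (\<one> \<ominus> d) \<in> V" by (simp add: u_def)
qed

text \<open>\<open>hor x n\<close> is the set of values at \<open>x\<close> of polynomials of degree at most \<open>n\<close> with
  coefficients in the ideal \<open>J\<close>, written in Horner form.\<close>

primrec hor :: "'a \<Rightarrow> nat \<Rightarrow> 'a set" where
  "hor x 0 = J"
| "hor x (Suc n) = {a \<oplus> x \<otimes> b | a b. a \<in> J \<and> b \<in> hor x n}"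

lemma hor_carrier: "x \<in> N \<Longrightarrow> hor x n \<subseteq> carrier R"
  by (induction n) (use J_V V_carrier N_carrier in auto)

lemma hor_add: "x \<in> N \<Longrightarrow> a \<in> hor x n \<Longrightarrow> b \<in> hor x n \<Longrightarrow> a \<oplus> b \<in> hor x n"
proof (induction n arbitrary: a b)
  case (Suc n)
  obtain a1 a2 where a: "a = a1 \<oplus> x \<otimes> a2" "a1 \<in> J" "a2 \<in> hor x n" using Suc by auto
  obtain b1 b2 where b: "b = b1 \<oplus> x \<otimes> b2" "b1 \<in> J" "b2 \<in> hor x n" using Suc by auto
  have c: "a1 \<in> carrier R" "a2 \<in> carrier R" "b1 \<in> carrier R" "b2 \<in> carrier R" "x \<in> carrier R"
    using a b Suc hor_carrier[of x n] J_V V_carrier N_carrier by auto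
  have "a \<oplus> b = (a1 \<oplus> b1) \<oplus> x \<otimes> (a2 \<oplus> b2)" unfolding a b using c by algebra
  then show ?case using J_add[OF a(2) b(2)] Suc.IH[OF Suc.prems(1) a(3) b(3)] by auto
qed (simp add: J_add)

lemma hor_smult: "x \<in> N \<Longrightarrow> c \<in> V \<Longrightarrow> a \<in> hor x n \<Longrightarrow> c \<otimes> a \<in> hor x n"
proof (induction n arbitrary: a)
  case (Suc n)
  obtain a1 a2 where a: "a = a1 \<oplus> x \<otimes> a2" "a1 \<in> J" "a2 \<in> hor x n" using Suc by auto
  have c: "a1 \<in> carrier R" "a2 \<in> carrier R" "x \<in> carrier R" "c \<in> carrier R"
    using a Suc hor_carrier[of x n] J_V V_carrier N_carrier by auto
  have "c \<otimes> a = c \<otimes> a1 \<oplus> x \<otimes> (c \<otimes> a2)" unfolding a using c by algebra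
  then show ?case using J_mult[OF Suc.prems(2) a(2)] Suc.IH[OF Suc.prems(1,2) a(3)] by auto
qed (simp add: J_mult)

lemma hor_Suc: "x \<in> N \<Longrightarrow> a \<in> hor x n \<Longrightarrow> a \<in> hor x (Suc n)"
proof (induction n arbitrary: a)
  case 0
  have "a = a \<oplus> x \<otimes> \<zero>" using 0 J_V V_carrier N_carrier by simp
  then show ?case using 0 J_zero by auto
next
  case (Suc n)
  obtain a1 a2 where a: "a = a1 \<oplus> x \<otimes> a2" "a1 \<in> J" "a2 \<in> hor x n" using Suc by auto
  have "a2 \<in> hor x (Suc n)" by (rule Suc.IH[OF Suc.prems(1) a(3)])
  then show ?case using a by auto
qed

lemma hor_shift: "x \<in> N \<Longrightarrow> a \<in> hor x n \<Longrightarrow> x \<otimes> a \<in> hor x (Suc n)"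
proof -
  assume x: "x \<in> N" "a \<in> hor x n"
  have "x \<otimes> a = \<zero> \<oplus> x \<otimes> a" using x hor_carrier[of x n] N_carrier by auto
  then show ?thesis using x J_zero by auto
qed

lemma hor_shift_pow: "x \<in> N \<Longrightarrow> a \<in> hor x n \<Longrightarrow> x [^] m \<otimes> a \<in> hor x (m + n)"
proof (induction m)
  case 0
  then show ?case using hor_carrier[of x n] by auto
next
  case (Suc m)
  have c: "x \<in> carrier R" "a \<in> carrier R" using Suc hor_carrier[of x n] N_carrier by auto
  have "x [^] Suc m \<otimes> a = x \<otimes> (x [^] m \<otimes> a)" using c by (simp add: K.m_assoc K.m_lcomm)
  then show ?case using hor_shift[OF Suc.prems(1) Suc.IH[OF Suc.prems]] by simp
qed

lemma hor_top: "x \<in> N \<Longrightarrow> a \<in> hor x (Suc n) \<Longrightarrow> \<exists>q\<in>hor x n. \<exists>c\<in>J. a = q \<oplus> c \<otimes> x [^] Suc n"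
proof (induction n arbitrary: a)
  case 0
  then obtain a1 a2 where a: "a = a1 \<oplus> x \<otimes> a2" "a1 \<in> J" "a2 \<in> J" by auto
  have "a = a1 \<oplus> a2 \<otimes> x [^] Suc 0" using a 0 J_V V_carrier N_carrier by (simp add: K.m_comm)
  then show ?case using a by auto
next
  case (Suc n)
  obtain a1 a2 where a: "a = a1 \<oplus> x \<otimes> a2" "a1 \<in> J" "a2 \<in> hor x (Suc n)" using Suc.prems(2) hor.simps(2) by blast
  obtain q c where q: "q \<in> hor x n" "c \<in> J" "a2 = q \<oplus> c \<otimes> x [^] Suc n"
    using Suc.IH[OF Suc.prems(1) a(3)] by blast
  define y where "y = x [^] Suc n"
  have c: "a1 \<in> carrier R" "q \<in> carrier R" "c \<in> carrier R" "x \<in> carrier R" "y \<in> carrier R"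
    using a q Suc.prems hor_carrier[of x n] J_V V_carrier N_carrier unfolding y_def by auto
  have "a = (a1 \<oplus> x \<otimes> q) \<oplus> c \<otimes> (y \<otimes> x)" unfolding a(1) q(3) y_def[symmetric] using c by algebra
  then have "a = (a1 \<oplus> x \<otimes> q) \<oplus> c \<otimes> x [^] Suc (Suc n)" by (simp add: y_def)
  moreover have "a1 \<oplus> x \<otimes> q \<in> hor x (Suc n)" using a q by auto
  ultimately show ?case using q(2) by blast
qed

text \<open>Maximality writes 1/p as a polynomial in x over V; multiplication by p moves the
  coefficients into J.\<close>

lemma one_in_hor:
  assumes "x \<in> N" "x \<notin> V"
  shows "\<exists>n. \<one> \<in> hor x n"
proof -
  have xc: "x \<in> carrier R" using assms N_carrier by simp
  have "\<exists>n. p \<otimes> y \<in> hor x n" if "y \<in> K.simple_extension V x" for y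
    using that
  proof (induction rule: K.simple_extension.induct)
    case zero
    then show ?case using J_zero p_facts by (intro exI[of _ 0]) simp
  next
    case (lin k1 k2)
    then obtain n where n: "p \<otimes> k1 \<in> hor x n" by blast
    have k1: "k1 \<in> carrier R"
      using lin(1) K.simple_extension_in_carrier[of V x] V_carrier xc by blast
    have k2: "k2 \<in> carrier R" using lin V_carrier by simp
    have "p \<otimes> (k1 \<otimes> x \<oplus> k2) = p \<otimes> k2 \<oplus> x \<otimes> (p \<otimes> k1)" using k1 k2 xc p_facts(3) by algebra
    moreover have "p \<otimes> k2 \<in> J" using lin by (auto simp: J_def)
    ultimately have "p \<otimes> (k1 \<otimes> x \<oplus> k2) \<in> hor x (Suc n)" using n by auto
    then show ?case by blast
  qed
  from this[OF maximal[OF assms]] show ?thesis using p_facts by simp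
qed

text \<open>The descent step of Chevalley's extension theorem. The relation in x^-1 reads 1 - d =
  x^-1 b with a unit 1 - d. Multiplied by x^m and divided by the unit, it expresses x^m through
  lower powers of x with coefficients in J. As m \<le> n, this removes the leading power x^n from
  the other relation.\<close>

lemma hor_reduce:
  assumes x: "x \<in> N" "x \<noteq> \<zero>" and m: "\<one> \<in> hor (inv x) m" and n: "\<one> \<in> hor x n" and mn: "m \<le> n"
  shows "\<exists>n'<n. \<one> \<in> hor x n'"
proof -
  note ix = N_inv[OF x]
  have c: "x \<in> carrier R" "inv x \<in> carrier R" using x ix N_carrier by auto
  obtain m' where m': "m = Suc m'" using m one_notin_J by (cases m) auto
  then obtain n' where n': "n = Suc n'" using mn by (cases n) auto
  obtain d b where db: "\<one> = d \<oplus> inv x \<otimes> b" "d \<in> J" "b \<in> hor (inv x) m'" using m m' by auto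
  have dbc: "d \<in> carrier R" "b \<in> carrier R" using db hor_carrier[OF ix(1)] J_V V_carrier by auto
  \<comment> \<open>Multiplication by x^k reverses a polynomial of degree at most k in x^-1 into one
    in x.\<close>
  have flip: "x [^] k \<otimes> b \<in> hor x k" if "b \<in> hor (inv x) k" for k b
    using that
  proof (induction k arbitrary: b)
    case 0
    then show ?case using J_V V_carrier by auto
  next
    case (Suc k)
    then obtain a1 a2 where a: "b = a1 \<oplus> inv x \<otimes> a2" "a1 \<in> J" "a2 \<in> hor (inv x) k" by auto
    have ac: "a1 \<in> carrier R" "a2 \<in> carrier R" using a hor_carrier[OF ix(1)] J_V V_carrier by auto
    define y where "y = x [^] k"
    have yc: "y \<in> carrier R" using c by (simp add: y_def)
    have "x [^] Suc k \<otimes> b = x [^] Suc k \<otimes> a1 \<oplus> (x \<otimes> inv x) \<otimes> (y \<otimes> a2)"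
      unfolding a(1) nat_pow_Suc y_def[symmetric] using c ac yc by algebra
    also have "\<dots> = x [^] Suc k \<otimes> a1 \<oplus> x [^] k \<otimes> a2" using ix ac yc by (simp add: y_def)
    finally have e: "x [^] Suc k \<otimes> b = x [^] Suc k \<otimes> a1 \<oplus> x [^] k \<otimes> a2" .
    have "x [^] Suc k \<otimes> a1 \<in> hor x (Suc k + 0)" by (rule hor_shift_pow[OF x(1)]) (simp add: a)
    then have 1: "x [^] Suc k \<otimes> a1 \<in> hor x (Suc k)" by (simp only: add_0_right)
    have "x [^] k \<otimes> a2 \<in> hor x (Suc k)" by (rule hor_Suc[OF x(1) Suc.IH[OF a(3)]])
    then show ?case unfolding e by (rule hor_add[OF x(1) 1])
  qed
  define u where "u = \<one> \<ominus> d"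
  have "u = inv x \<otimes> b" unfolding u_def
  proof -
    have "\<one> \<ominus> d = (d \<oplus> inv x \<otimes> b) \<ominus> d" using db(1) by simp
    also have "\<dots> = inv x \<otimes> b" using c dbc unfolding a_minus_def by algebra
    finally show "\<one> \<ominus> d = inv x \<otimes> b" .
  qed
  have u: "u \<noteq> \<zero>" "inv u \<in> V" using one_minus_J_unit[OF db(2)] by (auto simp: u_def)
  have uN: "u \<in> N" using db(2) J_V V_closed V_le_N unfolding u_def a_minus_def by auto
  have iu: "inv u \<otimes> u = \<one>" using N_inv[OF uN u(1)] by simp
  have uc: "u \<in> carrier R" "inv u \<in> carrier R" using uN u V_carrier N_carrier by auto
  define y where "y = x [^] m'"
  have yc: "y \<in> carrier R" using c by (simp add: y_def)
  have "x [^] m = (inv u \<otimes> u) \<otimes> (y \<otimes> x)" using c yc m' iu by (simp add: y_def)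
  also have "\<dots> = inv u \<otimes> ((inv x \<otimes> b) \<otimes> (y \<otimes> x))" using uc yc c \<open>u = inv x \<otimes> b\<close> by (simp add: K.m_assoc)
  also have "\<dots> = inv u \<otimes> ((x \<otimes> inv x) \<otimes> (y \<otimes> b))" using uc yc c dbc by algebra
  also have "\<dots> = inv u \<otimes> (y \<otimes> b)" using ix yc dbc by simp
  finally have "x [^] m = inv u \<otimes> (x [^] m' \<otimes> b)" by (simp add: y_def)
  then have xm: "x [^] m \<in> hor x m'" using hor_smult[OF x(1) u(2) flip[OF db(3)]] by simp
  have "x [^] n = x [^] (n - m) \<otimes> x [^] m" using mn c by (simp add: K.nat_pow_mult)
  then have "x [^] n \<in> hor x ((n - m) + m')" using hor_shift_pow[OF x(1) xm] by simp
  then have xn: "x [^] Suc n' \<in> hor x n'" using mn m' n' by simp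
  obtain q e where q: "q \<in> hor x n'" "e \<in> J" "\<one> = q \<oplus> e \<otimes> x [^] Suc n'"
    using hor_top[OF x(1)] n n' by blast
  have "e \<otimes> x [^] Suc n' \<in> hor x n'" by (rule hor_smult[OF x(1) J_V[OF q(2)] xn])
  then have "q \<oplus> e \<otimes> x [^] Suc n' \<in> hor x n'" by (rule hor_add[OF x(1) q(1)])
  then have "\<one> \<in> hor x n'" using q(3) by simp
  then show ?thesis using n' by blast
qed

text \<open>Descent on n + m: the larger of the two degrees is lowered, with x and x^-1 exchanging
  roles. It cannot go on, since 1 is not in J = \<open>hor x 0\<close>.\<close>

lemma hor_contradiction:
  assumes "x \<in> N" "x \<noteq> \<zero>" "\<one> \<in> hor x n" "\<one> \<in> hor (inv x) m"
  shows False
  using assms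
proof (induction "n + m" arbitrary: x n m rule: less_induct)
  case less
  note x = less.prems(1,2)
  show ?case
  proof (cases "m \<le> n")
    case True
    obtain n' where "n' < n" "\<one> \<in> hor x n'" using hor_reduce[OF x less.prems(4,3) True] by blast
    then show False using less.hyps[of n' m x] less.prems by simp
  next
    case False
    have ii: "inv (inv x) = x" by (rule inv_invN[OF x])
    have "\<exists>m'<m. \<one> \<in> hor (inv x) m'"
      by (rule hor_reduce[of "inv x" n]) (use less.prems N_inv[OF x] ii False in auto)
    then obtain m' where "m' < m" "\<one> \<in> hor (inv x) m'" by blast
    then show False using less.hyps[of n m' x] less.prems by simp
  qed
qed

lemma valuation_ring_dichotomy:
  assumes "x \<in> N" "x \<noteq> \<zero>"
  shows "x \<in> V \<or> inv x \<in> V"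
  using hor_contradiction[OF assms] one_in_hor[of x] one_in_hor[of "inv x"] N_inv[OF assms] assms(1)
  by blast

end

lemma (in valued_subfield) exists_multiple:
  assumes "x \<in> N" "x \<noteq> \<zero>"
  shows "\<exists>z\<in>N. z \<noteq> \<zero> \<and> w z = q * w x"
proof (cases "0 \<le> q")
  case True
  then obtain n where "q = int n" using nonneg_int_cases by blast
  then show ?thesis using assms w_pow N_pow_nz by (intro bexI[of _ "x [^] n"]) auto
next
  case False
  define n where "n = nat (- q)"
  have q: "q = - int n" using False by (simp add: n_def)
  have nz: "x [^] n \<in> N" "x [^] n \<noteq> \<zero>" using assms N_pow_nz by auto
  then show ?thesis using assms w_pow w_inv[OF nz] N_inv[OF nz] q by (intro bexI[of _ "inv (x [^] n)"]) auto
qed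

section \<open>Units of V and values modulo the base field\<close>

context dominating_ring begin

lemma inv_mult: assumes "x \<in> N" "x \<noteq> \<zero>" "y \<in> N" "y \<noteq> \<zero>"
  shows "inv (x \<otimes> y) = inv x \<otimes> inv y"
proof -
  note ix = N_inv[OF assms(1,2)] and iy = N_inv[OF assms(3,4)]
  have c: "x \<in> carrier R" "y \<in> carrier R" "inv x \<in> carrier R" "inv y \<in> carrier R"
    using assms ix iy N_carrier by auto
  have "(x \<otimes> y) \<otimes> (inv x \<otimes> inv y) = (x \<otimes> inv x) \<otimes> (y \<otimes> inv y)" using c by algebra
  then have "(x \<otimes> y) \<otimes> (inv x \<otimes> inv y) = \<one>" using ix iy by simp
  then show ?thesis using K.comm_inv_char[of "x \<otimes> y" "inv x \<otimes> inv y"] c by simp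
qed

definition U :: "'a set" where "U = {x \<in> V. x \<noteq> \<zero> \<and> inv x \<in> V}"

lemma U_N: "x \<in> U \<Longrightarrow> x \<in> N" "x \<in> U \<Longrightarrow> x \<noteq> \<zero>" "x \<in> U \<Longrightarrow> x \<in> V" "x \<in> U \<Longrightarrow> inv x \<in> V"
  using V_le_N by (auto simp: U_def)

lemma U_one: "\<one> \<in> U" using V_closed by (simp add: U_def)

lemma U_I: "x \<in> V \<Longrightarrow> x \<noteq> \<zero> \<Longrightarrow> inv x \<in> V \<Longrightarrow> x \<in> U"
  by (simp add: U_def)

lemma U_mult: assumes x: "x \<in> U" and y: "y \<in> U" shows "x \<otimes> y \<in> U"
proof (rule U_I)
  note xs = U_N[OF x] and ys = U_N[OF y]
  show "x \<otimes> y \<in> V" by (rule V_closed(5)[OF xs(3) ys(3)])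
  show "x \<otimes> y \<noteq> \<zero>" by (rule N_mult_nz[OF xs(1,2) ys(1,2)])
  show "inv (x \<otimes> y) \<in> V"
    unfolding inv_mult[OF xs(1,2) ys(1,2)] by (rule V_closed(5)[OF xs(4) ys(4)])
qed

lemma U_inv: assumes x: "x \<in> U" shows "inv x \<in> U"
proof (rule U_I)
  note xs = U_N[OF x]
  show "inv x \<in> V" by (rule xs(4))
  show "inv x \<noteq> \<zero>" by (rule N_inv(2)[OF xs(1,2)])
  show "inv (inv x) \<in> V" unfolding inv_invN[OF xs(1,2)] by (rule xs(3))
qed

lemma U_pow: "x \<in> U \<Longrightarrow> x [^] (n::nat) \<in> U"
  by (induction n) (auto simp: U_one U_mult)

lemma inv_eqI: "x \<in> N \<Longrightarrow> y \<in> N \<Longrightarrow> x \<otimes> y = \<one> \<Longrightarrow> inv x = y"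
  using K.comm_inv_char[of x y] N_carrier by simp

text \<open>V is local. With s = 1 + a, one of a / s and s / a lies in V, so s or a divides s - a =
  1 in V; only s can be the unit.\<close>

lemma one_plus_nonunit:
  assumes a: "a \<in> V" "a \<notin> U"
  shows "\<one> \<oplus> a \<in> U"
proof (rule ccontr)
  assume n: "\<one> \<oplus> a \<notin> U"
  define s where "s = \<one> \<oplus> a"
  have aN: "a \<in> N" and ac: "a \<in> carrier R" using a V_le_N V_carrier by auto
  have sV: "s \<in> V" using a V_closed by (simp add: s_def)
  then have sN: "s \<in> N" and sc: "s \<in> carrier R" using V_le_N V_carrier by auto
  have a0: "a \<noteq> \<zero>" using n U_one by auto
  have sa: "s \<ominus> a = \<one>" using ac unfolding s_def a_minus_def by algebra
  have s0: "s \<noteq> \<zero>"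
  proof
    assume "s = \<zero>"
    then have "\<ominus> a = \<one>" using sa ac by (simp add: a_minus_def)
    then have "a \<otimes> (\<ominus> \<one>) = \<one>" using ac by (simp add: K.r_minus)
    then have "inv a = \<ominus> \<one>" using inv_eqI aN N_closed by simp
    then show False using a(2) U_I[OF a(1) a0] V_closed by simp
  qed
  note ia = N_inv[OF aN a0] and js = N_inv[OF sN s0]
  have c: "inv a \<in> carrier R" "inv s \<in> carrier R" using ia js N_carrier by auto
  define t where "t = a \<otimes> inv s"
  have t: "t \<in> N" "t \<noteq> \<zero>" using aN a0 js N_closed N_mult_nz by (auto simp: t_def)
  have it: "inv t = inv a \<otimes> s" unfolding t_def using inv_mult[OF aN a0 js(1,2)] inv_invN[OF sN s0] by simp
  from valuation_ring_dichotomy[OF t] show False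
  proof
    assume tV: "t \<in> V"
    have "s \<otimes> (\<one> \<ominus> t) = s \<ominus> a \<otimes> (s \<otimes> inv s)" unfolding t_def a_minus_def using sc ac c by algebra
    then have "s \<otimes> (\<one> \<ominus> t) = \<one>" using js sa ac by simp
    then have "inv s = \<one> \<ominus> t" using inv_eqI sN t N_closed by (simp add: a_minus_def)
    then have "inv s \<in> V" using tV V_closed by (simp add: a_minus_def)
    then show False using n U_I[OF sV s0] by (simp add: s_def)
  next
    assume tV: "inv t \<in> V"
    have "a \<otimes> (inv t \<ominus> \<one>) = (a \<otimes> inv a) \<otimes> s \<ominus> a" unfolding it a_minus_def using sc ac c by algebra
    then have "a \<otimes> (inv t \<ominus> \<one>) = \<one>" using ia sa sc by simp
    then have "inv a = inv t \<ominus> \<one>" using inv_eqI aN tV V_le_N N_closed by (auto simp add: a_minus_def)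
    then have "inv a \<in> V" using tV V_closed by (simp add: a_minus_def)
    then show False using a(2) U_I[OF a(1) a0] by simp
  qed
qed

text \<open>If v c < 0, then 1/(c p) is integral, and its product with c would place 1/p in
  V.\<close>

lemma base_V: assumes "c \<in> K" "c \<noteq> \<zero>" "c \<in> V" shows "0 \<le> v c"
proof (rule ccontr)
  assume n: "\<not> 0 \<le> v c"
  note ic = K.N_inv[OF assms(1,2)] and ip = K.N_inv[OF p(1,2)]
  have c: "c \<in> carrier R" "inv c \<in> carrier R" "inv p \<in> carrier R" using assms ic ip K_carrier by auto
  have "v (inv c \<otimes> inv p) = - v c - 1"
    using K.w_mult ic ip K.w_inv[OF assms(1,2)] K.w_inv[OF p(1,2)] p by simp
  then have "inv c \<otimes> inv p \<in> K.B 0" using n ic ip by (simp add: K.B_def)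
  then have "c \<otimes> (inv c \<otimes> inv p) \<in> V" using base_le_V assms V_closed by auto
  moreover have "c \<otimes> (inv c \<otimes> inv p) = inv p" using c ic by (simp add: K.m_assoc[symmetric])
  ultimately show False using inv_p_notin by simp
qed

text \<open>In a vanishing sum two terms must have the same value, and their quotient is a unit of
  the form c x^j with j \<ge> 1. Without such a tie, each partial sum is a unit times a single
  dominant term, hence nonzero. Thus the values of N are torsion modulo those of K.\<close>

lemma tie:
  assumes x: "x \<in> N" "x \<noteq> \<zero>"
    and cs: "set cs \<subseteq> K" "\<exists>c\<in>set cs. c \<noteq> \<zero>" "K.eval cs x = \<zero>"
  shows "\<exists>j c. 1 \<le> j \<and> j < length cs \<and> c \<in> K \<and> c \<noteq> \<zero> \<and> c \<otimes> x [^] j \<in> U"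
proof (rule ccontr)
  assume nt: "\<not> ?thesis"
  have xc: "x \<in> carrier R" using x N_carrier by simp
  have "\<exists>i<length ds. \<exists>c\<in>K. c \<noteq> \<zero> \<and> (\<exists>u\<in>U. K.eval ds x = c \<otimes> x [^] i \<otimes> u)"
    if "set ds \<subseteq> K" "\<exists>c\<in>set ds. c \<noteq> \<zero>" "length ds \<le> length cs" for ds
    using that
  proof (induction ds)
    case Nil
    then show ?case by simp
  next
    case (Cons c ds)
    have cK: "c \<in> K" using Cons by simp
    have dsc: "set ds \<subseteq> carrier R" using Cons K_carrier by auto
    have ev: "K.eval (c # ds) x = c \<otimes> x [^] length ds \<oplus> K.eval ds x" by simp
    define L where "L = length ds"
    have ec: "K.eval ds x \<in> carrier R" using K.eval_in_carrier dsc xc by simp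
    show ?case
    proof (cases "\<exists>c\<in>set ds. c \<noteq> \<zero>")
      case False
      have "K.eval ds' x = \<zero>" if "\<forall>c\<in>set ds'. c = \<zero>" for ds'
        using that by (induction ds') (use xc in auto)
      then have "K.eval (c # ds) x = c \<otimes> x [^] L \<otimes> \<one>" using False ev cK K_carrier xc by (simp add: L_def)
      moreover have "c \<noteq> \<zero>" using Cons False by auto
      ultimately show ?thesis using cK U_one
        by (intro exI[of _ L] conjI bexI[of _ c] bexI[of _ \<one>]) (simp_all add: L_def)
    next
      case True
      have "\<exists>i<length ds. \<exists>c\<in>K. c \<noteq> \<zero> \<and> (\<exists>u\<in>U. K.eval ds x = c \<otimes> x [^] i \<otimes> u)"
        using Cons.IH True Cons.prems by simp
      then obtain i d u where d: "i < L" "d \<in> K" "d \<noteq> \<zero>" "u \<in> U" "K.eval ds x = d \<otimes> x [^] i \<otimes> u"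
        unfolding L_def by blast
      show ?thesis
      proof (cases "c = \<zero>")
        case True
        then have "K.eval (c # ds) x = d \<otimes> x [^] i \<otimes> u" using ev ec xc d(5) by simp
        then show ?thesis using d
          by (intro exI[of _ i] conjI bexI[of _ d] bexI[of _ u]) (simp_all add: L_def)
      next
        case c0: False
        define z where "z = x [^] (L - i)"
        define y where "y = x [^] i"
        have yz: "y \<in> N" "y \<noteq> \<zero>" "z \<in> N" "z \<noteq> \<zero>" using x N_pow N_pow_nz by (auto simp: y_def z_def)
        have xL: "x [^] L = y \<otimes> z" using d(1) xc by (simp add: y_def z_def K.nat_pow_mult)
        have dN: "d \<in> N" and cN: "c \<in> N" using d cK K_le_N by auto
        note id = K.N_inv[OF d(2,3)] and ic = K.N_inv[OF cK c0]
        have idN: "inv d \<in> N" using id K_le_N by auto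
        have icN: "inv c \<in> N" using ic K_le_N by auto
        note u = U_N[OF d(4)]
        note iuN = N_inv[OF u(1,2)]
        define g where "g = (c \<otimes> inv d) \<otimes> z"
        have gN: "g \<in> N" "g \<noteq> \<zero>" using cN c0 idN id yz N_closed N_mult_nz by (auto simp: g_def)
        have gU: "g \<notin> U"
        proof
          assume "g \<in> U"
          then have "(c \<otimes> inv d) \<otimes> x [^] (L - i) \<in> U" by (simp add: g_def z_def)
          moreover have "c \<otimes> inv d \<in> K" "c \<otimes> inv d \<noteq> \<zero>" using cK c0 id K.N_mult_nz by auto
          moreover have "1 \<le> L - i" "L - i < length cs" using d(1) Cons.prems by (auto simp: L_def)
          ultimately show False using nt by blast
        qed
        \<comment> \<open>t is the quotient of the new term c x^L by the dominant form d x^i u of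
          the rest. It is not a unit, so the sum is the larger of the two times 1 plus a
          nonunit.\<close>
        define t where "t = g \<otimes> inv u"
        have tN: "t \<in> N" "t \<noteq> \<zero>" using gN iuN N_closed N_mult_nz by (auto simp: t_def)
        have cc: "c \<in> carrier R" "d \<in> carrier R" "inv d \<in> carrier R" "inv c \<in> carrier R" "y \<in> carrier R" "z \<in> carrier R"
          "u \<in> carrier R" "inv u \<in> carrier R" "g \<in> carrier R" "t \<in> carrier R" "inv t \<in> carrier R"
          using cN dN idN icN yz u iuN gN tN N_inv[OF tN] N_carrier by auto
        have tu: "t \<otimes> u = g" using cc iuN by (simp add: t_def K.m_assoc)
        have tU: "t \<notin> U" using U_mult[of t u] d(4) tu gU by auto
        have iit: "inv (inv t) = t" by (rule inv_invN[OF tN])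
        have itU: "inv t \<notin> U" using U_inv[of "inv t"] iit tU by auto
        have dg: "d \<otimes> g = c \<otimes> z"
        proof -
          have "d \<otimes> g = (d \<otimes> inv d) \<otimes> (c \<otimes> z)" unfolding g_def using cc(1-3,6) by algebra
          then show ?thesis using id cc by simp
        qed
        have e: "K.eval (c # ds) x = c \<otimes> (y \<otimes> z) \<oplus> d \<otimes> y \<otimes> u"
          using ev d(5) xL by (simp add: L_def y_def)
        have e2: "c \<otimes> (y \<otimes> z) = d \<otimes> y \<otimes> (t \<otimes> u)"
        proof -
          have "d \<otimes> y \<otimes> (t \<otimes> u) = y \<otimes> (d \<otimes> g)" unfolding tu using cc by (simp add: K.m_lcomm K.m_assoc)
          then show ?thesis unfolding dg using cc by (simp add: K.m_lcomm)
        qed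
        from valuation_ring_dichotomy[OF tN] show ?thesis
        proof
          assume "t \<in> V"
          then have 1: "\<one> \<oplus> t \<in> U" using one_plus_nonunit tU by simp
          have "K.eval (c # ds) x = d \<otimes> x [^] i \<otimes> (u \<otimes> (\<one> \<oplus> t))"
            unfolding e e2 y_def[symmetric] using cc(2,5,7,10) by algebra
          moreover have "u \<otimes> (\<one> \<oplus> t) \<in> U" using U_mult d(4) 1 by simp
          ultimately show ?thesis using d(1-3)
            by (intro exI[of _ i] conjI bexI[of _ d] bexI[of _ "u \<otimes> (\<one> \<oplus> t)"]) (simp_all add: L_def)
        next
          assume "inv t \<in> V"
          then have 1: "\<one> \<oplus> inv t \<in> U" using one_plus_nonunit itU by simp
          have tt: "inv t \<otimes> t = \<one>" using N_inv[OF tN] by simp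
          have "c \<otimes> x [^] L \<otimes> (\<one> \<oplus> inv t) = c \<otimes> (y \<otimes> z) \<oplus> c \<otimes> (y \<otimes> z) \<otimes> inv t"
            unfolding xL using cc(1,5,6,11) by algebra
          also have "c \<otimes> (y \<otimes> z) \<otimes> inv t = d \<otimes> y \<otimes> u \<otimes> (inv t \<otimes> t)"
            unfolding e2 using cc(2,5,7,10,11) by algebra
          finally have "K.eval (c # ds) x = c \<otimes> x [^] L \<otimes> (\<one> \<oplus> inv t)"
            unfolding e tt using cc by simp
          then show ?thesis using cK c0 1
            by (intro exI[of _ L] conjI bexI[of _ c] bexI[of _ "\<one> \<oplus> inv t"]) (simp_all add: L_def)
        qed
      qed
    qed
  qed
  from this[OF cs(1,2)] obtain i c u where c: "c \<in> K" "c \<noteq> \<zero>" "u \<in> U" "K.eval cs x = c \<otimes> x [^] (i::nat) \<otimes> u"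
    by auto
  have cN: "c \<in> N" using c(1) K_le_N by auto
  have "c \<otimes> x [^] i \<in> N" "c \<otimes> x [^] i \<noteq> \<zero>"
    using N_closed(5)[OF cN N_pow[OF x(1)]] N_mult_nz[OF cN c(2) N_pow[OF x(1)] N_pow_nz[OF x]] by auto
  then have "c \<otimes> x [^] i \<otimes> u \<noteq> \<zero>" using N_mult_nz U_N(1,2)[OF c(3)] by simp
  then show False using c cs(3) by simp
qed

end

locale dominating_ring_exponent = dominating_ring +
  fixes D :: nat
  assumes D_pos: "1 \<le> D"
    and exponent: "\<lbrakk> x \<in> N; x \<noteq> \<zero> \<rbrakk> \<Longrightarrow> \<exists>c\<in>K. c \<noteq> \<zero> \<and> c \<otimes> x [^] D \<in> U"
begin

text \<open>The value of x^D read off in K. Passing to D-th powers keeps the values integral, where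
  the extension of v to N may take fractional values.\<close>

definition lam :: "'a \<Rightarrow> int"
  where "lam x = - v (SOME c. c \<in> K \<and> c \<noteq> \<zero> \<and> c \<otimes> x [^] D \<in> U)"

text \<open>Two admissible choices of c differ by a unit of V that lies in K, and such a unit has v
  equal to 0 by \<open>base_V\<close>.\<close>

lemma lam_eq:
  assumes x: "x \<in> N" "x \<noteq> \<zero>" and c: "c \<in> K" "c \<noteq> \<zero>" "c \<otimes> x [^] D \<in> U"
  shows "lam x = - v c"
proof -
  define d where "d = (SOME c. c \<in> K \<and> c \<noteq> \<zero> \<and> c \<otimes> x [^] D \<in> U)"
  have d: "d \<in> K \<and> d \<noteq> \<zero> \<and> d \<otimes> x [^] D \<in> U" unfolding d_def by (rule someI[of _ c]) (use c in blast)
  define y where "y = x [^] D"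
  have y: "y \<in> N" "y \<noteq> \<zero>" using x N_pow N_pow_nz by (auto simp: y_def)
  have cN: "c \<in> N" "d \<in> N" using c d K_le_N by auto
  note id = N_inv[OF cN(2)] and iy = N_inv[OF y]
  have cc: "c \<in> carrier R" "d \<in> carrier R" "y \<in> carrier R" "inv d \<in> carrier R" "inv y \<in> carrier R"
    using cN y id iy d N_carrier by auto
  have "(c \<otimes> y) \<otimes> inv (d \<otimes> y) \<in> U" using c d U_mult U_inv by (simp add: y_def)
  moreover have "(c \<otimes> y) \<otimes> inv (d \<otimes> y) = (c \<otimes> inv d) \<otimes> (y \<otimes> inv y)"
    unfolding inv_mult[OF cN(2) conjunct1[OF conjunct2[OF d]] y] using cc by algebra
  ultimately have cd: "c \<otimes> inv d \<in> U" using iy cc by simp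
  have idK: "inv d \<in> K" "inv d \<noteq> \<zero>" "v (inv d) = - v d" using K.N_inv[of d] K.w_inv[of d] d by auto
  have k: "c \<otimes> inv d \<in> K" "c \<otimes> inv d \<noteq> \<zero>" "v (c \<otimes> inv d) = v c - v d"
    using c idK K.N_mult_nz K.w_mult by auto
  have "0 \<le> v (c \<otimes> inv d)" using base_V[OF k(1,2)] cd U_N by simp
  moreover have "0 \<le> v (inv (c \<otimes> inv d))"
    using base_V[of "inv (c \<otimes> inv d)"] K.N_inv[OF k(1,2)] U_N(4)[OF cd] by simp
  ultimately have "v c = v d" using K.w_inv[OF k(1,2)] k(3) by simp
  then show ?thesis by (simp add: lam_def d_def)
qed

lemma lam_mult:
  assumes x: "x \<in> N" "x \<noteq> \<zero>" and y: "y \<in> N" "y \<noteq> \<zero>"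
  shows "lam (x \<otimes> y) = lam x + lam y"
proof -
  obtain c where c: "c \<in> K" "c \<noteq> \<zero>" "c \<otimes> x [^] D \<in> U" using exponent[OF x] by blast
  obtain d where d: "d \<in> K" "d \<noteq> \<zero>" "d \<otimes> y [^] D \<in> U" using exponent[OF y] by blast
  have cc: "c \<in> carrier R" "d \<in> carrier R" "x [^] D \<in> carrier R" "y [^] D \<in> carrier R" "x \<in> carrier R" "y \<in> carrier R"
    using c d x y K_carrier N_carrier N_pow by auto
  have "(c \<otimes> d) \<otimes> (x \<otimes> y) [^] D = (c \<otimes> x [^] D) \<otimes> (d \<otimes> y [^] D)"
    unfolding K.nat_pow_distrib[OF cc(5,6)] using cc(1-4) by algebra
  also have "\<dots> \<in> U" by (rule U_mult[OF c(3) d(3)])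
  finally have u: "(c \<otimes> d) \<otimes> (x \<otimes> y) [^] D \<in> U" .
  have "lam (x \<otimes> y) = - v (c \<otimes> d)"
    by (rule lam_eq[OF _ _ _ _ u]) (use x y c d N_closed N_mult_nz K.N_mult_nz in auto)
  then show ?thesis using lam_eq[OF x c] lam_eq[OF y d] K.w_mult c d by simp
qed

lemma lam_base:
  assumes c: "c \<in> K" "c \<noteq> \<zero>"
  shows "lam c = int D * v c"
proof -
  have n: "c [^] D \<in> K" "c [^] D \<noteq> \<zero>" using c K.N_pow_nz by auto
  note i = K.N_inv[OF n]
  have "lam c = - v (inv (c [^] D))"
    by (rule lam_eq) (use c K_le_N i U_one in auto)
  then show ?thesis using K.w_inv[OF n] K.w_pow[OF c] by simp
qed

lemma lam_nonneg:
  assumes x: "x \<in> N" "x \<noteq> \<zero>"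
  shows "0 \<le> lam x \<longleftrightarrow> x \<in> V"
proof -
  obtain c where c: "c \<in> K" "c \<noteq> \<zero>" "c \<otimes> x [^] D \<in> U" using exponent[OF x] by blast
  have l: "lam x = - v c" by (rule lam_eq[OF x c])
  note ic = K.N_inv[OF c(1,2)]
  define u where "u = c \<otimes> x [^] D"
  have u: "u \<in> U" using c by (simp add: u_def)
  note uu = U_N[OF u]
  note iu = N_inv[OF uu(1,2)]
  have cc: "c \<in> carrier R" "inv c \<in> carrier R" "x [^] D \<in> carrier R" "u \<in> carrier R" "inv u \<in> carrier R" "x \<in> carrier R"
    using c ic x uu iu K_carrier N_carrier N_pow by auto
  have xD: "x [^] D = inv c \<otimes> u" unfolding u_def using cc ic by (simp add: K.m_assoc[symmetric])
  show ?thesis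
  proof
    assume "x \<in> V"
    then have "x [^] D \<otimes> inv u \<in> V" by (rule V_closed(5)[OF V_pow uu(4)])
    moreover have "x [^] D \<otimes> inv u = inv c" unfolding xD using cc iu by (simp add: K.m_assoc)
    ultimately have "0 \<le> v (inv c)" using base_V ic by simp
    then show "0 \<le> lam x" using l K.w_inv[OF c(1,2)] by simp
  next
    assume "0 \<le> lam x"
    then have "inv c \<in> K.B 0" using l ic K.w_inv[OF c(1,2)] by (simp add: K.B_def)
    then have xDV: "x [^] D \<in> V" unfolding xD using base_le_V uu V_closed by auto
    show "x \<in> V"
    proof (rule ccontr)
      assume "x \<notin> V"
      then have ixV: "inv x \<in> V" using valuation_ring_dichotomy[OF x] by simp
      note ix = N_inv[OF x]
      have ixc: "inv x \<in> carrier R" using ix N_carrier by simp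
      \<comment> \<open>V contains x as soon as it contains x^D and x^-1, because x = x^D
        (x^-1)^(D-1).\<close>
      have e: "x [^] Suc n \<otimes> inv x [^] n = x" for n :: nat
      proof (induction n)
        case (Suc n)
        define a where "a = x [^] n"
        define b where "b = inv x [^] n"
        have ab: "a \<in> carrier R" "b \<in> carrier R" using cc(6) ixc by (auto simp: a_def b_def)
        have "x [^] Suc (Suc n) \<otimes> inv x [^] Suc n = ((a \<otimes> x) \<otimes> b) \<otimes> (x \<otimes> inv x)"
          unfolding nat_pow_Suc a_def[symmetric] b_def[symmetric] using ab cc(6) ixc by algebra
        then show ?case using Suc ix cc(6) by (simp add: a_def b_def)
      qed (use cc in simp)
      have "x [^] D \<otimes> inv x [^] (D - 1) \<in> V" using xDV V_pow[OF ixV] V_closed by simp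
      then show False using e[of "D - 1"] D_pos \<open>x \<notin> V\<close> by simp
    qed
  qed
qed

lemma lam_valued: "valued_subfield R N lam"
proof (intro valued_subfield.intro valued_subfield_axioms.intro K.field_axioms subfield_top)
  fix x y assume xy: "x \<in> N" "x \<noteq> \<zero>" "y \<in> N" "y \<noteq> \<zero>"
  then show "lam (x \<otimes> y) = lam x + lam y" by (rule lam_mult)
next
  have half: "lam x \<le> lam (x \<oplus> y)"
    if xy: "x \<in> N" "x \<noteq> \<zero>" "y \<in> N" "x \<oplus> y \<noteq> \<zero>" and q: "inv x \<otimes> y \<in> V" for x y
  proof -
    note ix = N_inv[OF xy(1,2)]
    have c: "x \<in> carrier R" "y \<in> carrier R" "inv x \<in> carrier R" using xy ix N_carrier by auto
    define z where "z = \<one> \<oplus> inv x \<otimes> y"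
    have zV: "z \<in> V" using q V_closed by (simp add: z_def)
    have "x \<otimes> z = x \<oplus> (x \<otimes> inv x) \<otimes> y" unfolding z_def using c by algebra
    then have xz: "x \<otimes> z = x \<oplus> y" using ix c by simp
    have z0: "z \<noteq> \<zero>" using xz xy c by auto
    have zN: "z \<in> N" using zV V_le_N by auto
    have "0 \<le> lam z" using lam_nonneg[OF zN z0] zV by simp
    then show ?thesis using lam_mult[OF xy(1,2) zN z0] xz by simp
  qed
  fix x y assume xy: "x \<in> N" "x \<noteq> \<zero>" "y \<in> N" "y \<noteq> \<zero>" "x \<oplus> y \<noteq> \<zero>"
  note ix = N_inv[OF xy(1,2)] and iy = N_inv[OF xy(3,4)]
  have c: "x \<in> carrier R" "y \<in> carrier R" "inv x \<in> carrier R" "inv y \<in> carrier R"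
    using xy ix iy N_carrier by auto
  have q: "inv x \<otimes> y \<in> N" "inv x \<otimes> y \<noteq> \<zero>" using ix xy N_closed N_mult_nz by auto
  from valuation_ring_dichotomy[OF q] show "min (lam x) (lam y) \<le> lam (x \<oplus> y)"
  proof
    assume "inv x \<otimes> y \<in> V"
    then have "lam x \<le> lam (x \<oplus> y)" by (rule half[OF xy(1,2,3,5)])
    then show ?thesis by simp
  next
    assume "inv (inv x \<otimes> y) \<in> V"
    moreover have "inv (inv x \<otimes> y) = inv y \<otimes> x"
      unfolding inv_mult[OF ix(1,2) xy(3,4)] inv_invN[OF xy(1,2)] using c by (simp add: K.m_comm)
    ultimately have "lam y \<le> lam (y \<oplus> x)" using half[OF xy(3,4,1)] xy(5) c by (simp add: K.a_comm)
    then show ?thesis using c by (simp add: K.a_comm)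
  qed
qed

end

text \<open>The values form a subgroup of the integers, and d is its generator, the least positive
  value.\<close>

lemma (in valued_subfield) normalise:
  assumes "x0 \<in> N" "x0 \<noteq> \<zero>" "0 < w x0"
  shows "\<exists>d>0. (\<forall>x\<in>N. x \<noteq> \<zero> \<longrightarrow> d dvd w x) \<and> valued_subfield R N (\<lambda>x. w x div d) \<and>
    (\<forall>k. \<exists>x\<in>N. x \<noteq> \<zero> \<and> w x div d = k)"
proof -
  define P where "P n \<longleftrightarrow> 0 < n \<and> (\<exists>x\<in>N. x \<noteq> \<zero> \<and> w x = int n)" for n
  have "P (nat (w x0))" using assms by (auto simp: P_def)
  define n where "n = (LEAST n. P n)"
  have Pn: "P n" unfolding n_def by (rule LeastI) fact
  then obtain y where y: "y \<in> N" "y \<noteq> \<zero>" "w y = int n" and n0: "0 < n" by (auto simp: P_def)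
  define d where "d = int n"
  have dvd: "d dvd w x" if x: "x \<in> N" "x \<noteq> \<zero>" for x
  proof -
    obtain z where z: "z \<in> N" "z \<noteq> \<zero>" "w z = - (w x div d) * w y" using exists_multiple[OF y(1,2)] by blast
    have xz: "x \<otimes> z \<in> N" "x \<otimes> z \<noteq> \<zero>" using x z N_mult_nz by auto
    have "w (x \<otimes> z) = w x + (- (w x div d)) * d" using w_mult x z y by (simp add: d_def)
    then have wxz: "w (x \<otimes> z) = w x mod d" by (simp add: minus_div_mult_eq_mod[symmetric])
    have b: "0 \<le> w x mod d" "w x mod d < d" using n0 by (auto simp: d_def)
    have "w x mod d = 0"
    proof (rule ccontr)
      assume "w x mod d \<noteq> 0"
      then have "P (nat (w x mod d))" using b xz wxz by (auto simp: P_def)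
      then have "n \<le> nat (w x mod d)" unfolding n_def by (rule Least_le)
      then show False using b by (simp add: d_def)
    qed
    then show ?thesis by auto
  qed
  have d0: "0 < d" using n0 by (simp add: d_def)
  have "valued_subfield R N (\<lambda>x. w x div d)"
  proof (intro valued_subfield.intro valued_subfield_axioms.intro field_axioms subfieldN)
    fix x y assume xy: "x \<in> N" "x \<noteq> \<zero>" "y \<in> N" "y \<noteq> \<zero>"
    then show "w (x \<otimes> y) div d = w x div d + w y div d" using w_mult dvd by (simp add: div_plus_div_distrib_dvd_left)
  next
    fix x y assume xy: "x \<in> N" "x \<noteq> \<zero>" "y \<in> N" "y \<noteq> \<zero>" "x \<oplus> y \<noteq> \<zero>"
    have "w x div d \<le> w (x \<oplus> y) div d \<or> w y div d \<le> w (x \<oplus> y) div d"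
      using w_add[OF xy] d0 by (auto simp: min_def split: if_splits intro: zdiv_mono1)
    then show "min (w x div d) (w y div d) \<le> w (x \<oplus> y) div d" by auto
  qed
  moreover have "\<exists>x\<in>N. x \<noteq> \<zero> \<and> w x div d = k" for k
  proof -
    obtain z where z: "z \<in> N" "z \<noteq> \<zero>" "w z = k * w y" using exists_multiple[OF y(1,2)] by blast
    then have "w z div d = k" using y d0 by (simp add: d_def)
    then show ?thesis using z by blast
  qed
  ultimately show ?thesis using d0 dvd by blast
qed

text \<open>Completeness and the finiteness of the residue field are read off from a base of N over
  K. The representatives that are found in N are cut down to \<open>B 0\<close>, since t = x - (x -
  t) is integral whenever it serves an integral x.\<close>

lemma (in local_base) local_subfieldI:
  assumes "finite_dimension K N" and "\<And>k. \<exists>x\<in>N. x \<noteq> \<zero> \<and> w x = k"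
  shows "local_subfield R N w"
proof -
  have sf: "subfield K R" by (rule K.subfieldN)
  obtain n where n: "dimension n K N" using assms(1) by (auto simp: finite_dimension_def)
  then obtain Us where Us: "set Us \<subseteq> carrier R" "Span K Us = N" using exists_base[OF sf n] by blast
  have "set Us \<subseteq> N" using Span_base_incl[OF sf Us(1)] Us(2) by simp
  note sp = Span_complete_bounded[OF this, unfolded Us(2)]
  obtain T where T: "finite T" "\<forall>x\<in>N \<inter> B 0. \<exists>t\<in>T. x \<ominus> t \<in> B 1" "T \<subseteq> N" using sp by blast
  have "\<exists>t\<in>T \<inter> B 0. x \<ominus> t \<in> B 1" if x: "x \<in> B 0" for x
  proof -
    obtain t where t: "t \<in> T" "x \<ominus> t \<in> B 1" using T x B_N by blast
    have c: "x \<in> carrier R" "t \<in> carrier R" using x t T(3) B_carrier N_carrier by auto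
    have "x \<ominus> t \<in> B 0" using t(2) B_mono[of 0 1] by simp
    then have "x \<ominus> (x \<ominus> t) \<in> B 0" by (rule B_minus[OF x])
    moreover have "x \<ominus> (x \<ominus> t) = t" using c unfolding a_minus_def by algebra
    ultimately show ?thesis using t by auto
  qed
  then have "\<exists>T. finite T \<and> T \<subseteq> B 0 \<and> (\<forall>x\<in>B 0. \<exists>t\<in>T. x \<ominus> t \<in> B 1)"
    using T(1) by (intro exI[of _ "T \<inter> B 0"]) auto
  then show ?thesis
    using assms(2) sp valued_subfield_axioms by (intro local_subfield.intro local_subfield_axioms.intro) auto
qed

theorem (in local_subfield) finite_extension_local:
  assumes L: "subfield L R" "N \<subseteq> L" "finite_dimension N L"
  shows "\<exists>u. local_subfield R L u"
proof -
  obtain p where p: "p \<in> N" "p \<noteq> \<zero>" "w p = 1" using w_surj by blast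
  note ip = N_inv[OF p(1,2)]
  define \<A> where "\<A> = {V. subring V R \<and> B 0 \<subseteq> V \<and> V \<subseteq> L \<and> inv p \<notin> V}"
  have B0: "subring (B 0) R"
    by (rule subringI) (use B_carrier B0_mult in auto)
  have "inv p \<notin> B 0" using ip w_inv[OF p(1,2)] p by (simp add: B_def)
  then have "B 0 \<in> \<A>" using B0 B_N L(2) by (auto simp: \<A>_def)
  moreover have "(\<Union>C) \<in> \<A>" if C: "C \<noteq> {}" "subset.chain \<A> C" for C
  proof -
    have CA: "C \<subseteq> \<A>" and lin: "\<And>S S'. S \<in> C \<Longrightarrow> S' \<in> C \<Longrightarrow> S \<subseteq> S' \<or> S' \<subseteq> S"
      using C(2) by (auto simp: subset.chain_def)
    have sub: "\<And>S. S \<in> C \<Longrightarrow> subring S R" using CA by (auto simp: \<A>_def)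
    have both: "\<exists>S\<in>C. x \<in> S \<and> y \<in> S" if "x \<in> \<Union>C" "y \<in> \<Union>C" for x y
      using that lin by blast
    have "subring (\<Union>C) R"
    proof (rule subringI)
      show "\<Union>C \<subseteq> carrier R" using sub subringE(1) by blast
      show "\<one> \<in> \<Union>C" using C(1) sub subringE(3) by blast
      show "\<ominus> h \<in> \<Union>C" if "h \<in> \<Union>C" for h
      proof -
        obtain S where S: "S \<in> C" "h \<in> S" using \<open>h \<in> \<Union>C\<close> by blast
        show ?thesis by (rule UnionI[OF S(1) subringE(5)[OF sub[OF S(1)] S(2)]])
      qed
      fix h1 h2 assume "h1 \<in> \<Union>C" "h2 \<in> \<Union>C"
      from both[OF this] obtain S where S: "S \<in> C" "h1 \<in> S" "h2 \<in> S" by blast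
      show "h1 \<otimes> h2 \<in> \<Union>C" by (rule UnionI[OF S(1) subringE(6)[OF sub[OF S(1)] S(2,3)]])
      show "h1 \<oplus> h2 \<in> \<Union>C" by (rule UnionI[OF S(1) subringE(7)[OF sub[OF S(1)] S(2,3)]])
    qed
    moreover have "B 0 \<subseteq> \<Union>C" "\<Union>C \<subseteq> L" "inv p \<notin> \<Union>C" using C(1) CA by (auto simp: \<A>_def)
    ultimately show ?thesis by (simp add: \<A>_def)
  qed
  ultimately obtain V where V: "V \<in> \<A>" "\<And>S. S \<in> \<A> \<Longrightarrow> V \<subseteq> S \<Longrightarrow> S = V"
    using subset_Zorn_nonempty[of \<A>] by blast
  interpret DR: dominating_ring R N w L p V
  proof (intro dominating_ring.intro dominating_ring_axioms.intro local_subfield_axioms)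
    fix x assume x: "x \<in> L" "x \<notin> V"
    have xc: "x \<in> carrier R" using x subfieldE(3)[OF L(1)] by auto
    have Vr: "subring V R" "B 0 \<subseteq> V" "V \<subseteq> L" using V by (auto simp: \<A>_def)
    have VE: "V \<subseteq> simple_extension V x" by (rule simple_extension_incl[OF subringE(1)[OF Vr(1)] xc])
    have "subring (simple_extension V x) R" by (rule simple_extension_is_subring[OF Vr(1) xc])
    moreover have "simple_extension V x \<subseteq> L"
      by (rule simple_extension_subring_incl[OF subfieldE(1)[OF L(1)] Vr(3) x(1)])
    moreover have "simple_extension V x \<noteq> V" using simple_extension_mem[OF Vr(1) xc] x by auto
    ultimately show "inv p \<in> simple_extension V x"
      using V(2)[of "simple_extension V x"] VE Vr(2) by (auto simp: \<A>_def)
  qed (use L p V in \<open>auto simp: \<A>_def\<close>)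
  obtain n where n: "dimension n N L" using L(3) by (auto simp: finite_dimension_def)
  \<comment> \<open>Any n + 1 powers of an element x of L are dependent over N, so
    \<open>tie\<close> gives an exponent j \<le> n. The factorial is a multiple of all these j,
    hence one exponent for all x.\<close>
  define D :: nat where "D = fact n"
  interpret DE: dominating_ring_exponent R N w L p V D
  proof (intro dominating_ring_exponent.intro dominating_ring_exponent_axioms.intro DR.dominating_ring_axioms)
    show "1 \<le> D" by (simp add: D_def)
    fix x assume x: "x \<in> L" "x \<noteq> \<zero>"
    have xc: "x \<in> carrier R" using x DR.N_carrier by simp
    have set: "set (exp_base x (Suc n)) \<subseteq> L" using DR.N_pow[OF x(1)] by (auto simp: exp_base_def)
    have car: "set (exp_base x (Suc n)) \<subseteq> carrier R" by (rule exp_base_closed[OF xc])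
    have len: "length (exp_base x (Suc n)) = Suc n" by (simp add: exp_base_def)
    have "dependent N (exp_base x (Suc n))"
    proof
      assume "independent N (exp_base x (Suc n))"
      then have "length (exp_base x (Suc n)) \<le> n"
        by (rule independent_length_le_dimension[OF subfieldN n _ set])
      then show False using len by simp
    qed
    from dependent_imp_non_trivial_combine[OF subfieldN car this]
    obtain Ks where Ks: "length Ks = Suc n" "combine Ks (exp_base x (Suc n)) = \<zero>" "set Ks \<subseteq> N" "set Ks \<noteq> {\<zero>}"
      unfolding len by blast
    have ev: "eval Ks x = \<zero>" using combine_eq_eval[of Ks x] Ks by simp
    have "\<exists>c\<in>set Ks. c \<noteq> \<zero>" using Ks(1,4) by (cases Ks) auto
    from DR.tie[OF x Ks(3) this ev] obtain j c
      where j: "1 \<le> j" "j \<le> n" "c \<in> N" "c \<noteq> \<zero>" "c \<otimes> x [^] j \<in> DR.U" using Ks(1) by auto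
    have "j dvd D" unfolding D_def by (rule dvd_fact) (use j in auto)
    then obtain k where k: "D = j * k" by (auto simp: dvd_def)
    have cc: "c \<in> carrier R" using j N_carrier by simp
    have "(c \<otimes> x [^] j) [^] k \<in> DR.U" by (rule DR.U_pow[OF j(5)])
    also have "(c \<otimes> x [^] j) [^] k = c [^] k \<otimes> x [^] D"
      using cc xc by (simp add: nat_pow_distrib nat_pow_pow k)
    finally show "\<exists>c\<in>N. c \<noteq> \<zero> \<and> c \<otimes> x [^] D \<in> DR.U"
      using j(3,4) N_pow_nz by (intro bexI[of _ "c [^] k"]) auto
  qed
  interpret V0: valued_subfield R L DE.lam by (rule DE.lam_valued)
  have lp: "DE.lam p = int D" using DE.lam_base[OF p(1,2)] p(3) by simp
  then have lp0: "0 < DE.lam p" using DE.D_pos by simp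
  obtain d where d: "d > 0" "\<forall>x\<in>L. x \<noteq> \<zero> \<longrightarrow> d dvd DE.lam x"
    "valued_subfield R L (\<lambda>x. DE.lam x div d)" "\<forall>k. \<exists>x\<in>L. x \<noteq> \<zero> \<and> DE.lam x div d = k"
    using V0.normalise[of p] lp0 p L(2) by blast
  interpret W: valued_subfield R L "\<lambda>x. DE.lam x div d" by (rule d(3))
  \<comment> \<open>D is the value \<open>lam p\<close> of the uniformiser of N. After division by d
    the valuation restricts to e w with e = D / d.\<close>
  have "d dvd int D" using d(2) p L(2) lp by auto
  then obtain e where e: "int D = d * e" by (auto simp: dvd_def)
  have e0: "0 < e" using e d(1) DE.D_pos by (smt (verit) mult_nonneg_nonpos of_nat_1 of_nat_mono)
  interpret LB: local_base R L "\<lambda>x. DE.lam x div d" N w e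
  proof (intro local_base.intro local_base_axioms.intro W.valued_subfield_axioms local_subfield_axioms L(2) e0)
    fix x assume x: "x \<in> N" "x \<noteq> \<zero>"
    then show "DE.lam x div d = e * w x" using DE.lam_base[OF x] e d(1) by (simp add: mult.assoc)
  qed
  show ?thesis using LB.local_subfieldI[OF L(3)] d(4) by blast
qed

section \<open>Total ramification and residue fields\<close>

context field begin

lemma subfield_subalgebra:
  assumes "subring E R" "K \<subseteq> E" shows "subalgebra K E R"
  using assms(2) subringE(6)[OF assms(1)] assms(1)
  by (intro subalgebra.intro subalgebra_axioms.intro subring.axioms(1)) auto

lemma finite_dimension_intermediate:
  assumes "subfield K R" "subfield F R" "subring N R" "K \<subseteq> F" "F \<subseteq> N" "finite_dimension K N"
  shows "finite_dimension K F" "finite_dimension F N"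
proof -
  show "finite_dimension K F"
    by (rule subalbegra_incl_imp_finite_dimension[OF assms(1,6) _ assms(5)])
      (rule subfield_subalgebra[OF subfieldE(1)[OF assms(2)] assms(4)])
  obtain n where n: "dimension n K N" using assms(6) by (auto simp: finite_dimension_def)
  obtain Us where Us: "set Us \<subseteq> carrier R" "Span K Us = N" using exists_base[OF assms(1) n] by blast
  have UsN: "set Us \<subseteq> N" using Span_base_incl[OF assms(1) Us(1)] Us(2) by simp
  have "Span F Us \<subseteq> N" by (rule subalgebra_Span_incl[OF assms(2) subfield_subalgebra[OF assms(3,5)] UsN])
  moreover have "Span K Us \<subseteq> Span F Us"
  proof (rule subalgebra_Span_incl[OF assms(1) _ Span_base_incl[OF assms(2) Us(1)]])
    show "subalgebra K (Span F Us) R"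
      using Span_is_subalgebra[OF assms(2) Us(1)] assms(4) by (auto simp: subalgebra_def subalgebra_axioms_def)
  qed
  ultimately show "finite_dimension F N" using Us(2) Span_finite_dimension[OF assms(2) Us(1)] by auto
qed

lemma finite_dimension_generators:
  assumes "subfield K R" "subring N R" "K \<subseteq> N" "finite_dimension K N"
  obtains Us where "set Us \<subseteq> N" "finite_extension K Us = N" "Span K Us = N"
proof -
  obtain n where n: "dimension n K N" using assms(4) by (auto simp: finite_dimension_def)
  obtain Us where Us: "set Us \<subseteq> carrier R" "Span K Us = N" using exists_base[OF assms(1) n] by blast
  have UsN: "set Us \<subseteq> N" using Span_base_incl[OF assms(1) Us(1)] Us(2) by simp
  have "finite_extension K Us \<subseteq> N" by (rule finite_extension_subring_incl[OF assms(2,3) UsN])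
  moreover have "Span K Us \<subseteq> finite_extension K Us"
  proof (rule subalgebra_Span_incl[OF assms(1)])
    show "subalgebra K (finite_extension K Us) R"
      using finite_extension_is_subring[OF subfieldE(1)[OF assms(1)] Us(1)]
        finite_extension_incl[OF subfieldE(3)[OF assms(1)] Us(1)] by (rule subfield_subalgebra)
    show "set Us \<subseteq> finite_extension K Us" by (rule finite_extension_mem[OF subfieldE(1)[OF assms(1)] Us(1)])
  qed
  ultimately show ?thesis using that Us UsN by blast
qed

end

lemma (in valued_subfield) restrict_valued:
  assumes "subfield K R" "K \<subseteq> N"
  shows "valued_subfield R K w"
  using assms w_mult w_add
  by (intro valued_subfield.intro valued_subfield_axioms.intro field_axioms) (auto simp: subset_iff)

lemma (in local_subfield) local_unique:
  assumes "local_subfield R N u" "x \<in> N" "x \<noteq> \<zero>"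
  shows "u x = w x"
proof -
  interpret U: local_subfield R N u by fact
  obtain c where c: "c \<ge> 0" "\<forall>x\<in>N. x \<noteq> \<zero> \<longrightarrow> u x = c * w x"
    using valuation_unique[OF U.valued_subfield_axioms] by blast
  obtain y where y: "y \<in> N" "y \<noteq> \<zero>" "u y = 1" using U.w_surj by blast
  then have "c * w y = 1" using c by simp
  then have "c = 1" using c(1) by (metis zmult_eq_1_iff neg_0_le_iff_le not_one_le_zero)
  then show ?thesis using c assms by simp
qed

text \<open>If w x < 0, the leading term of an algebraic equation for x over K would have strictly
  the smallest value and could not be cancelled.\<close>

lemma (in valued_subfield) trivial_on_base:
  assumes K: "subfield K R" "K \<subseteq> N" and triv: "\<And>c. c \<in> K \<Longrightarrow> c \<noteq> \<zero> \<Longrightarrow> w c = 0"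
    and x: "x \<in> N" "x \<noteq> \<zero>" "(algebraic over K) x"
  shows "0 \<le> w x"
proof (rule ccontr)
  assume neg: "\<not> 0 \<le> w x"
  have xc: "x \<in> carrier R" using x N_carrier by simp
  obtain p where p: "p \<in> carrier (K[X])" "p \<noteq> []" "eval p x = \<zero>"
    using algebraicE[OF subfieldE(1)[OF K(1)] xc x(3)] by blast
  have pw: "x [^] n \<in> B (int n * w x)" for n :: nat using x w_pow by (simp add: B_def)
  have KB: "c \<in> K \<Longrightarrow> c \<in> B 0" for c using K(2) triv by (cases "c = \<zero>") (auto simp: B_def)
  have bound: "eval ds x \<in> B ((int (length ds) - 1) * w x)" if "set ds \<subseteq> K" for ds
    using that
  proof (induction ds)
    case (Cons c ds)
    have "c \<otimes> x [^] length ds \<in> B (int (length ds) * w x)"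
      by (rule B0_mult(1)[OF KB pw]) (use Cons in simp)
    moreover have "eval ds x \<in> B (int (length ds) * w x)"
      by (rule B_mono[of _ "(int (length ds) - 1) * w x"]) (use Cons neg in \<open>auto simp: algebra_simps\<close>)
    ultimately show ?case using B_add by simp
  qed simp
  obtain c ds where cd: "p = c # ds" using p(2) by (cases p) auto
  have pK: "set p \<subseteq> K" "c \<noteq> \<zero>" using p(1) cd by (auto simp: univ_poly_carrier[symmetric] polynomial_def)
  then have c: "c \<in> K" "c \<in> N" "set ds \<subseteq> K" using cd K(2) by auto
  define n where "n = length ds"
  have lead: "c \<otimes> x [^] n \<in> N" "c \<otimes> x [^] n \<noteq> \<zero>" "w (c \<otimes> x [^] n) = int n * w x"
    using c pK(2) x N_pow_nz N_mult_nz w_mult w_pow triv by auto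
  have rest: "eval ds x \<in> B ((int n - 1) * w x)" using bound[OF c(3)] by (simp add: n_def)
  have sum0: "c \<otimes> x [^] n \<oplus> eval ds x = \<zero>" using p(3) cd by (simp add: n_def)
  have lt: "w (c \<otimes> x [^] n) < (int n - 1) * w x" unfolding lead(3) using neg by (simp add: algebra_simps)
  show False
  proof (cases "eval ds x = \<zero>")
    case True
    then show ?thesis using sum0 lead N_carrier by simp
  next
    case False
    then have "w (c \<otimes> x [^] n) < w (eval ds x)" using rest lt by (simp add: B_def)
    then show ?thesis using w_add_eq(1)[OF lead(1,2) B_N[OF rest] False] sum0 by simp
  qed
qed

text \<open>Uniqueness on N gives a factor c \<ge> 0. For c = 0 the valuation u would be trivial on
  N, hence nonnegative at x and at 1/x for every nonzero x in L, hence trivial on L.\<close>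

lemma (in local_subfield) local_baseI:
  assumes L: "valued_subfield R L u" "N \<subseteq> L" "finite_dimension N L"
    and nontriv: "\<exists>x\<in>L. x \<noteq> \<zero> \<and> u x \<noteq> 0"
  shows "\<exists>e. local_base R L u N w e"
proof -
  interpret U: valued_subfield R L u by fact
  obtain c where c: "c \<ge> 0" "\<forall>x\<in>N. x \<noteq> \<zero> \<longrightarrow> u x = c * w x"
    using valuation_unique[OF U.restrict_valued[OF subfieldN L(2)]] by blast
  have alg: "(algebraic over N) x" if "x \<in> L" for x
    by (rule finite_dimension_imp_algebraic[OF subfieldN U.subringN L(3) that])
  have "c \<noteq> 0"
  proof
    assume "c = 0"
    then have pos: "0 \<le> u x" if "x \<in> L" "x \<noteq> \<zero>" for x
      using U.trivial_on_base[OF subfieldN L(2) _ that alg[OF that(1)]] c by simp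
    obtain x where x: "x \<in> L" "x \<noteq> \<zero>" "u x \<noteq> 0" using nontriv by blast
    have "0 \<le> u (inv x)" using pos U.N_inv[OF x(1,2)] by blast
    then show False using pos[OF x(1,2)] U.w_inv[OF x(1,2)] x(3) by simp
  qed
  then have "0 < c" using c by simp
  then have "local_base R L u N w c"
    using c L by (intro local_base.intro local_base_axioms.intro local_subfield_axioms) auto
  then show ?thesis by blast
qed

text \<open>Every intermediate field is tested with the one valuation of the top field N. The
  element y is automatically integral, being congruent to an integral x.\<close>

definition (in valued_subfield) same_residue :: "'a set \<Rightarrow> 'a set \<Rightarrow> bool"
  where "same_residue K E \<longleftrightarrow> (\<forall>x\<in>E \<inter> B 0. \<exists>y\<in>K. x \<ominus> y \<in> B 1)"

locale local_extension = local_base +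
  assumes w_surj: "\<exists>x\<in>N. x \<noteq> \<zero> \<and> w x = k"
    and fin_dim: "finite_dimension K N"
begin

lemma local_top: "local_subfield R N w"
  by (rule local_subfieldI[OF fin_dim w_surj])

text \<open>Any two normalised valuations that make a field local agree by
  \<open>local_unique\<close>, so the factor in the definite description is forced; a uniformiser of
  K reads it off.\<close>

lemma ramification_index_eq: "ramification_index K N = nat e"
  unfolding ramification_index_def
proof (rule the_equality)
  have "local_valuation (R\<lparr>carrier := K\<rparr>) v" "local_valuation (R\<lparr>carrier := N\<rparr>) w"
    using K.local_valuation_iff K.local_subfield_axioms local_valuation_iff local_top by auto
  then show "\<exists>v w. local_valuation (R\<lparr>carrier := K\<rparr>) v \<and> local_valuation (R\<lparr>carrier := N\<rparr>) w \<and>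
      (\<forall>x\<in>K - {\<zero>}. w x = int (nat e) * v x)"
    using w_base e_pos by (intro exI[of _ v] exI[of _ w]) auto
next
  fix n assume "\<exists>v w. local_valuation (R\<lparr>carrier := K\<rparr>) v \<and> local_valuation (R\<lparr>carrier := N\<rparr>) w \<and>
      (\<forall>x\<in>K - {\<zero>}. w x = int n * v x)"
  then obtain v' w' where v': "local_valuation (R\<lparr>carrier := K\<rparr>) v'" and w': "local_valuation (R\<lparr>carrier := N\<rparr>) w'"
    and n: "\<forall>x\<in>K - {\<zero>}. w' x = int n * v' x" by blast
  have V: "valued_subfield R K v'" 
    using discrete_valuation_valued[OF K.subfieldN] local_valuation.axioms(1)[OF v'] by blast
  have W: "valued_subfield R N w'"
    using discrete_valuation_valued[OF subfieldN] local_valuation.axioms(1)[OF w'] by blast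
  have V': "local_subfield R K v'" using valued_subfield.local_valuation_iff[OF V] v' by simp
  have W': "local_subfield R N w'" using valued_subfield.local_valuation_iff[OF W] w' by simp
  obtain x where x: "x \<in> K" "x \<noteq> \<zero>" "v x = 1" using K.w_surj by blast
  have "w' x = w x" using local_subfield.local_unique[OF local_top W'] x KN by auto
  moreover have "v' x = v x" using K.local_unique[OF V'] x by simp
  ultimately have "e = int n" using n x w_base[OF x(1,2)] by auto
  then show "n = nat e" by simp
qed

definition \<pi> :: 'a where "\<pi> = (SOME x. x \<in> N \<and> x \<noteq> \<zero> \<and> w x = 1)"

lemma \<pi>: "\<pi> \<in> N" "\<pi> \<noteq> \<zero>" "w \<pi> = 1" "\<pi> \<in> carrier R"
proof -
  have "\<exists>x. x \<in> N \<and> x \<noteq> \<zero> \<and> w x = 1" using w_surj by blast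
  then have "\<pi> \<in> N \<and> \<pi> \<noteq> \<zero> \<and> w \<pi> = 1" unfolding \<pi>_def by (rule someI_ex)
  then show "\<pi> \<in> N" "\<pi> \<noteq> \<zero>" "w \<pi> = 1" "\<pi> \<in> carrier R" using N_carrier by auto
qed

text \<open>The terms of \<open>\<Sum>\<^sub>i c\<^sub>i \<pi>\<^sup>i\<close> with \<open>i < e\<close> have pairwise distinct valuations modulo \<open>e\<close>.\<close>

lemma eval_valuation:
  assumes "set cs \<subseteq> K" "int (length cs) \<le> e" "\<exists>j. coeff cs j \<noteq> \<zero>"
  shows "eval cs \<pi> \<noteq> \<zero> \<and> (\<exists>i<length cs. coeff cs i \<noteq> \<zero> \<and> w (eval cs \<pi>) = e * v (coeff cs i) + int i) \<and>
    (\<forall>j. coeff cs j \<noteq> \<zero> \<longrightarrow> w (eval cs \<pi>) \<le> e * v (coeff cs j) + int j)"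
  using assms
proof (induction cs)
  case Nil
  then show ?case by simp
next
  case (Cons c cs)
  define n where "n = length cs"
  define E where "E = eval cs \<pi>"
  have cK: "c \<in> K" and cN: "c \<in> N" using Cons KN by auto
  have csN: "set cs \<subseteq> N" using Cons KN by auto
  have EN: "E \<in> N"
  proof -
    have "set ds \<subseteq> N \<Longrightarrow> eval ds \<pi> \<in> N" for ds using \<pi>(1) by (induction ds) auto
    then show ?thesis using csN by (simp add: E_def)
  qed
  have ev: "eval (c # cs) \<pi> = c \<otimes> \<pi> [^] n \<oplus> E" by (simp add: n_def E_def)
  have cf: "coeff (c # cs) = (\<lambda>i. if i = n then c else coeff cs i)" by (simp add: n_def fun_eq_iff)
  have cfz: "coeff cs n = \<zero>" using coeff_length[of cs n] by (simp add: n_def)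
  have lead: "c \<otimes> \<pi> [^] n \<in> N" "c \<noteq> \<zero> \<Longrightarrow> c \<otimes> \<pi> [^] n \<noteq> \<zero>" "c \<noteq> \<zero> \<Longrightarrow> w (c \<otimes> \<pi> [^] n) = e * v c + int n"
    using cN \<pi> N_mult_nz[OF cN _ N_pow[OF \<pi>(1)] N_pow_nz[OF \<pi>(1,2)]]
      w_mult[OF cN _ N_pow[OF \<pi>(1)] N_pow_nz[OF \<pi>(1,2)]] w_pow[OF \<pi>(1,2)] w_base[OF cK] by auto
  show ?case
  proof (cases "\<exists>j. coeff cs j \<noteq> \<zero>")
    case False
    have "\<zero> = x" if "x \<in> set cs" for x
      using False that coeff_img(3)[of cs] by (metis UnI1 imageE)
    then have "E = \<zero>" unfolding E_def using \<pi> by (induction cs) force+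
    then have E: "eval (c # cs) \<pi> = c \<otimes> \<pi> [^] n" using ev lead N_carrier by simp
    have c0: "c \<noteq> \<zero>" using Cons.prems(3) False unfolding cf by (auto split: if_splits)
    show ?thesis unfolding E cf using lead c0 False by (auto simp: n_def)
  next
    case True
    then have IH: "E \<noteq> \<zero>" "\<exists>i<n. coeff cs i \<noteq> \<zero> \<and> w E = e * v (coeff cs i) + int i"
      "\<And>j. coeff cs j \<noteq> \<zero> \<Longrightarrow> w E \<le> e * v (coeff cs j) + int j"
      using Cons unfolding E_def n_def by auto
    show ?thesis
    proof (cases "c = \<zero>")
      case True
      then have E: "eval (c # cs) \<pi> = E" using ev EN N_carrier \<pi> by simp
      have cf': "coeff (c # cs) = coeff cs" unfolding cf using True cfz by auto
      have "\<exists>i<length (c # cs). coeff cs i \<noteq> \<zero> \<and> w E = e * v (coeff cs i) + int i"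
        using IH(2) unfolding n_def by (metis length_Cons less_SucI)
      then show ?thesis unfolding E cf' using IH(1,3) by blast
    next
      case False
      note lead = lead(1) lead(2,3)[OF False]
      obtain i where i: "i < n" "coeff cs i \<noteq> \<zero>" "w E = e * v (coeff cs i) + int i" using IH(2) by blast
      have ne: "w E \<noteq> w (c \<otimes> \<pi> [^] n)"
      proof
        assume "w E = w (c \<otimes> \<pi> [^] n)"
        then have eq: "e * v (coeff cs i) + int i = e * v c + int n" using i(3) lead(3) by simp
        have "int n < e" using Cons.prems(2) by (simp add: n_def)
        then have m: "int i mod e = int i" "int n mod e = int n" using i(1) by auto
        have "(e * v (coeff cs i) + int i) mod e = (e * v c + int n) mod e" using eq by simp
        then show False using m i(1) by simp
      qed
      show ?thesis
      proof (cases "w (c \<otimes> \<pi> [^] n) < w E")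
        case True
        note s = w_add_eq[OF lead(1,2) EN IH(1) True]
        have "w (eval (c # cs) \<pi>) = e * v c + int n" using s lead ev by simp
        moreover have "e * v c + int n \<le> e * v (coeff cs j) + int j" if "coeff cs j \<noteq> \<zero>" for j
          using IH(3)[OF that] True lead(3) by simp
        ultimately show ?thesis unfolding cf using s ev False by (auto simp: n_def)
      next
        case False
        then have lt: "w E < w (c \<otimes> \<pi> [^] n)" using ne by simp
        note s = w_add_eq[OF EN IH(1) lead(1,2) lt]
        have c: "E \<oplus> c \<otimes> \<pi> [^] n = eval (c # cs) \<pi>" unfolding ev using EN lead(1) N_carrier by (simp add: a_comm)
        have w: "w (eval (c # cs) \<pi>) = w E" "eval (c # cs) \<pi> \<noteq> \<zero>" using s unfolding c by auto
        have "\<exists>i<length (c # cs). coeff (c # cs) i \<noteq> \<zero> \<and> w (eval (c # cs) \<pi>) = e * v (coeff (c # cs) i) + int i"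
          using i w(1) unfolding cf by (intro exI[of _ i]) (auto simp: n_def)
        moreover have "w (eval (c # cs) \<pi>) \<le> e * v (coeff (c # cs) j) + int j" if "coeff (c # cs) j \<noteq> \<zero>" for j
          using that IH(3)[of j] lt lead(3) unfolding w(1) cf by (auto split: if_splits)
        ultimately show ?thesis using w(2) by blast
      qed
    qed
  qed
qed

lemma powers_independent: "independent K (exp_base \<pi> (nat e))"
proof (rule ccontr)
  assume dep: "dependent K (exp_base \<pi> (nat e))"
  have len: "length (exp_base \<pi> (nat e)) = nat e" by (simp add: exp_base_def)
  obtain Ks where Ks: "length Ks = nat e" "combine Ks (exp_base \<pi> (nat e)) = \<zero>" "set Ks \<subseteq> K" "set Ks \<noteq> {\<zero>}"
    using dependent_imp_non_trivial_combine[OF K.subfieldN exp_base_closed[OF \<pi>(4)] dep] unfolding len by blast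
  have "Ks \<noteq> []" using Ks(1) e_pos by auto
  then obtain c where "c \<in> set Ks" "c \<noteq> \<zero>" using Ks(4) by (metis insertI1 set_empty subsetI subset_singleton_iff)
  then have "\<exists>j. coeff Ks j \<noteq> \<zero>" using coeff_img(3)[of Ks] by (metis UnI1 imageE)
  then have "eval Ks \<pi> \<noteq> \<zero>" using eval_valuation[OF Ks(3)] Ks(1) e_pos by auto
  then show False using combine_eq_eval[of Ks \<pi>] Ks by simp
qed

lemma powers_N: "set (exp_base \<pi> n) \<subseteq> N"
  using \<pi>(1) by (auto simp: exp_base_def)

text \<open>The powers of \<pi> with exponent below e are e independent elements, so the dimension
  equals e exactly when they span.\<close>

lemma totally_ramified_iff_Span: "totally_ramified K N \<longleftrightarrow> Span K (exp_base \<pi> (nat e)) = N"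
proof -
  obtain n where n: "dimension n K N" using fin_dim by (auto simp: finite_dimension_def)
  have d: "(dim over K) N = n" by (rule dimI[OF K.subfieldN n])
  have len: "length (exp_base \<pi> (nat e)) = nat e" by (simp add: exp_base_def)
  show ?thesis
    using independent_length_eq_dimension[OF K.subfieldN n powers_independent powers_N] fin_dim
    unfolding totally_ramified_def ramification_index_eq d len by simp
qed

text \<open>The terms of the expansion in powers of \<pi> cannot cancel, so each term of an integral
  x is integral, and x is congruent to its constant coefficient, which lies in K.\<close>

lemma same_residue_if_Span:
  assumes S: "Span K (exp_base \<pi> (nat e)) = N"
  shows "same_residue K N"
  unfolding same_residue_def
proof
  fix x assume "x \<in> N \<inter> B 0"
  then have x: "x \<in> N" "x \<in> B 0" by auto
  have len: "length (exp_base \<pi> (nat e)) = nat e" by (simp add: exp_base_def)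
  obtain Ks where Ks: "set Ks \<subseteq> K" "length Ks = nat e" "x = combine Ks (exp_base \<pi> (nat e))"
    using x(1) Span_mem_iff_length_version[OF K.subfieldN exp_base_closed[OF \<pi>(4)], of x "nat e"] S len by auto
  have xe: "x = eval Ks \<pi>" using Ks combine_eq_eval[of Ks \<pi>] by simp
  have "Ks \<noteq> []" using Ks(2) e_pos by auto
  then obtain Cs c where cs: "Ks = Cs @ [c]" by (metis rev_exhaust)
  have c: "c \<in> K" "set Cs \<subseteq> K" using cs Ks by auto
  have Csc: "set Cs \<subseteq> carrier R" "c \<in> carrier R" using c KN N_carrier by auto
  have xs: "x = eval Cs \<pi> \<otimes> \<pi> \<oplus> c" unfolding xe cs by (rule eval_append_aux[OF Csc \<pi>(4)])
  have Ec: "eval Cs \<pi> \<in> carrier R" by (rule eval_in_carrier[OF Csc(1) \<pi>(4)])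
  have xc: "x \<ominus> c = eval Cs \<pi> \<otimes> \<pi>" unfolding xs a_minus_def using Ec Csc \<pi>(4) by algebra
  have "eval Cs \<pi> \<in> B 0"
  proof (cases "\<exists>j. coeff Cs j \<noteq> \<zero>")
    case False
    have "\<zero> = y" if "y \<in> set Cs" for y
      using False that coeff_img(3)[of Cs] by (metis UnI1 imageE)
    then have "eval Cs \<pi> = \<zero>" using \<pi> by (induction Cs) force+
    then show ?thesis by simp
  next
    case True
    have "int (length Cs) \<le> e" using Ks(2) cs e_pos by auto
    from eval_valuation[OF c(2) this True] obtain i where
      i: "i < length Cs" "coeff Cs i \<noteq> \<zero>" "w (eval Cs \<pi>) = e * v (coeff Cs i) + int i" by blast
    have ci: "coeff Ks (Suc i) = coeff Cs i" unfolding cs append_coeff by simp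
    have "\<exists>j. coeff Ks j \<noteq> \<zero>" using i(2) ci by metis
    from eval_valuation[OF Ks(1) _ this] have "x \<noteq> \<zero>" "w x \<le> e * v (coeff Cs i) + int (Suc i)"
      unfolding xe using i(2) ci Ks(2) e_pos by (auto dest: spec[of _ "Suc i"])
    then have "0 \<le> e * v (coeff Cs i) + int (Suc i)" using x(2) by (simp add: B_def)
    \<comment> \<open>An exponent below e leaves no room for a negative v of the coefficient: e v +
      (i + 1) would be negative for v \<le> -1.\<close>
    moreover have "int (Suc i) < e" using i(1) Ks(2) cs e_pos by auto
    ultimately have "e * (-1) < e * v (coeff Cs i)" by linarith
    then have "-1 < v (coeff Cs i)" using e_pos mult_less_cancel_left_pos by blast
    then have "0 \<le> w (eval Cs \<pi>)" unfolding i(3) using e_pos by auto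
    moreover have "eval Cs \<pi> \<in> N"
    proof -
      have "set ds \<subseteq> N \<Longrightarrow> eval ds \<pi> \<in> N" for ds using \<pi>(1) by (induction ds) auto
      then show ?thesis using c KN by blast
    qed
    ultimately show ?thesis by (simp add: B_def)
  qed
  moreover have "\<pi> \<in> B 1" using \<pi> by (simp add: B_def)
  ultimately have "x \<ominus> c \<in> B (0 + 1)" unfolding xc by (rule B_mult)
  then show "\<exists>y\<in>K. x \<ominus> y \<in> B 1" using c by auto
qed

text \<open>Successive approximation. Some y = c \<pi>^i in S has any prescribed value k, with i = k
  mod e and v c = k div e. The residue of x / y is represented in K, which improves the
  approximation of x from S by one level. Since S is complete, it contains x.\<close>

lemma Span_if_same_residue:
  assumes f: "same_residue K N"
  shows "Span K (exp_base \<pi> (nat e)) = N"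
proof -
  define S where "S = Span K (exp_base \<pi> (nat e))"
  have SN: "S \<subseteq> N" unfolding S_def by (rule Span_sub[OF powers_N])
  have car: "set (exp_base \<pi> (nat e)) \<subseteq> carrier R" by (rule exp_base_closed[OF \<pi>(4)])
  note sp = Span_subgroup_props[OF K.subfieldN car, folded S_def] Span_smult_closed[OF K.subfieldN car, folded S_def]
  have base: "\<pi> [^] (i::nat) \<in> S" if "int i < e" for i
    using Span_base_incl[OF K.subfieldN car] that unfolding S_def by (auto simp: exp_base_def subset_iff)
  have step: "\<exists>s\<in>S. x \<ominus> s \<in> B (k + 1)" if x: "x \<in> B k" for x k
  proof -
    define i where "i = nat (k mod e)"
    have i: "int i = k mod e" "int i < e" using e_pos by (auto simp: i_def)
    obtain c where c: "c \<in> K" "c \<noteq> \<zero>" "v c = k div e" using K.w_surj by blast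
    have cN: "c \<in> N" using c KN by auto
    define y where "y = c \<otimes> \<pi> [^] i"
    have y: "y \<in> N" "y \<noteq> \<zero>" "w y = k"
      using cN c \<pi> N_mult_nz[OF cN c(2) N_pow[OF \<pi>(1)] N_pow_nz[OF \<pi>(1,2)]]
        w_mult[OF cN c(2) N_pow[OF \<pi>(1)] N_pow_nz[OF \<pi>(1,2)]] w_pow[OF \<pi>(1,2)] w_base[OF c(1,2)] i(1)
      by (auto simp: y_def)
    note iy = N_inv[OF y(1,2)]
    have "inv y \<in> B (- k)" using iy w_inv[OF y(1,2)] y(3) by (simp add: B_def)
    from B_mult[OF x this] have "x \<otimes> inv y \<in> N \<inter> B 0" using B_N by auto
    then obtain z where z: "z \<in> K" "x \<otimes> inv y \<ominus> z \<in> B 1" using f unfolding same_residue_def by blast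
    have cc: "x \<in> carrier R" "y \<in> carrier R" "inv y \<in> carrier R" "z \<in> carrier R" "c \<in> carrier R"
      using x y iy z cN KN B_carrier N_carrier by auto
    have "y \<in> B k" using y by (simp add: B_def)
    from B_mult[OF z(2) this] have "(x \<otimes> inv y \<ominus> z) \<otimes> y \<in> B (k + 1)" by (simp add: add.commute)
    moreover have "(x \<otimes> inv y \<ominus> z) \<otimes> y = x \<otimes> (inv y \<otimes> y) \<ominus> z \<otimes> y"
      unfolding a_minus_def using cc by algebra
    ultimately have "x \<ominus> z \<otimes> y \<in> B (k + 1)" using iy cc by simp
    moreover have "z \<otimes> y \<in> S"
    proof -
      have "z \<otimes> y = (z \<otimes> c) \<otimes> \<pi> [^] i" unfolding y_def using cc \<pi>(4) by (simp add: m_assoc)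
      then show ?thesis using sp(5)[OF _ base[OF i(2)], of "z \<otimes> c"] z c by auto
    qed
    ultimately show ?thesis by blast
  qed
  have "N \<subseteq> S"
  proof
    fix x assume x: "x \<in> N"
    obtain k0 where k0: "x \<in> B k0" using exists_level x by blast
    have xc: "x \<in> carrier R" using x N_carrier by simp
    have approx: "\<exists>s\<in>S. x \<ominus> s \<in> B (k0 + int n)" for n
    proof (induction n)
      case 0
      have "x \<ominus> \<zero> \<in> B (k0 + int 0)" using k0 xc by (simp add: a_minus_def)
      then show ?case using sp(2) by blast
    next
      case (Suc n)
      then obtain s where s: "s \<in> S" "x \<ominus> s \<in> B (k0 + int n)" by blast
      obtain t where t: "t \<in> S" "(x \<ominus> s) \<ominus> t \<in> B (k0 + int n + 1)" using step[OF s(2)] by blast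
      have cc: "s \<in> carrier R" "t \<in> carrier R" using s t sp(1) by auto
      have "(x \<ominus> s) \<ominus> t = x \<ominus> (s \<oplus> t)" unfolding a_minus_def using xc cc by algebra
      then show ?case using t sp(3)[OF s(1) t(1)] by (intro bexI[of _ "s \<oplus> t"]) (auto simp: add_ac)
    qed
    show "x \<in> S"
    proof (rule ccontr)
      assume "x \<notin> S"
      have "complete_set S" unfolding S_def using Span_complete_bounded[OF powers_N] by simp
      from complete_set_gap[OF this SN x \<open>x \<notin> S\<close>] obtain C where C: "\<forall>u\<in>S. x \<ominus> u \<notin> B C" by blast
      obtain s where "s \<in> S" "x \<ominus> s \<in> B (k0 + int (nat (C - k0)))" using approx by blast
      moreover have "C \<le> k0 + int (nat (C - k0))" by simp
      ultimately show False using C B_mono by blast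
    qed
  qed
  then show ?thesis using SN by (simp add: S_def)
qed

theorem totally_ramified_iff_same_residue: "totally_ramified K N \<longleftrightarrow> same_residue K N"
  using totally_ramified_iff_Span same_residue_if_Span Span_if_same_residue by blast

end

text \<open>The ramification index of E refers to the normalised valuation r of E, while
  \<open>same_residue\<close> uses that of L. On E the latter is a positive multiple of r, so the
  valuation ring and its maximal ideal are the same for both.\<close>

theorem (in local_subfield) totally_ramified_iff:
  assumes top: "local_subfield R L u" "N \<subseteq> L" "finite_dimension N L"
    and E: "subfield E R" "N \<subseteq> E" "E \<subseteq> L"
  shows "totally_ramified N E \<longleftrightarrow> valued_subfield.same_residue R L u N E"
proof -
  interpret U: local_subfield R L u by fact
  note fin = finite_dimension_intermediate[OF subfieldN E(1) U.subringN E(2,3) top(3)]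
  obtain r where r: "local_subfield R E r" using finite_extension_local[OF E(1,2) fin(1)] by blast
  interpret E: local_subfield R E r by fact
  obtain d where d: "local_base R E r N w d"
    using local_baseI[OF E.valued_subfield_axioms E(2) fin(1)] E.w_surj[of 1] by force
  interpret X: local_extension R E r N w d
    using d E.w_surj fin(1) by (intro local_extension.intro local_extension_axioms.intro) auto
  obtain c where c: "local_base R L u E r c"
    using E.local_baseI[OF U.valued_subfield_axioms E(3) fin(2)] U.w_surj[of 1] by force
  interpret C: local_base R L u E r c by (rule c)
  have B: "x \<in> E.B k \<longleftrightarrow> x \<in> U.B k" if "x \<in> E" "k = 0 \<or> k = 1" for x k
  proof (cases "x = \<zero>")
    case False
    have "k \<le> r x \<longleftrightarrow> k \<le> c * r x"
      using that(2) C.e_pos by (auto simp: zero_le_mult_iff) (smt (verit) mult_pos_pos mult_nonneg_nonpos mult_le_cancel_left1)+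
    then show ?thesis using that False E(3) C.w_base by (auto simp: E.B_def U.B_def)
  qed simp
  have "E.same_residue N E \<longleftrightarrow> U.same_residue N E"
    unfolding E.same_residue_def U.same_residue_def
  proof (intro iffI ballI)
    fix x assume h: "\<forall>x\<in>E \<inter> E.B 0. \<exists>y\<in>N. x \<ominus> y \<in> E.B 1" and x: "x \<in> E \<inter> U.B 0"
    then obtain y where y: "y \<in> N" "x \<ominus> y \<in> E.B 1" using B[of x 0] by blast
    then show "\<exists>y\<in>N. x \<ominus> y \<in> U.B 1" using B[of "x \<ominus> y" 1] E.B_N by blast
  next
    fix x assume h: "\<forall>x\<in>E \<inter> U.B 0. \<exists>y\<in>N. x \<ominus> y \<in> U.B 1" and x: "x \<in> E \<inter> E.B 0"
    then obtain y where y: "y \<in> N" "x \<ominus> y \<in> U.B 1" using B[of x 0] by blast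
    have "x \<ominus> y \<in> E" using x y E(2) by auto
    then show "\<exists>y\<in>N. x \<ominus> y \<in> E.B 1" using B[of "x \<ominus> y" 1] y by blast
  qed
  then show ?thesis using X.totally_ramified_iff_same_residue by simp
qed

section \<open>Extension of embeddings\<close>

context field begin

lemma hom_ring:
  assumes "subfield E R" "s \<in> ring_hom (R\<lparr>carrier := E\<rparr>) R"
  shows "ring_hom_ring (R\<lparr>carrier := E\<rparr>) R s"
  using subring_is_ring[OF subfieldE(1)[OF assms(1)]] assms(2) ring_axioms
  by (intro ring_hom_ringI2) auto

lemma hom_facts:
  assumes "subfield E R" "s \<in> ring_hom (R\<lparr>carrier := E\<rparr>) R"
  shows "x \<in> E \<Longrightarrow> s x \<in> carrier R" "s \<one> = \<one>" "s \<zero> = \<zero>"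
    "x \<in> E \<Longrightarrow> y \<in> E \<Longrightarrow> s (x \<otimes> y) = s x \<otimes> s y"
    "x \<in> E \<Longrightarrow> y \<in> E \<Longrightarrow> s (x \<oplus> y) = s x \<oplus> s y"
    "x \<in> E \<Longrightarrow> s (\<ominus> x) = \<ominus> s x"
    "inj_on s E"
proof -
  interpret H: ring_hom_ring "R\<lparr>carrier := E\<rparr>" R s by (rule hom_ring[OF assms])
  show "x \<in> E \<Longrightarrow> s x \<in> carrier R" using H.hom_closed by simp
  show "s \<one> = \<one>" using H.hom_one by simp
  show "s \<zero> = \<zero>" using H.hom_zero by simp
  show "x \<in> E \<Longrightarrow> y \<in> E \<Longrightarrow> s (x \<otimes> y) = s x \<otimes> s y" using H.hom_mult by simp
  show "x \<in> E \<Longrightarrow> y \<in> E \<Longrightarrow> s (x \<oplus> y) = s x \<oplus> s y" using H.hom_add by simp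
  show "x \<in> E \<Longrightarrow> s (\<ominus> x) = \<ominus> s x"
    using H.hom_a_inv[of x] a_inv_subring[OF subfieldE(1)[OF assms(1)], of x] by simp
  interpret F: field "R\<lparr>carrier := E\<rparr>" by (rule subfield_iff(2)[OF assms(1)])
  show "inj_on s E"
    using ring_hom_ring.img_is_subfield(1)[OF hom_ring[OF assms] F.carrier_is_subfield] by simp
qed

lemma hom_nz: assumes "subfield E R" "s \<in> ring_hom (R\<lparr>carrier := E\<rparr>) R" "x \<in> E" "x \<noteq> \<zero>" shows "s x \<noteq> \<zero>"
  using hom_facts(3,7)[OF assms(1,2)] assms(3,4) subringE(2)[OF subfieldE(1)[OF assms(1)]]
  by (metis inj_on_contraD)

lemma hom_eval:
  assumes "subfield E R" "s \<in> ring_hom (R\<lparr>carrier := E\<rparr>) R" "set p \<subseteq> E" "x \<in> E"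
  shows "s (eval p x) = eval (map s p) (s x)"
  using ring_hom_ring.eval_hom'[OF hom_ring[OF assms(1,2)], of x p] assms(3,4)
    eval_consistent[OF subfieldE(1)[OF assms(1)]] by simp

lemma hom_map_carrier:
  assumes "subfield E R" "s \<in> ring_hom (R\<lparr>carrier := E\<rparr>) R" "set p \<subseteq> E"
  shows "set (map s p) \<subseteq> carrier R"
  using hom_facts(1)[OF assms(1,2)] assms(3) by auto

lemma hom_eval_add:
  assumes "subfield E R" "s \<in> ring_hom (R\<lparr>carrier := E\<rparr>) R" "set p \<subseteq> E" "set q \<subseteq> E" "y \<in> carrier R"
  shows "eval (map s (poly_add p q)) y = eval (map s p) y \<oplus> eval (map s q) y"
proof -
  have n: "normalize (map s (poly_add p q)) = poly_add (map s p) (map s q)"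
    using ring_hom_ring.poly_add_hom'[OF hom_ring[OF assms(1,2)], of p q] assms(3,4)
      poly_add_consistent[OF subfieldE(1)[OF assms(1)]] by simp
  have "set (poly_add p q) \<subseteq> E"
    using poly_add_is_polynomial[OF subfieldE(1)[OF assms(1)] assms(3,4)] polynomial_incl by blast
  then have "eval (map s (poly_add p q)) y = eval (normalize (map s (poly_add p q))) y"
    using eval_normalize[OF hom_map_carrier[OF assms(1,2)] assms(5)] by simp
  then show ?thesis
    unfolding n eval_poly_add[OF hom_map_carrier[OF assms(1-3)] hom_map_carrier[OF assms(1,2,4)] assms(5)] .
qed

lemma hom_eval_mult:
  assumes "subfield E R" "s \<in> ring_hom (R\<lparr>carrier := E\<rparr>) R" "set p \<subseteq> E" "set q \<subseteq> E" "y \<in> carrier R"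
  shows "eval (map s (poly_mult p q)) y = eval (map s p) y \<otimes> eval (map s q) y"
proof -
  have n: "normalize (map s (poly_mult p q)) = poly_mult (map s p) (map s q)"
    using ring_hom_ring.poly_mult_hom'[OF hom_ring[OF assms(1,2)], of p q] assms(3,4)
      poly_mult_consistent[OF subfieldE(1)[OF assms(1)]] by simp
  have "set (poly_mult p q) \<subseteq> E"
    using poly_mult_is_polynomial[OF subfieldE(1)[OF assms(1)] assms(3,4)] polynomial_incl by blast
  then have "eval (map s (poly_mult p q)) y = eval (normalize (map s (poly_mult p q))) y"
    using eval_normalize[OF hom_map_carrier[OF assms(1,2)] assms(5)] by simp
  then show ?thesis
    unfolding n eval_poly_mult[OF hom_map_carrier[OF assms(1-3)] hom_map_carrier[OF assms(1,2,4)] assms(5)] .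
qed

lemma eval_uminus:
  "set p \<subseteq> carrier R \<Longrightarrow> x \<in> carrier R \<Longrightarrow> eval (map (\<lambda>a. \<ominus> a) p) x = \<ominus> eval p x"
proof (induction p)
  case (Cons a p)
  then show ?case using eval_in_carrier[of p x] by (simp add: minus_add l_minus)
qed simp

lemma poly_mem_set: "p \<in> carrier (E[X]) \<Longrightarrow> set p \<subseteq> E"
  using polynomial_incl univ_poly_carrier by blast

lemma Irr_dividesE:
  assumes "subfield F R" "b \<in> carrier R" "(algebraic over F) b" "r \<in> carrier (F[X])" "eval r b = \<zero>"
  obtains t where "t \<in> carrier (F[X])" "r = poly_mult (Irr F b) t"
proof -
  have "Irr F b pdivides r" by (rule Irr_minimal[OF assms])
  then have "Irr F b divides\<^bsub>F[X]\<^esub> r"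
    using pdivides_iff_shell[OF assms(1) IrrE(1)[OF assms(1-3)] assms(4)] by simp
  then show ?thesis using that unfolding factor_def univ_poly_mult by blast
qed

text \<open>The image of p(b) is the value at y of p with s applied to its coefficients. This
  depends only on p(b), because the minimal polynomial of b divides the difference of two
  representations.\<close>

lemma simple_extension_hom:
  assumes F: "subfield F R" and s: "s \<in> ring_hom (R\<lparr>carrier := F\<rparr>) R"
    and b: "b \<in> carrier R" "(algebraic over F) b"
    and y: "y \<in> carrier R" "eval (map s (Irr F b)) y = \<zero>"
  shows "\<exists>s'. s' \<in> ring_hom (R\<lparr>carrier := simple_extension F b\<rparr>) R \<and> s' b = y \<and> (\<forall>x\<in>F. s' x = s x)"
proof -
  have Fc: "F \<subseteq> carrier R" and sr: "subring F R" using subfieldE[OF F] by auto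
  define E where "E = simple_extension F b"
  have im: "E = (\<lambda>p. eval p b) ` carrier (F[X])"
    unfolding E_def by (rule simple_extension_as_eval_img[OF Fc b(1)])
  have wd: "eval (map s p) y = eval (map s q) y"
    if "p \<in> carrier (F[X])" "q \<in> carrier (F[X])" "eval p b = eval q b" for p q
  proof -
    define q' where "q' = map (\<lambda>a. \<ominus> a) q"
    define r where "r = poly_add p q'"
    have ps: "set p \<subseteq> F" "set q \<subseteq> F" using that poly_mem_set by auto
    have q's: "set q' \<subseteq> F" using ps(2) subringE(5)[OF sr] by (auto simp: q'_def)
    have rF: "r \<in> carrier (F[X])"
      unfolding r_def univ_poly_carrier[symmetric] by (rule poly_add_is_polynomial[OF sr ps(1) q's])
    have pc: "set p \<subseteq> carrier R" "set q \<subseteq> carrier R" "set q' \<subseteq> carrier R" using ps q's Fc by auto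
    have "eval r b = eval p b \<oplus> \<ominus> eval q b"
      unfolding r_def using eval_poly_add[OF pc(1,3) b(1)] eval_uminus[OF pc(2) b(1)] by (simp add: q'_def)
    then have "eval r b = \<zero>" using that(3) eval_in_carrier[OF pc(2) b(1)] by (simp add: r_neg)
    then obtain t where t: "t \<in> carrier (F[X])" "r = poly_mult (Irr F b) t"
      by (rule Irr_dividesE[OF F b rF])
    have "eval (map s r) y = eval (map s (Irr F b)) y \<otimes> eval (map s t) y"
      unfolding t(2) by (rule hom_eval_mult[OF F s poly_mem_set[OF IrrE(1)[OF F b]] poly_mem_set[OF t(1)] y(1)])
    also have "\<dots> = \<zero>"
      using y(2) eval_in_carrier[OF hom_map_carrier[OF F s poly_mem_set[OF t(1)]] y(1)] by simp
    finally have "eval (map s r) y = \<zero>" .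
    moreover have "eval (map s r) y = eval (map s p) y \<oplus> eval (map s q') y"
      unfolding r_def by (rule hom_eval_add[OF F s ps(1) q's y(1)])
    moreover have "map s q' = map (\<lambda>a. \<ominus> a) (map s q)"
      using hom_facts(6)[OF F s] ps(2) by (auto simp: q'_def)
    moreover have "eval (map (\<lambda>a. \<ominus> a) (map s q)) y = \<ominus> eval (map s q) y"
      by (rule eval_uminus[OF hom_map_carrier[OF F s ps(2)] y(1)])
    moreover have "eval (map s p) y \<in> carrier R" "eval (map s q) y \<in> carrier R"
      using eval_in_carrier[OF hom_map_carrier[OF F s] y(1)] ps by auto
    ultimately show ?thesis using minus_equality by (metis minus_minus a_inv_closed)
  qed
  define P where "P z = (SOME p. p \<in> carrier (F[X]) \<and> eval p b = z)" for z
  have P: "P z \<in> carrier (F[X])" "eval (P z) b = z" if "z \<in> E" for z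
  proof -
    have "\<exists>p. p \<in> carrier (F[X]) \<and> eval p b = z" using that im by blast
    then have "P z \<in> carrier (F[X]) \<and> eval (P z) b = z" unfolding P_def by (rule someI_ex)
    then show "P z \<in> carrier (F[X])" "eval (P z) b = z" by auto
  qed
  define s' where "s' z = eval (map s (P z)) y" for z
  have s'_eval: "s' (eval p b) = eval (map s p) y" if "p \<in> carrier (F[X])" for p
  proof -
    have "eval p b \<in> E" using that im by blast
    then show ?thesis unfolding s'_def using wd[OF P(1) that] P(2) by blast
  qed
  have const: "[k] \<in> carrier (F[X])" if "k \<in> F" "k \<noteq> \<zero>" for k
    using that by (simp add: univ_poly_carrier[symmetric] polynomial_def)
  have sF: "s' x = s x" if x: "x \<in> F" for x
  proof (cases "x = \<zero>")
    case True
    have "[] \<in> carrier (F[X])" by (simp add: univ_poly_carrier[symmetric] polynomial_def)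
    from s'_eval[OF this] show ?thesis using True hom_facts(3)[OF F s] by simp
  next
    case False
    have "s x \<in> carrier R" "x \<in> carrier R" using hom_facts(1)[OF F s] x Fc by auto
    then show ?thesis using s'_eval[OF const[OF x False]] by simp
  qed
  have Xp: "[\<one>, \<zero>] \<in> carrier (F[X])"
    using subringE(2,3)[OF sr] by (simp add: univ_poly_carrier[symmetric] polynomial_def)
  have sb: "s' b = y"
    using s'_eval[OF Xp] b(1) y(1) hom_facts(2,3)[OF F s] by simp
  have "s' \<in> ring_hom (R\<lparr>carrier := E\<rparr>) R"
  proof (rule ring_hom_memI)
    show "s' x \<in> carrier R" if "x \<in> carrier (R\<lparr>carrier := E\<rparr>)" for x
      using that P(1)[of x] eval_in_carrier[OF hom_map_carrier[OF F s poly_mem_set] y(1)] by (simp add: s'_def)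
    show "s' \<one>\<^bsub>R\<lparr>carrier := E\<rparr>\<^esub> = \<one>" using sF subringE(3)[OF sr] hom_facts(2)[OF F s] by simp
    fix u v assume "u \<in> carrier (R\<lparr>carrier := E\<rparr>)" "v \<in> carrier (R\<lparr>carrier := E\<rparr>)"
    then have uv: "u \<in> E" "v \<in> E" by auto
    note Pu = P[OF uv(1)] and Pv = P[OF uv(2)]
    note su = poly_mem_set[OF Pu(1)] and sv = poly_mem_set[OF Pv(1)]
    have c: "set (P u) \<subseteq> carrier R" "set (P v) \<subseteq> carrier R" using su sv Fc by auto
    have "poly_mult (P u) (P v) \<in> carrier (F[X])"
      unfolding univ_poly_carrier[symmetric] by (rule poly_mult_is_polynomial[OF sr su sv])
    from s'_eval[OF this] have "s' (u \<otimes> v) = eval (map s (P u)) y \<otimes> eval (map s (P v)) y"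
      using eval_poly_mult[OF c b(1)] Pu Pv hom_eval_mult[OF F s su sv y(1)] by simp
    then show "s' (u \<otimes>\<^bsub>R\<lparr>carrier := E\<rparr>\<^esub> v) = s' u \<otimes> s' v" by (simp add: s'_def)
    have "poly_add (P u) (P v) \<in> carrier (F[X])"
      unfolding univ_poly_carrier[symmetric] by (rule poly_add_is_polynomial[OF sr su sv])
    from s'_eval[OF this] have "s' (u \<oplus> v) = eval (map s (P u)) y \<oplus> eval (map s (P v)) y"
      using eval_poly_add[OF c b(1)] Pu Pv hom_eval_add[OF F s su sv y(1)] by simp
    then show "s' (u \<oplus>\<^bsub>R\<lparr>carrier := E\<rparr>\<^esub> v) = s' u \<oplus> s' v" by (simp add: s'_def)
  qed
  then show ?thesis using sb sF unfolding E_def by blast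
qed

end

context algebraically_closed begin

lemma exists_root:
  assumes "p \<in> carrier (poly_ring L)" "1 \<le> degree p"
  shows "\<exists>y\<in>carrier L. eval p y = \<zero>"
proof -
  have "size (roots p) = degree p" using roots_over_carrier[OF assms(1)] by (simp add: splitted_def)
  then have "roots p \<noteq> {#}" using assms(2) by auto
  then obtain a where "a \<in># roots p" by blast
  then show ?thesis using roots_mem_iff_is_root[OF assms(1)] by (auto simp: is_root_def)
qed

text \<open>Generators are adjoined one by one; the image of each minimal polynomial has a root in
  the algebraically closed field, which can serve as the image of the generator.\<close>

lemma hom_extends:
  assumes E: "subfield E L" and N: "subring N L" "E \<subseteq> N" "finite_dimension E N"
    and s: "s \<in> ring_hom (L\<lparr>carrier := E\<rparr>) L"
  shows "\<exists>t. t \<in> ring_hom (L\<lparr>carrier := N\<rparr>) L \<and> (\<forall>x\<in>E. t x = s x)"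
proof -
  obtain Us where Us: "set Us \<subseteq> N" "finite_extension E Us = N"
    by (rule finite_dimension_generators[OF E N])
  have alg: "(algebraic over E) x" if "x \<in> N" for x
    by (rule finite_dimension_imp_algebraic[OF E N(1,3) that])
  have Nc: "N \<subseteq> carrier L" using subringE(1)[OF N(1)] .
  have "\<exists>t. t \<in> ring_hom (L\<lparr>carrier := finite_extension E xs\<rparr>) L \<and> (\<forall>x\<in>E. t x = s x)"
    if "set xs \<subseteq> N" for xs
    using that
  proof (induction xs)
    case Nil
    then show ?case using s by auto
  next
    case (Cons b xs)
    define F where "F = finite_extension E xs"
    have xsc: "set xs \<subseteq> carrier L" and bc: "b \<in> carrier L" using Cons Nc by auto
    have F: "subfield F L" unfolding F_def
      by (rule finite_extension_is_subfield[OF E xsc]) (use Cons alg in auto)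
    have EF: "E \<subseteq> F" unfolding F_def by (rule finite_extension_incl[OF subfieldE(3)[OF E] xsc])
    have "set xs \<subseteq> N" using Cons.prems by simp
    from Cons.IH[OF this, folded F_def]
    obtain t where t: "t \<in> ring_hom (L\<lparr>carrier := F\<rparr>) L" "\<forall>x\<in>E. t x = s x" by blast
    have bF: "(algebraic over F) b" using algebraic_mono[OF EF alg] Cons by simp
    note I = IrrE[OF F bc bF]
    have Ine: "Irr F b \<noteq> []" using pirreducibleE(1)[OF subfieldE(1)[OF F] I(1,2)] .
    have mc: "map t (Irr F b) \<in> carrier (poly_ring L)"
      using hom_map_carrier[OF F t(1) poly_mem_set[OF I(1)]] Ine I(3) hom_facts(2)[OF F t(1)]
      by (auto simp: univ_poly_carrier[symmetric] polynomial_def hd_map)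
    have "1 \<le> degree (map t (Irr F b))" using pirreducible_degree[OF F I(1,2)] by simp
    then obtain y where y: "y \<in> carrier L" "eval (map t (Irr F b)) y = \<zero>" using exists_root[OF mc] by blast
    obtain s' where s': "s' \<in> ring_hom (L\<lparr>carrier := simple_extension F b\<rparr>) L" "\<forall>x\<in>F. s' x = t x"
      using simple_extension_hom[OF F t(1) bc bF y] by blast
    then have "\<forall>x\<in>E. s' x = s x" using t(2) EF by auto
    moreover have "finite_extension E (b # xs) = simple_extension F b" by (simp add: F_def)
    ultimately show ?case using s' by metis
  qed
  from this[OF Us(1)] show ?thesis unfolding Us(2) .
qed

end

section \<open>Normal extensions and their automorphisms\<close>

context field begin

text \<open>Normality expressed by roots in the ambient field instead of by splitting over N;
  \<open>normal_iff_root_closed\<close> connects the two.\<close>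

definition root_closed :: "'a set \<Rightarrow> 'a set \<Rightarrow> bool"
  where "root_closed K N \<longleftrightarrow>
    (\<forall>x\<in>N. (algebraic over K) x \<and> (\<forall>y\<in>carrier R. eval (Irr K x) y = \<zero> \<longrightarrow> y \<in> N))"

end

context algebraically_closed begin

text \<open>If p splits over N, the minimal polynomial over N of any root divides p and is therefore
  linear. Conversely, an irreducible factor of degree above 1 would have a root in the ambient
  field, hence in N, which irreducibility excludes.\<close>

lemma splitted_subfield_iff:
  assumes N: "subfield N L" and p: "p \<in> carrier (N[X])" "p \<noteq> []"
  shows "ring.splitted (L\<lparr>carrier := N\<rparr>) p \<longleftrightarrow> (\<forall>y\<in>carrier L. eval p y = \<zero> \<longrightarrow> y \<in> N)"
proof -
  let ?S = "L\<lparr>carrier := N\<rparr>"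
  interpret S: field ?S by (rule subfield_iff(2)[OF N])
  have sr: "subring N L" by (rule subfieldE(1)[OF N])
  have Nc: "N \<subseteq> carrier L" by (rule subfieldE(3)[OF N])
  have up: "univ_poly ?S = univ_poly L" by (rule univ_poly_consistent[OF sr])
  have ev: "S.eval = eval" by (rule eval_consistent[OF sr])
  have pS: "p \<in> carrier (poly_ring ?S)" using p(1) up by simp
  have fac: "eval p y = \<zero>" if "q \<in> carrier (poly_ring ?S)" "q pdivides\<^bsub>?S\<^esub> p" "y \<in> carrier L" "eval q y = \<zero>" for q y
  proof -
    have "q divides\<^bsub>N[X]\<^esub> p" using that(2) by (simp add: pdivides_def up)
    then obtain t where t: "t \<in> carrier (N[X])" "p = poly_mult q t" unfolding factor_def univ_poly_mult by blast
    have "set q \<subseteq> carrier L" "set t \<subseteq> carrier L" using that(1) t(1) up poly_mem_set Nc by auto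
    then show ?thesis using eval_poly_mult[of q t y] t(2) that(3,4) eval_in_carrier[of t y] by simp
  qed
  show ?thesis
  proof
    assume sp: "S.splitted p"
    show "\<forall>y\<in>carrier L. eval p y = \<zero> \<longrightarrow> y \<in> N"
    proof (intro ballI impI)
      fix y assume y: "y \<in> carrier L" "eval p y = \<zero>"
      have al: "(algebraic over N) y" by (rule algebraicI[of p]) (use p y in \<open>auto simp: over_def\<close>)
      note I = IrrE[OF N y(1) al]
      obtain t where t: "t \<in> carrier (N[X])" "p = poly_mult (Irr N y) t" using Irr_dividesE[OF N y(1) al p(1) y(2)] .
      have "Irr N y pdivides\<^bsub>?S\<^esub> p" unfolding pdivides_def using t by (auto simp: up factor_def univ_poly_mult)
      then have d1: "degree (Irr N y) = 1"
        using S.splitted_imp_trivial_factors[OF pS p(2) sp, of "Irr N y"] I(1,2) up by simp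
      obtain a b where ab: "a \<in> N" "b \<in> N" "a \<noteq> \<zero>" "Irr N y = [a, b]"
        using degree_oneE[OF I(1) d1] by blast
      then have "a = \<one>" using I(3) by simp
      moreover have "b \<in> carrier L" using ab(2) Nc by auto
      ultimately have "y \<oplus> b = \<zero>" using I(4) ab(4) y(1) by simp
      then have "y = \<ominus> b" using y(1) ab(2) Nc by (metis minus_equality subsetD)
      then show "y \<in> N" using ab(2) subringE(5)[OF sr] by simp
    qed
  next
    assume r: "\<forall>y\<in>carrier L. eval p y = \<zero> \<longrightarrow> y \<in> N"
    show "S.splitted p"
    proof (rule S.trivial_factors_imp_splitted[OF pS])
      fix q assume q: "q \<in> carrier (poly_ring ?S)" "ring_irreducible\<^bsub>univ_poly ?S (carrier ?S)\<^esub> q" "q pdivides\<^bsub>?S\<^esub> p"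
      show "degree q \<le> 1"
      proof (rule ccontr)
        assume d: "\<not> degree q \<le> 1"
        have qN: "q \<in> carrier (N[X])" using q(1) up by simp
        have qL: "q \<in> carrier (poly_ring L)" by (rule carrier_polynomial_shell[OF sr qN])
        obtain y where y: "y \<in> carrier L" "eval q y = \<zero>" using exists_root[OF qL] d by auto
        have "y \<in> N" using r y(1) fac[OF q(1,3) y] by simp
        then have "S.is_root q y" using y(2) d ev by (auto simp: S.is_root_def)
        then have "y \<in># S.roots q" using S.roots_mem_iff_is_root[OF q(1)] by simp
        moreover have "S.roots q = {#}" by (rule S.pirreducible_roots[OF q(1,2)]) (use d in simp)
        ultimately show False by simp
      qed
    qed
  qed
qed

lemma normal_iff_root_closed:
  assumes "subfield K L" "subfield N L" "K \<subseteq> N"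
  shows "normal_extension K N \<longleftrightarrow> root_closed K N"
proof -
  have "ring.splitted (L\<lparr>carrier := N\<rparr>) (Irr K x) \<longleftrightarrow> (\<forall>y\<in>carrier L. eval (Irr K x) y = \<zero> \<longrightarrow> y \<in> N)"
    if "x \<in> N" "(algebraic over K) x" for x
  proof -
    have xc: "x \<in> carrier L" using that(1) subfieldE(3)[OF assms(2)] by auto
    note I = IrrE[OF assms(1) xc that(2)]
    have "Irr K x \<in> carrier (N[X])"
      using I(1) assms(3) by (auto simp: univ_poly_carrier[symmetric] polynomial_def)
    then show ?thesis
      using splitted_subfield_iff[OF assms(2)] pirreducibleE(1)[OF subfieldE(1)[OF assms(1)] I(1,2)] by simp
  qed
  then show ?thesis unfolding normal_extension_def root_closed_def by blast
qed

lemma root_closed_intermediate: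
  assumes "root_closed K N" "subfield K L" "subfield F L" "subfield N L" "K \<subseteq> F" "F \<subseteq> N"
  shows "root_closed F N"
  unfolding root_closed_def
proof (intro ballI conjI impI)
  fix x assume x: "x \<in> N"
  have xc: "x \<in> carrier L" using x subfieldE(3)[OF assms(4)] by auto
  have aK: "(algebraic over K) x" using assms(1) x by (simp add: root_closed_def)
  show aF: "(algebraic over F) x" by (rule algebraic_mono[OF assms(5) aK])
  fix y assume y: "y \<in> carrier L" "eval (Irr F x) y = \<zero>"
  note I = IrrE[OF assms(2) xc aK]
  have "Irr K x \<in> carrier (F[X])" using I(1) assms(5) by (auto simp: univ_poly_carrier[symmetric] polynomial_def)
  then obtain t where t: "t \<in> carrier (F[X])" "Irr K x = poly_mult (Irr F x) t"
    by (rule Irr_dividesE[OF assms(3) xc aF _ I(4)])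
  have c: "set (Irr F x) \<subseteq> carrier L" "set t \<subseteq> carrier L"
    using poly_mem_set[OF IrrE(1)[OF assms(3) xc aF]] poly_mem_set[OF t(1)] subfieldE(3)[OF assms(3)] by auto
  have "eval (Irr K x) y = \<zero>" unfolding t(2) eval_poly_mult[OF c y(1)] y(2)
    using eval_in_carrier[OF c(2) y(1)] by simp
  then show "y \<in> N" using assms(1) x y(1) by (simp add: root_closed_def)
qed

lemma hom_root:
  assumes "subfield N L" "K \<subseteq> N" "subfield K L" "s \<in> ring_hom (L\<lparr>carrier := N\<rparr>) L" "\<forall>c\<in>K. s c = c"
    and "x \<in> N" "p \<in> carrier (K[X])" "eval p x = \<zero>"
  shows "eval p (s x) = \<zero>"
proof -
  have "set p \<subseteq> K" by (rule poly_mem_set[OF assms(7)])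
  then have "map s p = p" using assms(5) by (auto intro: map_idI)
  moreover have "s (eval p x) = eval (map s p) (s x)"
    by (rule hom_eval[OF assms(1,4)]) (use \<open>set p \<subseteq> K\<close> assms in auto)
  ultimately show ?thesis using assms(8) hom_facts(3)[OF assms(1,4)] by simp
qed

text \<open>The roots in N of the minimal polynomial of x form a finite set that s maps injectively
  into itself, hence onto itself.\<close>

lemma hom_image_root_closed:
  assumes N: "subfield N L" "K \<subseteq> N" "subfield K L" "root_closed K N"
    and s: "s \<in> ring_hom (L\<lparr>carrier := N\<rparr>) L" "\<forall>c\<in>K. s c = c"
  shows "s ` N = N"
proof -
  have Nc: "N \<subseteq> carrier L" by (rule subfieldE(3)[OF N(1)])
  have al: "(algebraic over K) x" if "x \<in> N" for x using N(4) that by (simp add: root_closed_def)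
  have root: "eval (Irr K x) (s z) = \<zero>" if "x \<in> N" "z \<in> N" "eval (Irr K x) z = \<zero>" for x z
    by (rule hom_root[OF N(1-3) s that(2) IrrE(1)[OF N(3) _ al[OF that(1)]] that(3)]) (use that Nc in auto)
  have in_N: "s x \<in> N" if "x \<in> N" for x
    using root[OF that that IrrE(4)[OF N(3) _ al[OF that]]] that Nc N(4) hom_facts(1)[OF N(1) s(1) that]
    by (auto simp: root_closed_def)
  have "x \<in> s ` N" if x: "x \<in> N" for x
  proof -
    have xc: "x \<in> carrier L" using x Nc by auto
    note I = IrrE[OF N(3) xc al[OF x]]
    define A where "A = {y \<in> N. eval (Irr K x) y = \<zero>}"
    have IL: "Irr K x \<in> carrier (poly_ring L)" by (rule carrier_polynomial_shell[OF subfieldE(1)[OF N(3)] I(1)])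
    have "A \<subseteq> {y. is_root (Irr K x) y}"
      using Nc pirreducibleE(1)[OF subfieldE(1)[OF N(3)] I(1,2)] by (auto simp: A_def is_root_def)
    then have "finite A" using finite_number_of_roots[OF IL] finite_subset by blast
    moreover have "s ` A \<subseteq> A" using in_N root[OF x] by (auto simp: A_def)
    moreover have "inj_on s A" using hom_facts(7)[OF N(1) s(1)] by (rule inj_on_subset) (auto simp: A_def)
    ultimately have "s ` A = A" by (simp add: endo_inj_surj)
    moreover have "x \<in> A" using x I(4) by (simp add: A_def)
    ultimately show ?thesis by (auto simp: A_def)
  qed
  then show ?thesis using in_N by auto
qed

lemma galois_groupI:
  assumes N: "subfield N L" "K \<subseteq> N" "subfield K L" "root_closed K N"
    and s: "s \<in> ring_hom (L\<lparr>carrier := N\<rparr>) L" "\<forall>c\<in>K. s c = c"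
  shows "restrict s N \<in> galois_group K N"
proof -
  have im: "s ` N = N" by (rule hom_image_root_closed[OF N s])
  have cl: "x \<in> N \<Longrightarrow> s x \<in> N" for x using im by auto
  note Nc = subringE[OF subfieldE(1)[OF N(1)]]
  have "restrict s N \<in> ring_hom (L\<lparr>carrier := N\<rparr>) (L\<lparr>carrier := N\<rparr>)"
    by (rule ring_hom_memI) (use cl Nc hom_facts[OF N(1) s(1)] in auto)
  moreover have "bij_betw (restrict s N) N N"
    using hom_facts(7)[OF N(1) s(1)] im by (auto simp: bij_betw_def inj_on_def)
  ultimately show ?thesis using s(2) N(2) by (auto simp: galois_group_def ring_iso_def)
qed

lemma galois_groupD:
  assumes "\<tau> \<in> galois_group K N" "N \<subseteq> carrier L"
  shows "\<tau> \<in> ring_hom (L\<lparr>carrier := N\<rparr>) L" "\<tau> \<in> extensional N" "\<tau> ` N = N" "inj_on \<tau> N"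
    "x \<in> K \<Longrightarrow> \<tau> x = x" "x \<in> N \<Longrightarrow> \<tau> x \<in> N"
proof -
  have t: "\<tau> \<in> ring_hom (L\<lparr>carrier := N\<rparr>) (L\<lparr>carrier := N\<rparr>)" "bij_betw \<tau> N N" "\<tau> \<in> extensional N" "\<forall>x\<in>K. \<tau> x = x"
    using assms(1) by (auto simp: galois_group_def ring_iso_def)
  show "\<tau> \<in> ring_hom (L\<lparr>carrier := N\<rparr>) L"
    using t(1) assms(2) by (auto simp: ring_hom_def Pi_def)
  show "\<tau> \<in> extensional N" "\<tau> ` N = N" "inj_on \<tau> N" "x \<in> K \<Longrightarrow> \<tau> x = x" "x \<in> N \<Longrightarrow> \<tau> x \<in> N"
    using t by (auto simp: bij_betw_def)
qed

lemma hom_extends_galois: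
  assumes K: "subfield K L" and E: "subfield E L" and N: "subfield N L" and KE: "K \<subseteq> E" and EN: "E \<subseteq> N"
    and fin: "finite_dimension K N" and nrm: "root_closed K N"
    and s: "s \<in> ring_hom (L\<lparr>carrier := E\<rparr>) L" "\<forall>c\<in>K. s c = c"
  shows "\<exists>\<tau>\<in>galois_group K N. \<forall>x\<in>E. \<tau> x = s x"
proof -
  have fE: "finite_dimension E N"
    by (rule finite_dimension_intermediate(2)[OF K E subfieldE(1)[OF N] KE EN fin])
  obtain t where t: "t \<in> ring_hom (L\<lparr>carrier := N\<rparr>) L" "\<forall>x\<in>E. t x = s x"
    using hom_extends[OF E subfieldE(1)[OF N] EN fE s(1)] by blast
  have "restrict t N \<in> galois_group K N"
    by (rule galois_groupI[OF N _ K nrm t(1)]) (use t KE EN s in auto)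
  then show ?thesis using t(2) EN by (intro bexI[of _ "restrict t N"]) auto
qed

lemma conjugate_hom:
  assumes F: "subfield F L" and b: "b \<in> carrier L" "(algebraic over F) b"
    and y: "y \<in> carrier L" "eval (Irr F b) y = \<zero>"
  shows "\<exists>s. s \<in> ring_hom (L\<lparr>carrier := simple_extension F b\<rparr>) L \<and> s b = y \<and> (\<forall>x\<in>F. s x = x)"
proof -
  have id: "(\<lambda>x. x) \<in> ring_hom (L\<lparr>carrier := F\<rparr>) L"
    by (rule ring_hom_memI) (use subfieldE(3)[OF F] in auto)
  show ?thesis using simple_extension_hom[OF F id b y(1)] y(2) by simp
qed

lemma conjugate_galois:
  assumes F: "subfield F L" and N: "subfield N L" "F \<subseteq> N" "finite_dimension F N" "root_closed F N"
    and b: "b \<in> N" and y: "y \<in> carrier L" "eval (Irr F b) y = \<zero>"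
  shows "\<exists>\<tau>\<in>galois_group F N. \<tau> b = y"
proof -
  have bc: "b \<in> carrier L" using b subfieldE(3)[OF N(1)] by auto
  have al: "(algebraic over F) b" using N(4) b by (simp add: root_closed_def)
  obtain s where s: "s \<in> ring_hom (L\<lparr>carrier := simple_extension F b\<rparr>) L" "s b = y" "\<forall>x\<in>F. s x = x"
    using conjugate_hom[OF F bc al y] by blast
  define E where "E = simple_extension F b"
  have E: "subfield E L" unfolding E_def using simple_extension_is_subfield[OF F bc] al by simp
  have FE: "F \<subseteq> E" unfolding E_def by (rule simple_extension_incl[OF subfieldE(3)[OF F] bc])
  have EN: "E \<subseteq> N" unfolding E_def by (rule simple_extension_subring_incl[OF subfieldE(1)[OF N(1)] N(2) b])
  have bE: "b \<in> E" unfolding E_def by (rule simple_extension_mem[OF subfieldE(1)[OF F] bc])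
  show ?thesis
    using hom_extends_galois[OF F E N(1) FE EN N(3,4) s(1)[folded E_def] s(3)] bE s(2) by auto
qed

end

section \<open>Separability and Galois closures\<close>

context field begin

lemma size_roots_ge_card:
  assumes "p \<in> carrier (poly_ring R)" "p \<noteq> []" "\<forall>y\<in>A. y \<in> carrier R \<and> eval p y = \<zero>"
  shows "card A \<le> degree p"
proof -
  have "A \<subseteq> set_mset (roots p)"
    using assms roots_mem_iff_is_root[OF assms(1)] by (auto simp: is_root_def)
  then have "card A \<le> card (set_mset (roots p))" by (intro card_mono) auto
  also have "\<dots> = size (mset_set (set_mset (roots p)))" by simp
  also have "\<dots> \<le> size (roots p)" by (intro size_mset_mono mset_set_set_mset_msubset)
  also have "\<dots> \<le> degree p" by (rule size_roots_le_degree[OF assms(1)])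
  finally show ?thesis .
qed

text \<open>Made for coefficient lists with possible leading zeros: the formal degree is below
  \<open>length q\<close>. It serves to prove polynomial identities by counting roots.\<close>

lemma coefficients_zero_if_many_roots:
  assumes "set q \<subseteq> carrier R" "\<forall>y\<in>A. y \<in> carrier R \<and> eval q y = \<zero>" "length q \<le> card A" "c \<in> set q"
  shows "c = \<zero>"
proof -
  define p where "p = normalize q"
  have pc: "p \<in> carrier (poly_ring R)"
    unfolding p_def univ_poly_carrier[symmetric] by (rule normalize_gives_polynomial[OF assms(1)])
  have "p = []"
  proof (rule ccontr)
    assume ne: "p \<noteq> []"
    have "\<forall>y\<in>A. y \<in> carrier R \<and> eval p y = \<zero>" using assms(1,2) eval_normalize by (simp add: p_def)
    then have "card A \<le> length p - 1" by (rule size_roots_ge_card[OF pc ne])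
    moreover have "length p \<le> length q" unfolding p_def by (rule normalize_length_le)
    moreover have "0 < length p" using ne by simp
    ultimately show False using assms(3) by linarith
  qed
  then have "q = replicate (length q) \<zero>" using normalize_trick[of q] by (simp add: p_def)
  then show ?thesis using assms(4) by (metis in_set_replicate)
qed

lemma eval_map2_add:
  assumes "length p = length q" "set p \<subseteq> carrier R" "set q \<subseteq> carrier R" "z \<in> carrier R"
  shows "eval (map2 (\<oplus>) p q) z = eval p z \<oplus> eval q z"
proof -
  have len: "length (exp_base z (length q)) = length q" by (simp add: exp_base_def)
  have "combine p (exp_base z (length q)) \<oplus> combine q (exp_base z (length q)) = combine (map2 (\<oplus>) p q) (exp_base z (length q))"
    by (rule combine_add) (use assms len exp_base_closed[OF assms(4)] in auto)
  then show ?thesis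
    using combine_eq_eval[of p z] combine_eq_eval[of q z] combine_eq_eval[of "map2 (\<oplus>) p q" z] assms(1) by simp
qed

lemma eval_scale:
  assumes "set p \<subseteq> carrier R" "k \<in> carrier R" "z \<in> carrier R"
  shows "eval (map (\<lambda>c. k \<otimes> c) p) z = k \<otimes> eval p z"
  using assms(1)
proof (induction p)
  case (Cons c p)
  have "eval p z \<in> carrier R" "c \<in> carrier R" "z [^] length p \<in> carrier R"
    using eval_in_carrier[of p z] Cons assms by auto
  then show ?case using Cons assms by (simp add: r_distr m_assoc)
qed (use assms in simp)

text \<open>The coefficients below the leading one of the monic polynomial with roots \<open>ys\<close>.\<close>

primrec vieta :: "'a list \<Rightarrow> 'a list" where
  "vieta [] = []"
| "vieta (y # ys) = map2 (\<oplus>) (vieta ys @ [\<zero>]) (map (\<lambda>c. \<ominus> y \<otimes> c) (\<one> # vieta ys))"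

lemma length_vieta [simp]: "length (vieta ys) = length ys"
  by (induction ys) auto

lemma set_vieta:
  assumes "subring S R" "set ys \<subseteq> S"
  shows "set (vieta ys) \<subseteq> S"
  using assms(2)
proof (induction ys)
  case (Cons y ys)
  note S = subringE[OF assms(1)]
  have add: "set p \<subseteq> S \<Longrightarrow> set q \<subseteq> S \<Longrightarrow> set (map2 (\<oplus>) p q) \<subseteq> S" for p q
  proof
    fix z assume h: "set p \<subseteq> S" "set q \<subseteq> S" "z \<in> set (map2 (\<oplus>) p q)"
    then obtain a b where ab: "(a, b) \<in> set (zip p q)" "z = a \<oplus> b" by auto
    then have "a \<in> S" "b \<in> S" using h set_zip_leftD set_zip_rightD by fast+
    then show "z \<in> S" using S(7) ab(2) by simp
  qed
  have "set (vieta ys @ [\<zero>]) \<subseteq> S" using Cons S(2) by simp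
  moreover have "set (map (\<lambda>c. \<ominus> y \<otimes> c) (\<one> # vieta ys)) \<subseteq> S" using Cons S by auto
  ultimately show ?case using add by simp
qed simp

lemma eval_vieta:
  assumes "set ys \<subseteq> carrier R" "z \<in> carrier R"
  shows "z [^] length ys \<oplus> eval (vieta ys) z = foldr (\<lambda>y r. (z \<ominus> y) \<otimes> r) ys \<one>"
  using assms(1)
proof (induction ys)
  case Nil
  then show ?case by simp
next
  case (Cons y ys)
  have y: "y \<in> carrier R" and ys: "set ys \<subseteq> carrier R" using Cons by auto
  define n where "n = length ys"
  have vc: "set (vieta ys) \<subseteq> carrier R" by (rule set_vieta[OF carrier_is_subring ys])
  define e where "e = eval (vieta ys) z"
  define t where "t = z [^] n"
  have ec: "e \<in> carrier R" "t \<in> carrier R" using eval_in_carrier[OF vc assms(2)] assms(2) by (auto simp: e_def t_def)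
  have "eval (vieta (y # ys)) z = eval (vieta ys @ [\<zero>]) z \<oplus> eval (map (\<lambda>c. \<ominus> y \<otimes> c) (\<one> # vieta ys)) z"
    unfolding vieta.simps by (rule eval_map2_add) (use vc y assms in auto)
  moreover have "eval (vieta ys @ [\<zero>]) z = e \<otimes> z"
    using eval_append_aux[OF vc _ assms(2), of \<zero>] ec assms by (simp add: e_def)
  moreover have "eval (map (\<lambda>c. \<ominus> y \<otimes> c) (\<one> # vieta ys)) z = \<ominus> y \<otimes> eval (\<one> # vieta ys) z"
    by (rule eval_scale) (use vc y assms in auto)
  moreover have "eval (\<one> # vieta ys) z = t \<oplus> e" using ec by (simp add: e_def t_def n_def)
  ultimately have ev: "eval (vieta (y # ys)) z = e \<otimes> z \<oplus> \<ominus> y \<otimes> (t \<oplus> e)" by simp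
  have "z [^] length (y # ys) = t \<otimes> z" by (simp add: t_def n_def)
  then have "z [^] length (y # ys) \<oplus> eval (vieta (y # ys)) z = t \<otimes> z \<oplus> (e \<otimes> z \<oplus> \<ominus> y \<otimes> (t \<oplus> e))"
    unfolding ev by simp
  also have "\<dots> = (z \<ominus> y) \<otimes> (t \<oplus> e)" unfolding a_minus_def using ec y assms(2) by algebra
  also have "t \<oplus> e = foldr (\<lambda>y r. (z \<ominus> y) \<otimes> r) ys \<one>" using Cons.IH[OF ys] by (simp add: t_def e_def n_def)
  finally show ?case by simp
qed

lemma vieta_root:
  assumes "set ys \<subseteq> carrier R" "z \<in> set ys"
  shows "z [^] length ys \<oplus> eval (vieta ys) z = \<zero>"
proof -
  have zc: "z \<in> carrier R" using assms by auto
  have c: "set xs \<subseteq> carrier R \<Longrightarrow> foldr (\<lambda>y r. (z \<ominus> y) \<otimes> r) xs \<one> \<in> carrier R" for xs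
    using zc by (induction xs) auto
  have "foldr (\<lambda>y r. (z \<ominus> y) \<otimes> r) ys \<one> = \<zero>"
    using assms
  proof (induction ys)
    case (Cons y ys)
    show ?case
    proof (cases "z = y")
      case True
      then have "z \<ominus> y = \<zero>" using zc by simp
      then show ?thesis using c[of ys] Cons by simp
    next
      case False
      then show ?thesis using Cons zc by simp
    qed
  qed simp
  then show ?thesis using eval_vieta[OF assms(1) zc] by simp
qed

text \<open>The polynomial with coefficients t c - c has formal degree below the number of elements
  of \<open>ys\<close>, but it vanishes at all of them because t permutes them.\<close>

lemma vieta_fixed:
  assumes N: "subfield N R" and t: "t \<in> ring_hom (R\<lparr>carrier := N\<rparr>) R"
    and ys: "distinct ys" "set ys \<subseteq> N" "t ` set ys = set ys" and c: "c \<in> set (vieta ys)"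
  shows "t c = c"
proof -
  define v where "v = vieta ys"
  have Nc: "N \<subseteq> carrier R" by (rule subfieldE(3)[OF N])
  have vN: "set v \<subseteq> N" unfolding v_def by (rule set_vieta[OF subfieldE(1)[OF N] ys(2)])
  have vc: "set v \<subseteq> carrier R" "set (map t v) \<subseteq> carrier R" "set (map (\<lambda>a. \<ominus> a) v) \<subseteq> carrier R"
    using vN Nc hom_facts(1)[OF N t] by auto
  have ysc: "set ys \<subseteq> carrier R" using ys(2) Nc by auto
  define q where "q = map2 (\<oplus>) (map t v) (map (\<lambda>a. \<ominus> a) v)"
  have q_alt: "q = map (\<lambda>a. t a \<oplus> \<ominus> a) v"
    by (simp add: q_def map2_map_map)
  have qc: "set q \<subseteq> carrier R" using vN Nc hom_facts(1)[OF N t] by (auto simp: q_alt)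
  have root: "eval q z = \<zero>" if z: "z \<in> set ys" for z
  proof -
    obtain z' where z': "z' \<in> set ys" "z = t z'" using ys(3) z by blast
    have z'N: "z' \<in> N" and zc: "z \<in> carrier R" using z' z ys(2) Nc by auto
    have evN: "eval v z' \<in> N"
      using vN
    proof (induction v)
      case (Cons a v)
      have "z' [^] (n::nat) \<in> N" for n using z'N subringE(3,6)[OF subfieldE(1)[OF N]] by (induction n) auto
      then show ?case using Cons subringE(6,7)[OF subfieldE(1)[OF N]] by simp
    qed (use subringE(2)[OF subfieldE(1)[OF N]] in simp)
    have pN: "z' [^] (n::nat) \<in> N \<and> t (z' [^] n) = z [^] n" for n
    proof (induction n)
      case 0
      then show ?case using subringE(3)[OF subfieldE(1)[OF N]] hom_facts(2)[OF N t] by simp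
    next
      case (Suc n)
      then show ?case using z'N z'(2) subringE(6)[OF subfieldE(1)[OF N]] hom_facts(4)[OF N t] by simp
    qed
    define n where "n = length ys"
    have 1: "z [^] n \<oplus> eval v z = \<zero>" unfolding n_def v_def by (rule vieta_root[OF ysc z])
    have "z' [^] n \<oplus> eval v z' = \<zero>" unfolding n_def v_def by (rule vieta_root[OF ysc z'(1)])
    then have "t (z' [^] n) \<oplus> t (eval v z') = \<zero>"
      using hom_facts(5)[OF N t conjunct1[OF pN] evN, of n] hom_facts(3)[OF N t] by simp
    then have 2: "z [^] n \<oplus> eval (map t v) z = \<zero>" using pN[of n] hom_eval[OF N t vN z'N] z'(2) by simp
    have cc: "z [^] n \<in> carrier R" "eval v z \<in> carrier R" "eval (map t v) z \<in> carrier R"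
      using zc eval_in_carrier vc by auto
    have eq: "eval (map t v) z = eval v z" using 1 2 cc by (metis add.l_cancel)
    have "eval q z = eval (map t v) z \<oplus> eval (map (\<lambda>a. \<ominus> a) v) z"
      unfolding q_def by (rule eval_map2_add) (use vc zc in auto)
    also have "\<dots> = eval v z \<oplus> \<ominus> eval v z" unfolding eq eval_uminus[OF vc(1) zc] ..
    finally show ?thesis using cc by (simp add: r_neg)
  qed
  have "length q \<le> card (set ys)" using ys(1) by (simp add: q_alt v_def distinct_card)
  moreover have "\<forall>y\<in>set ys. y \<in> carrier R \<and> eval q y = \<zero>" using root ysc by auto
  ultimately have "t c \<oplus> \<ominus> c = \<zero>"
    using coefficients_zero_if_many_roots[OF qc, of "set ys" "t c \<oplus> \<ominus> c"] c by (auto simp: q_alt v_def)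
  moreover have "c \<in> N" using c vN by (auto simp: v_def)
  ultimately show ?thesis using Nc hom_facts(1)[OF N t] by (metis a_minus_def r_right_minus_eq subsetD)
qed

lemma alg_mult_mono:
  assumes "p \<in> carrier (poly_ring R)" "q \<in> carrier (poly_ring R)" "q \<noteq> []" "p pdivides q"
  shows "alg_mult p a \<le> alg_mult q a"
  using pdivides_imp_roots_incl[OF assms] alg_mult_eq_count_roots[OF assms(1)] alg_mult_eq_count_roots[OF assms(2)]
  by (simp add: mset_subset_eq_count)

definition separable_element :: "'a set \<Rightarrow> 'a \<Rightarrow> bool"
  where "separable_element K x \<longleftrightarrow> (algebraic over K) x \<and> (\<forall>a\<in>carrier R. alg_mult (Irr K x) a \<le> 1)"

lemma separable_element_mono:
  assumes "subfield K R" "subfield F R" "K \<subseteq> F" "x \<in> carrier R" "separable_element K x"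
  shows "separable_element F x"
proof -
  have aK: "(algebraic over K) x" using assms(5) by (simp add: separable_element_def)
  have aF: "(algebraic over F) x" by (rule algebraic_mono[OF assms(3) aK])
  note IK = IrrE[OF assms(1,4) aK] and IF = IrrE[OF assms(2,4) aF]
  have "Irr K x \<in> carrier (F[X])" using IK(1) assms(3) by (auto simp: univ_poly_carrier[symmetric] polynomial_def)
  then have d: "Irr F x pdivides Irr K x" using Irr_minimal[OF assms(2,4) aF _ IK(4)] by simp
  have "alg_mult (Irr F x) a \<le> alg_mult (Irr K x) a" for a
    by (rule alg_mult_mono[OF carrier_polynomial_shell[OF subfieldE(1)[OF assms(2)] IF(1)]
          carrier_polynomial_shell[OF subfieldE(1)[OF assms(1)] IK(1)]
          pirreducibleE(1)[OF subfieldE(1)[OF assms(1)] IK(1,2)] d])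
  then show ?thesis using aF assms(5) unfolding separable_element_def by (meson le_trans)
qed

lemma separable_extension_iff: "separable_extension K E \<longleftrightarrow> (\<forall>x\<in>E. separable_element K x)"
  by (simp add: separable_extension_def separable_element_def)

end

context algebraically_closed begin

lemma card_roots_separable:
  assumes "p \<in> carrier (poly_ring L)" "p \<noteq> []" "\<forall>a\<in>carrier L. alg_mult p a \<le> 1"
  shows "card {y \<in> carrier L. eval p y = \<zero>} = degree p"
proof -
  have s: "set_mset (roots p) = {y \<in> carrier L. eval p y = \<zero>}"
    using roots_mem_iff_is_root[OF assms(1)] assms(2) by (auto simp: is_root_def)
  have "count (roots p) y = 1" if "y \<in># roots p" for y
  proof -
    have "y \<in> carrier L" using that s by auto
    then have "count (roots p) y \<le> 1" using assms(3) alg_mult_eq_count_roots[OF assms(1)] by simp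
    moreover have "0 < count (roots p) y" using that by simp
    ultimately show ?thesis by linarith
  qed
  then have "size (roots p) = card (set_mset (roots p))" by (simp add: size_multiset_overloaded_eq)
  then show ?thesis using roots_over_carrier[OF assms(1)] s by (simp add: splitted_def)
qed

text \<open>Remove the generators one at a time. Write x = p(b) over F with deg p < d, the degree of
  b. An automorphism over F that moves b to a conjugate y fixes x, so p(y) = x for all d conjugates
  of b, which are distinct by separability. Hence p - x vanishes identically, and x is the constant
  coefficient of p, an element of F.\<close>

theorem fixed_by_galois:
  assumes K: "subfield K L" and N: "subfield N L" "K \<subseteq> N" "finite_dimension K N" "root_closed K N"
    and As: "set As \<subseteq> N" "\<forall>a\<in>set As. separable_element K a"
    and x: "x \<in> finite_extension K As" "\<forall>\<tau>\<in>galois_group K N. \<tau> x = x"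
  shows "x \<in> K"
  using As x(1)
proof (induction As)
  case Nil
  then show ?case by simp
next
  case (Cons b Bs)
  have Nc: "N \<subseteq> carrier L" by (rule subfieldE(3)[OF N(1)])
  have Bsc: "set Bs \<subseteq> carrier L" and bc: "b \<in> carrier L" using Cons Nc by auto
  define F where "F = finite_extension K Bs"
  have F: "subfield F L" unfolding F_def
    by (rule finite_extension_is_subfield[OF K Bsc]) (use Cons in \<open>auto simp: separable_element_def\<close>)
  have KF: "K \<subseteq> F" unfolding F_def by (rule finite_extension_incl[OF subfieldE(3)[OF K] Bsc])
  have FN: "F \<subseteq> N" unfolding F_def
    by (rule finite_extension_subring_incl[OF subfieldE(1)[OF N(1)] N(2)]) (use Cons in auto)
  have Fc: "F \<subseteq> carrier L" by (rule subfieldE(3)[OF F])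
  have sepb: "separable_element F b" by (rule separable_element_mono[OF K F KF bc]) (use Cons in auto)
  then have alb: "(algebraic over F) b" by (simp add: separable_element_def)
  note I = IrrE[OF F bc alb]
  have IL: "Irr F b \<in> carrier (poly_ring L)" by (rule carrier_polynomial_shell[OF subfieldE(1)[OF F] I(1)])
  have Ine: "Irr F b \<noteq> []" by (rule pirreducibleE(1)[OF subfieldE(1)[OF F] I(1,2)])
  define d where "d = degree (Irr F b)"
  have d1: "1 \<le> d" unfolding d_def by (rule pirreducible_degree[OF F I(1,2)])
  define A where "A = {y \<in> carrier L. eval (Irr F b) y = \<zero>}"
  have cardA: "card A = d" unfolding A_def d_def
    by (rule card_roots_separable[OF IL Ine]) (use sepb in \<open>simp add: separable_element_def\<close>)
  have "x \<in> simple_extension F b" using Cons.prems(3) by (simp add: F_def)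
  then have "x \<in> (\<lambda>p. eval p b) ` {p \<in> carrier (F[X]). length p \<le> d}"
    using Span_exp_base[OF F bc alb] Span_eq_eval_img[OF F bc, of d] by (simp add: d_def)
  then obtain p where p: "p \<in> carrier (F[X])" "length p \<le> d" "x = eval p b" by blast
  have ps: "set p \<subseteq> F" by (rule poly_mem_set[OF p(1)])
  have xN: "x \<in> N"
  proof -
    have "finite_extension K (b # Bs) \<subseteq> N"
      by (rule finite_extension_subring_incl[OF subfieldE(1)[OF N(1)] N(2)]) (use Cons in auto)
    then show ?thesis using Cons.prems(3) by blast
  qed
  then have xc: "x \<in> carrier L" using Nc by auto
  have val: "eval p y = x" if y: "y \<in> A" for y
  proof -
    have yc: "y \<in> carrier L" "eval (Irr F b) y = \<zero>" using y by (auto simp: A_def)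
    have fFN: "finite_dimension F N"
      by (rule finite_dimension_intermediate(2)[OF K F subfieldE(1)[OF N(1)] KF FN N(3)])
    have rFN: "root_closed F N" by (rule root_closed_intermediate[OF N(4) K F N(1) KF FN])
    obtain \<tau> where t: "\<tau> \<in> galois_group F N" "\<tau> b = y"
      using conjugate_galois[OF F N(1) FN fFN rFN _ yc] Cons.prems(1) by auto
    then have tK: "\<tau> \<in> galois_group K N" using KF by (auto simp: galois_group_def)
    note td = galois_groupD[OF t(1) Nc]
    have pN: "set p \<subseteq> N" using ps FN by auto
    have "\<tau> (eval p b) = eval (map \<tau> p) (\<tau> b)" by (rule hom_eval[OF N(1) td(1) pN]) (use Cons.prems(1) in simp)
    moreover have "map \<tau> p = p" using ps td(5) by (auto intro: map_idI)
    moreover have "\<tau> x = x" using x(2) tK by blast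
    ultimately show ?thesis unfolding p(3) t(2) by simp
  qed
  \<comment> \<open>Padding with leading zeros to length d provides a constant coefficient c even if
    p is the empty list.\<close>
  define p' where "p' = replicate (d - length p) \<zero> @ p"
  have lp': "length p' = d" using p(2) by (simp add: p'_def)
  have p'F: "set p' \<subseteq> F" using ps subringE(2)[OF subfieldE(1)[OF F]] by (auto simp: p'_def)
  have "p' \<noteq> []" using lp' d1 by auto
  then obtain r c where rc: "p' = r @ [c]" by (metis rev_exhaust)
  have cF: "c \<in> F" "set r \<subseteq> F" using p'F rc by auto
  have cc: "c \<in> carrier L" "set r \<subseteq> carrier L" using cF Fc by auto
  have root: "\<forall>y\<in>A. y \<in> carrier L \<and> eval (r @ [c \<ominus> x]) y = \<zero>"
  proof
    fix y assume y: "y \<in> A"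
    then have yc: "y \<in> carrier L" by (simp add: A_def)
    have ec: "eval r y \<in> carrier L" by (rule eval_in_carrier[OF cc(2) yc])
    have "eval p' y = x"
      unfolding p'_def using eval_replicate[of p y] val[OF y] ps Fc yc by auto
    then have e: "eval r y \<otimes> y \<oplus> c = x" unfolding rc eval_append_aux[OF cc(2,1) yc] .
    have "eval (r @ [c \<ominus> x]) y = eval r y \<otimes> y \<oplus> (c \<ominus> x)" by (rule eval_append_aux[OF cc(2) _ yc]) (use cc xc in simp)
    also have "\<dots> = (eval r y \<otimes> y \<oplus> c) \<ominus> x" unfolding a_minus_def using ec yc cc xc by (simp add: a_assoc)
    finally show "y \<in> carrier L \<and> eval (r @ [c \<ominus> x]) y = \<zero>" using e xc yc by simp
  qed
  have "c \<ominus> x = \<zero>"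
    by (rule coefficients_zero_if_many_roots[OF _ root]) (use cc xc cardA lp' rc in auto)
  then have "c = x" using cc xc by simp
  then have "x \<in> F" using cF by simp
  then show ?case using Cons.IH Cons.prems by (simp add: F_def)
qed

lemma finite_conjugates:
  assumes K: "subfield K L" and N: "subfield N L" "K \<subseteq> N" "root_closed K N" and x: "x \<in> N"
  shows "finite ((\<lambda>\<tau>. \<tau> x) ` galois_group K N)" "(\<lambda>\<tau>. \<tau> x) ` galois_group K N \<subseteq> N"
    "\<tau> \<in> galois_group K N \<Longrightarrow> eval (Irr K x) (\<tau> x) = \<zero>"
proof -
  have Nc: "N \<subseteq> carrier L" by (rule subfieldE(3)[OF N(1)])
  have xc: "x \<in> carrier L" using x Nc by auto
  have al: "(algebraic over K) x" using N(3) x by (simp add: root_closed_def)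
  note I = IrrE[OF K xc al]
  show root: "eval (Irr K x) (\<tau> x) = \<zero>" if "\<tau> \<in> galois_group K N" for \<tau>
    using hom_root[OF N(1,2) K _ _ x I(1,4)] galois_groupD[OF that Nc] by simp
  show sub: "(\<lambda>\<tau>. \<tau> x) ` galois_group K N \<subseteq> N" using galois_groupD(6)[OF _ Nc] x by auto
  have IL: "Irr K x \<in> carrier (poly_ring L)" by (rule carrier_polynomial_shell[OF subfieldE(1)[OF K] I(1)])
  have "(\<lambda>\<tau>. \<tau> x) ` galois_group K N \<subseteq> {y. is_root (Irr K x) y}"
    using sub root Nc pirreducibleE(1)[OF subfieldE(1)[OF K] I(1,2)] by (auto simp: is_root_def)
  then show "finite ((\<lambda>\<tau>. \<tau> x) ` galois_group K N)" using finite_number_of_roots[OF IL] finite_subset by blast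
qed

lemma galois_compose:
  assumes N: "subfield N L" "K \<subseteq> N" "subfield K L" "root_closed K N"
    and s: "\<eta> \<in> galois_group K N" and t: "\<tau> \<in> galois_group K N"
  shows "compose N \<eta> \<tau> \<in> galois_group K N"
proof -
  have Nc: "N \<subseteq> carrier L" by (rule subfieldE(3)[OF N(1)])
  note S = galois_groupD[OF s Nc] and T = galois_groupD[OF t Nc]
  note hs = hom_facts[OF N(1) S(1)] and ht = hom_facts[OF N(1) T(1)]
  have "(\<lambda>x. \<eta> (\<tau> x)) \<in> ring_hom (L\<lparr>carrier := N\<rparr>) L"
    by (rule ring_hom_memI) (use hs ht T(6) in auto)
  then have "restrict (\<lambda>x. \<eta> (\<tau> x)) N \<in> galois_group K N"
    by (rule galois_groupI[OF N]) (use S(5) T(5) in simp)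
  then show ?thesis by (simp add: compose_def)
qed

lemma galois_inverse:
  assumes N: "subfield N L" "K \<subseteq> N" "subfield K L" "root_closed K N" and s: "\<eta> \<in> galois_group K N"
  shows "\<exists>\<rho>\<in>galois_group K N. (\<forall>x\<in>N. \<rho> (\<eta> x) = x) \<and> (\<forall>x\<in>N. \<eta> (\<rho> x) = x)"
proof -
  have Nc: "N \<subseteq> carrier L" by (rule subfieldE(3)[OF N(1)])
  note S = galois_groupD[OF s Nc]
  note hs = hom_facts[OF N(1) S(1)]
  note Ns = subringE[OF subfieldE(1)[OF N(1)]]
  define \<rho> where "\<rho> = inv_into N \<eta>"
  have r: "\<rho> x \<in> N" "\<eta> (\<rho> x) = x" if "x \<in> N" for x
    using that S(3) by (auto simp: \<rho>_def inv_into_into f_inv_into_f)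
  have l: "\<rho> (\<eta> x) = x" if "x \<in> N" for x using that S(4) by (simp add: \<rho>_def)
  have eqI: "\<rho> x = y" if "y \<in> N" "\<eta> y = x" for x y using l[OF that(1)] that(2) by simp
  have "\<rho> \<in> ring_hom (L\<lparr>carrier := N\<rparr>) L"
  proof (rule ring_hom_memI)
    fix x assume "x \<in> carrier (L\<lparr>carrier := N\<rparr>)" then show "\<rho> x \<in> carrier L" using r Nc by auto
  next
    fix x y assume "x \<in> carrier (L\<lparr>carrier := N\<rparr>)" "y \<in> carrier (L\<lparr>carrier := N\<rparr>)"
    then have xy: "x \<in> N" "y \<in> N" by auto
    show "\<rho> (x \<otimes>\<^bsub>L\<lparr>carrier := N\<rparr>\<^esub> y) = \<rho> x \<otimes> \<rho> y" using xy r hs(4) Ns(6) by (intro eqI) auto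
    show "\<rho> (x \<oplus>\<^bsub>L\<lparr>carrier := N\<rparr>\<^esub> y) = \<rho> x \<oplus> \<rho> y" using xy r hs(5) Ns(7) by (intro eqI) auto
  next
    show "\<rho> \<one>\<^bsub>L\<lparr>carrier := N\<rparr>\<^esub> = \<one>" using hs(2) Ns(3) by (intro eqI) auto
  qed
  moreover have "\<forall>c\<in>K. \<rho> c = c" using S(5) N(2) by (auto intro: eqI)
  ultimately have "restrict \<rho> N \<in> galois_group K N" using galois_groupI[OF N] by blast
  then show ?thesis using l r S(6) by (intro bexI[of _ "restrict \<rho> N"]) auto
qed

text \<open>Automorphisms permute the orbit of x, so they fix the coefficients of the monic
  polynomial with these roots. The fixed field enters as the hypothesis \<open>fixed\<close>,
  because its proof differs between generators known to be separable and a separable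
  extension.\<close>

lemma orbit_polynomial:
  assumes K: "subfield K L" and N: "subfield N L" "K \<subseteq> N" "finite_dimension K N" "root_closed K N"
    and fixed: "\<And>x. x \<in> N \<Longrightarrow> \<forall>\<tau>\<in>galois_group K N. \<tau> x = x \<Longrightarrow> x \<in> K" and x: "x \<in> N"
  obtains ys where "distinct ys" "set ys = (\<lambda>\<tau>. \<tau> x) ` galois_group K N" "x \<in> set ys"
    "set (vieta ys) \<subseteq> K"
proof -
  have Nc: "N \<subseteq> carrier L" by (rule subfieldE(3)[OF N(1)])
  note fc = finite_conjugates[OF K N(1,2,4) x]
  obtain ys where ys: "distinct ys" "set ys = (\<lambda>\<tau>. \<tau> x) ` galois_group K N"
    using finite_distinct_list[OF fc(1)] by blast
  have "restrict (\<lambda>x. x) N \<in> galois_group K N"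
    by (rule galois_groupI[OF N(1,2) K N(4)]) (use Nc in \<open>auto intro!: ring_hom_memI\<close>)
  then have xys: "x \<in> set ys" unfolding ys(2) by (rule image_eqI[rotated]) (use x in simp)
  have ysN: "set ys \<subseteq> N" using ys fc by simp
  have "c \<in> K" if c: "c \<in> set (vieta ys)" for c
  proof (rule fixed)
    show "c \<in> N" using set_vieta[OF subfieldE(1)[OF N(1)] ysN] c by auto
    show "\<forall>\<tau>\<in>galois_group K N. \<tau> c = c"
    proof
      fix \<tau> assume t: "\<tau> \<in> galois_group K N"
      note T = galois_groupD[OF t Nc]
      have "\<tau> ` set ys \<subseteq> set ys"
      proof
        fix z assume "z \<in> \<tau> ` set ys"
        then obtain \<eta> where s: "\<eta> \<in> galois_group K N" "z = \<tau> (\<eta> x)" using ys(2) by auto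
        then have "z = compose N \<tau> \<eta> x" using x by (simp add: compose_def)
        then show "z \<in> set ys" unfolding ys(2) using galois_compose[OF N(1,2) K N(4) t s(1)] by blast
      qed
      moreover have "inj_on \<tau> (set ys)" using T(4) ysN inj_on_subset by blast
      ultimately have "\<tau> ` set ys = set ys" by (simp add: endo_inj_surj)
      then show "\<tau> c = c" by (rule vieta_fixed[OF N(1) T(1) ys(1) ysN _ c])
    qed
  qed
  then show ?thesis using that[OF ys xys] by blast
qed

text \<open>The minimal polynomial of x divides the orbit polynomial of x, whose roots are simple:
  their number is already its degree.\<close>

lemma separable_generated:
  assumes K: "subfield K L" and As: "set As \<subseteq> carrier L" "\<forall>a\<in>set As. separable_element K a"
    and nrm: "root_closed K (finite_extension K As)" and x: "x \<in> finite_extension K As"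
  shows "separable_element K x"
proof -
  define N where "N = finite_extension K As"
  have al: "\<And>a. a \<in> set As \<Longrightarrow> (algebraic over K) a" using As by (simp add: separable_element_def)
  have N: "subfield N L" unfolding N_def by (rule finite_extension_is_subfield[OF K As(1) al])
  have KN: "K \<subseteq> N" unfolding N_def by (rule finite_extension_incl[OF subfieldE(3)[OF K] As(1)])
  have fin: "finite_dimension K N" unfolding N_def by (rule finite_extension_finite_dimension(1)[OF K As(1) al])
  have AsN: "set As \<subseteq> N" unfolding N_def by (rule finite_extension_mem[OF subfieldE(1)[OF K] As(1)])
  have Nc: "N \<subseteq> carrier L" by (rule subfieldE(3)[OF N])
  have xN: "x \<in> N" and xc: "x \<in> carrier L" using x Nc by (auto simp: N_def)
  note nrm' = nrm[folded N_def]
  have fixed: "y \<in> K" if "y \<in> N" "\<forall>\<tau>\<in>galois_group K N. \<tau> y = y" for y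
    by (rule fixed_by_galois[OF K N KN fin nrm' AsN As(2) _ that(2)]) (use that(1) in \<open>simp add: N_def\<close>)
  obtain ys where ys: "distinct ys" "set ys = (\<lambda>\<tau>. \<tau> x) ` galois_group K N" "x \<in> set ys" "set (vieta ys) \<subseteq> K"
    by (rule orbit_polynomial[OF K N KN fin nrm' fixed xN])
  have ysc: "set ys \<subseteq> carrier L" using ys(2) finite_conjugates(2)[OF K N KN nrm' xN] Nc by auto
  define P where "P = \<one> # vieta ys"
  have vc: "set (vieta ys) \<subseteq> carrier L" using ys(4) subfieldE(3)[OF K] by auto
  have PK: "P \<in> carrier (K[X])"
    using ys(4) subringE(3)[OF subfieldE(1)[OF K]] by (simp add: P_def univ_poly_carrier[symmetric] polynomial_def)
  have PL: "P \<in> carrier (poly_ring L)" by (rule carrier_polynomial_shell[OF subfieldE(1)[OF K] PK])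
  have root: "eval P z = \<zero>" if "z \<in> set ys" for z
  proof -
    have "z \<in> carrier L" using that ysc by auto
    then show ?thesis using vieta_root[OF ysc that] eval_in_carrier[OF vc, of z] by (simp add: P_def)
  qed
  have alx: "(algebraic over K) x" using nrm' xN by (simp add: root_closed_def)
  note I = IrrE[OF K xc alx]
  have "Irr K x pdivides P" by (rule Irr_minimal[OF K xc alx PK root[OF ys(3)]])
  then have mono: "alg_mult (Irr K x) a \<le> alg_mult P a" for a
    using alg_mult_mono[OF carrier_polynomial_shell[OF subfieldE(1)[OF K] I(1)] PL] by (simp add: P_def)
  have "set ys \<subseteq> set_mset (roots P)"
    using roots_mem_iff_is_root[OF PL] root ysc by (auto simp: is_root_def P_def)
  then have "mset_set (set ys) \<subseteq># mset_set (set_mset (roots P))" by (intro subset_imp_msubset_mset_set) auto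
  also have "\<dots> \<subseteq># roots P" by (rule mset_set_set_mset_msubset)
  finally have sub: "mset_set (set ys) \<subseteq># roots P" .
  have "size (roots P) \<le> degree P" by (rule size_roots_le_degree[OF PL])
  also have "\<dots> = size (mset_set (set ys))" using ys(1) by (simp add: P_def distinct_card)
  finally have "roots P = mset_set (set ys)" using sub by (metis mset_subset_size not_less subset_mset.le_imp_less_or_eq)
  then have "alg_mult P a \<le> 1" for a
    using alg_mult_eq_count_roots[OF PL] by (simp add: count_mset_set')
  then show ?thesis using mono alx unfolding separable_element_def by (meson le_trans)
qed

lemma Irr_of_root:
  assumes K: "subfield K L" and u: "u \<in> carrier L" "(algebraic over K) u"
    and a: "a \<in> carrier L" "eval (Irr K u) a = \<zero>"
  shows "(algebraic over K) a" "Irr K a = Irr K u"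
proof -
  note I = IrrE[OF K u]
  show al: "(algebraic over K) a"
    using algebraicI[OF I(1) pirreducibleE(1)[OF subfieldE(1)[OF K] I(1,2)] a(2)] by (simp add: over_def)
  show "Irr K a = Irr K u"
    using minimal_polynomial_is_unique[OF K a(1) al] I IrrE[OF K a(1) al] a(2) by blast
qed

text \<open>Adjoin all roots of the minimal polynomials of generators of E. For normality, a root y
  of the minimal polynomial of some x in N is the image of x under an embedding t of N, and t
  permutes the adjoined roots, so that y lies in N.\<close>

lemma galois_extension_exists:
  assumes K: "subfield K L" and E: "subfield E L" "K \<subseteq> E" "finite_dimension K E" "separable_extension K E"
  shows "\<exists>N. subfield N L \<and> E \<subseteq> N \<and> galois_extension K N"
proof -
  obtain Us where Us: "set Us \<subseteq> E" "finite_extension K Us = E"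
    by (rule finite_dimension_generators[OF K subfieldE(1)[OF E(1)] E(2,3)])
  have Ec: "E \<subseteq> carrier L" by (rule subfieldE(3)[OF E(1)])
  have sepU: "separable_element K u" "u \<in> carrier L" "(algebraic over K) u" if "u \<in> set Us" for u
    using E(4) Us(1) Ec that by (auto simp: separable_extension_iff separable_element_def)
  have Upoly: "Irr K u \<in> carrier (poly_ring L)" "Irr K u \<noteq> []" "Irr K u \<in> carrier (K[X])" "eval (Irr K u) u = \<zero>"
    if "u \<in> set Us" for u
    using carrier_polynomial_shell[OF subfieldE(1)[OF K]] IrrE[OF K sepU(2,3)[OF that]]
      pirreducibleE(1)[OF subfieldE(1)[OF K]] by auto
  define A where "A = (\<Union>u\<in>set Us. {y \<in> carrier L. eval (Irr K u) y = \<zero>})"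
  have "finite {y \<in> carrier L. eval (Irr K u) y = \<zero>}" if "u \<in> set Us" for u
    using finite_number_of_roots[OF Upoly(1)[OF that]] Upoly(2)[OF that] by (simp add: is_root_def)
  then have "finite A" by (simp add: A_def)
  then obtain As where As: "set As = A" using finite_list by blast
  have Ac: "set As \<subseteq> carrier L" by (auto simp: As A_def)
  have sepA: "\<forall>a\<in>set As. separable_element K a"
  proof
    fix a assume "a \<in> set As"
    then obtain u where u: "u \<in> set Us" "a \<in> carrier L" "eval (Irr K u) a = \<zero>" by (auto simp: As A_def)
    then show "separable_element K a"
      using Irr_of_root[OF K sepU(2,3)[OF u(1)] u(2,3)] sepU(1)[OF u(1)] by (simp add: separable_element_def)
  qed
  have al: "\<And>a. a \<in> set As \<Longrightarrow> (algebraic over K) a" using sepA by (simp add: separable_element_def)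
  define N where "N = finite_extension K As"
  have N: "subfield N L" unfolding N_def by (rule finite_extension_is_subfield[OF K Ac al])
  have KN: "K \<subseteq> N" unfolding N_def by (rule finite_extension_incl[OF subfieldE(3)[OF K] Ac])
  have fin: "finite_dimension K N" unfolding N_def by (rule finite_extension_finite_dimension(1)[OF K Ac al])
  have AN: "set As \<subseteq> N" unfolding N_def by (rule finite_extension_mem[OF subfieldE(1)[OF K] Ac])
  have Nc: "N \<subseteq> carrier L" by (rule subfieldE(3)[OF N])
  have "set Us \<subseteq> set As" using sepU(2) Upoly(4) by (auto simp: As A_def)
  then have EN: "E \<subseteq> N"
    using finite_extension_subring_incl[OF subfieldE(1)[OF N] KN, of Us] AN Us(2) by auto
  have "root_closed K N" unfolding root_closed_def
  proof (intro ballI conjI impI)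
    fix x assume x: "x \<in> N"
    have xc: "x \<in> carrier L" using x Nc by auto
    show alx: "(algebraic over K) x" by (rule finite_dimension_imp_algebraic[OF K subfieldE(1)[OF N] fin x])
    fix y assume y: "y \<in> carrier L" "eval (Irr K x) y = \<zero>"
    define F where "F = simple_extension K x"
    have F: "subfield F L" unfolding F_def using simple_extension_is_subfield[OF K xc] alx by simp
    have KF: "K \<subseteq> F" unfolding F_def by (rule simple_extension_incl[OF subfieldE(3)[OF K] xc])
    have FN: "F \<subseteq> N" unfolding F_def by (rule simple_extension_subring_incl[OF subfieldE(1)[OF N] KN x])
    have xF: "x \<in> F" unfolding F_def by (rule simple_extension_mem[OF subfieldE(1)[OF K] xc])
    obtain s where s: "s \<in> ring_hom (L\<lparr>carrier := F\<rparr>) L" "s x = y" "\<forall>c\<in>K. s c = c"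
      using conjugate_hom[OF K xc alx y] unfolding F_def by blast
    obtain t where t: "t \<in> ring_hom (L\<lparr>carrier := N\<rparr>) L" "\<forall>z\<in>F. t z = s z"
      using hom_extends[OF F subfieldE(1)[OF N] FN
          finite_dimension_intermediate(2)[OF K F subfieldE(1)[OF N] KF FN fin] s(1)] by blast
    have tK: "\<forall>c\<in>K. t c = c" using t(2) s(3) KF by auto
    note ht = hom_facts[OF N t(1)]
    note Ns = subringE[OF subfieldE(1)[OF N]]
    have tA: "t a \<in> N" if "a \<in> set As" for a
    proof -
      obtain u where u: "u \<in> set Us" "a \<in> carrier L" "eval (Irr K u) a = \<zero>" using \<open>a \<in> set As\<close> by (auto simp: As A_def)
      have aN: "a \<in> N" using AN that by auto
      have "eval (Irr K u) (t a) = \<zero>" by (rule hom_root[OF N KN K t(1) tK aN Upoly(3)[OF u(1)] u(3)])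
      then have "t a \<in> set As" using u(1) ht(1)[OF aN] by (auto simp: As A_def)
      then show ?thesis using AN by auto
    qed
    \<comment> \<open>That t maps N into itself is checked on generators: Z is a subring that
      contains K and the adjoined roots.\<close>
    define Z where "Z = {z \<in> N. t z \<in> N}"
    have "subring Z L"
    proof (rule subringI)
      show "Z \<subseteq> carrier L" using Nc by (auto simp: Z_def)
      show "\<one> \<in> Z" using Ns(3) ht(2) by (simp add: Z_def)
      show "\<ominus> h \<in> Z" if "h \<in> Z" for h using that Ns(5) ht(6) by (simp add: Z_def)
      show "h1 \<otimes> h2 \<in> Z" if "h1 \<in> Z" "h2 \<in> Z" for h1 h2 using that Ns(6) ht(4) by (simp add: Z_def)
      show "h1 \<oplus> h2 \<in> Z" if "h1 \<in> Z" "h2 \<in> Z" for h1 h2 using that Ns(7) ht(5) by (simp add: Z_def)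
    qed
    moreover have "K \<subseteq> Z" using KN tK by (auto simp: Z_def)
    moreover have "set As \<subseteq> Z" using AN tA by (auto simp: Z_def)
    ultimately have "N \<subseteq> Z" unfolding N_def by (rule finite_extension_subring_incl)
    then have "t x \<in> N" using x by (auto simp: Z_def)
    then show "y \<in> N" using t(2) xF s(2) by simp
  qed
  moreover from this have "separable_extension K N"
    using separable_generated[OF K Ac sepA] unfolding separable_extension_iff N_def by blast
  ultimately have "galois_extension K N"
    using normal_iff_root_closed[OF K N KN] fin by (simp add: galois_extension_def)
  then show ?thesis using N EN by blast
qed

text \<open>An intersection is informative only over a nonempty family, whence the preceding lemma.
  Normality passes to it because it demands the same roots of every member.\<close>

lemma galois_closure_props:
  assumes K: "subfield K L" and E: "subfield E L" "K \<subseteq> E" "finite_dimension K E" "separable_extension K E"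
  shows "subfield (galois_closure K E) L" "E \<subseteq> galois_closure K E"
    "finite_dimension K (galois_closure K E)" "root_closed K (galois_closure K E)"
    "separable_extension K (galois_closure K E)"
proof -
  define \<N> where "\<N> = {N. subfield N L \<and> E \<subseteq> N \<and> galois_extension K N}"
  define C where "C = galois_closure K E"
  have C: "C = \<Inter>\<N>" by (simp add: C_def \<N>_def galois_closure_def)
  obtain N0 where N0: "N0 \<in> \<N>" using galois_extension_exists[OF assms] by (auto simp: \<N>_def)
  have sub: "\<And>N. N \<in> \<N> \<Longrightarrow> subfield N L" by (simp add: \<N>_def)
  have KN: "K \<subseteq> N" if "N \<in> \<N>" for N using that E(2) by (auto simp: \<N>_def)
  have rc: "root_closed K N" if "N \<in> \<N>" for N
    using that normal_iff_root_closed[OF K sub[OF that] KN[OF that]] by (simp add: \<N>_def galois_extension_def)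
  have CN0: "C \<subseteq> N0" using N0 C by auto
  show EC: "E \<subseteq> galois_closure K E" unfolding C_def[symmetric] C by (auto simp: \<N>_def)
  have sf: "subfield C L"
  proof (rule subfieldI')
    show "subring C L" unfolding C by (rule subring_Inter) (use sub subfieldE(1) N0 in auto)
    fix k assume k: "k \<in> C - {\<zero>}"
    show "inv k \<in> C" unfolding C
    proof
      fix N assume N: "N \<in> \<N>"
      then have "k \<in> N - {\<zero>}" using k C by auto
      then show "inv k \<in> N" using subfield_m_inv(1)[OF sub[OF N]] by auto
    qed
  qed
  then show "subfield (galois_closure K E) L" by (simp add: C_def)
  have fin0: "finite_dimension K N0" using N0 by (simp add: \<N>_def galois_extension_def)
  have KC: "K \<subseteq> C" using E(2) EC by (auto simp: C_def)
  have "finite_dimension K C"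
    by (rule finite_dimension_intermediate(1)[OF K sf subfieldE(1)[OF sub[OF N0]] KC CN0 fin0])
  then show "finite_dimension K (galois_closure K E)" by (simp add: C_def)
  have "root_closed K C" unfolding root_closed_def
  proof (intro ballI conjI impI)
    fix x assume x: "x \<in> C"
    then have "x \<in> N0" using CN0 by auto
    then show "(algebraic over K) x" using rc[OF N0] by (simp add: root_closed_def)
    fix y assume y: "y \<in> carrier L" "eval (Irr K x) y = \<zero>"
    show "y \<in> C" unfolding C
    proof
      fix N assume N: "N \<in> \<N>"
      then have "x \<in> N" using x C by auto
      then show "y \<in> N" using rc[OF N] y by (simp add: root_closed_def)
    qed
  qed
  then show "root_closed K (galois_closure K E)" by (simp add: C_def)
  have "separable_extension K N0" using N0 by (simp add: \<N>_def galois_extension_def)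
  then show "separable_extension K (galois_closure K E)"
    using CN0 unfolding separable_extension_iff by (auto simp: C_def)
qed

text \<open>The condition depends on \<tau> only through its restriction to E, an embedding of E
  over K, and every such embedding extends to every normal N. So any finite normal N containing E
  may replace the Galois closure.\<close>

lemma exceptional_iff:
  assumes K: "subfield K L" and E: "subfield E L" "K \<subseteq> E" "separable_extension K E"
    and N: "subfield N L" "E \<subseteq> N" "finite_dimension K N" "root_closed K N"
  shows "exceptional K E \<longleftrightarrow> totally_ramified K E \<and>
    (\<forall>\<tau>\<in>galois_group K N. (\<exists>x\<in>E. \<tau> x \<noteq> x) \<longrightarrow> \<not> totally_ramified K (compositum E (\<tau> ` E)))"
proof -
  have fE: "finite_dimension K E"
    by (rule finite_dimension_intermediate(1)[OF K E(1) subfieldE(1)[OF N(1)] E(2) N(2,3)])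
  define C where "C = galois_closure K E"
  note C = galois_closure_props[OF K E(1,2) fE E(3), folded C_def]
  have mem: "\<tau> \<in> galois_group K C - galois_group E C \<longleftrightarrow> \<tau> \<in> galois_group K C \<and> (\<exists>x\<in>E. \<tau> x \<noteq> x)" for \<tau>
    by (auto simp: galois_group_def)
  have transfer: "\<exists>\<eta>\<in>galois_group K N2. \<forall>x\<in>E. \<eta> x = \<tau> x"
    if t: "\<tau> \<in> galois_group K N1" and N1: "subfield N1 L" "E \<subseteq> N1"
      and N2: "subfield N2 L" "E \<subseteq> N2" "finite_dimension K N2" "root_closed K N2" for \<tau> N1 N2
  proof (rule hom_extends_galois[OF K E(1) N2(1) E(2) N2(2-4)])
    note T = galois_groupD[OF t subfieldE(3)[OF N1(1)]]
    show "\<tau> \<in> ring_hom (L\<lparr>carrier := E\<rparr>) L" using T(1) N1(2) by (auto simp: ring_hom_def Pi_def subset_iff)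
    show "\<forall>c\<in>K. \<tau> c = c" using T(5) by simp
  qed
  have img: "\<eta> ` E = \<tau> ` E" if "\<forall>x\<in>E. \<eta> x = \<tau> x" for \<eta> \<tau> :: "'a \<Rightarrow> 'a"
    using that by (auto simp: image_iff)
  have "(\<forall>\<tau>\<in>galois_group K C. (\<exists>x\<in>E. \<tau> x \<noteq> x) \<longrightarrow> \<not> totally_ramified K (compositum E (\<tau> ` E))) \<longleftrightarrow>
    (\<forall>\<tau>\<in>galois_group K N. (\<exists>x\<in>E. \<tau> x \<noteq> x) \<longrightarrow> \<not> totally_ramified K (compositum E (\<tau> ` E)))" (is "?P \<longleftrightarrow> ?Q")
  proof
    assume P: ?P
    show ?Q
    proof (intro ballI impI)
      fix \<tau> assume t: "\<tau> \<in> galois_group K N" "\<exists>x\<in>E. \<tau> x \<noteq> x"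
      obtain \<eta> where e: "\<eta> \<in> galois_group K C" "\<forall>x\<in>E. \<eta> x = \<tau> x" using transfer[OF t(1) N(1,2) C(1-4)] by blast
      have "\<exists>x\<in>E. \<eta> x \<noteq> x" using t(2) e(2) by auto
      then show "\<not> totally_ramified K (compositum E (\<tau> ` E))" using P e(1) img[OF e(2)] by auto
    qed
  next
    assume Q: ?Q
    show ?P
    proof (intro ballI impI)
      fix \<tau> assume t: "\<tau> \<in> galois_group K C" "\<exists>x\<in>E. \<tau> x \<noteq> x"
      obtain \<eta> where e: "\<eta> \<in> galois_group K N" "\<forall>x\<in>E. \<eta> x = \<tau> x" using transfer[OF t(1) C(1,2) N] by blast
      have "\<exists>x\<in>E. \<eta> x \<noteq> x" using t(2) e(2) by auto
      then show "\<not> totally_ramified K (compositum E (\<tau> ` E))" using Q e(1) img[OF e(2)] by auto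
    qed
  qed
  then show ?thesis unfolding exceptional_def C_def[symmetric] using mem by auto
qed

end

section \<open>Residue fields and the Frobenius map\<close>

context field begin

text \<open>The coefficients of \<open>(X + 1)\<^sup>n - X\<^sup>n\<close>.\<close>

primrec shift_coeffs :: "nat \<Rightarrow> 'a list" where
  "shift_coeffs 0 = []"
| "shift_coeffs (Suc n) = map2 (\<oplus>) (shift_coeffs n @ [\<zero>]) (\<one> # shift_coeffs n)"

lemma length_shift_coeffs [simp]: "length (shift_coeffs n) = n"
  by (induction n) auto

lemma set_shift_coeffs: "set (shift_coeffs n) \<subseteq> carrier R"
proof (induction n)
  case (Suc n)
  show ?case
  proof
    fix z assume "z \<in> set (shift_coeffs (Suc n))"
    then obtain a b where ab: "(a, b) \<in> set (zip (shift_coeffs n @ [\<zero>]) (\<one> # shift_coeffs n))" "z = a \<oplus> b" by auto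
    have "a \<in> carrier R" using set_zip_leftD[OF ab(1)] Suc by auto
    moreover have "b \<in> carrier R" using set_zip_rightD[OF ab(1)] Suc by auto
    ultimately show "z \<in> carrier R" using ab(2) by simp
  qed
qed simp

lemma eval_shift_coeffs:
  assumes x: "x \<in> carrier R"
  shows "(x \<oplus> \<one>) [^] n = x [^] n \<oplus> eval (shift_coeffs n) x"
proof (induction n)
  case (Suc n)
  define t where "t = x [^] n"
  define e where "e = eval (shift_coeffs n) x"
  have c: "t \<in> carrier R" "e \<in> carrier R" using x eval_in_carrier[OF set_shift_coeffs x] by (auto simp: t_def e_def)
  have "eval (shift_coeffs (Suc n)) x = eval (shift_coeffs n @ [\<zero>]) x \<oplus> eval (\<one> # shift_coeffs n) x"
    unfolding shift_coeffs.simps by (rule eval_map2_add) (use set_shift_coeffs x in auto)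
  moreover have "eval (shift_coeffs n @ [\<zero>]) x = e \<otimes> x"
    using eval_append_aux[OF set_shift_coeffs _ x, of \<zero> n] c x by (simp add: e_def)
  moreover have "eval (\<one> # shift_coeffs n) x = t \<oplus> e" using c by (simp add: e_def t_def)
  ultimately have "eval (shift_coeffs (Suc n)) x = e \<otimes> x \<oplus> (t \<oplus> e)" by simp
  moreover have "(x \<oplus> \<one>) [^] Suc n = (t \<oplus> e) \<otimes> (x \<oplus> \<one>)" using Suc by (simp add: t_def e_def)
  moreover have "(t \<oplus> e) \<otimes> (x \<oplus> \<one>) = t \<otimes> x \<oplus> (e \<otimes> x \<oplus> (t \<oplus> e))" using c x by algebra
  ultimately show ?case by (simp add: t_def)
qed (use x in simp)

text \<open>The polynomial \<open>(X + 1)\<^sup>q - X\<^sup>q - 1\<close> has degree less than \<open>q\<close>, but it vanishes on the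
  \<open>q\<close> elements of \<open>F\<close>.\<close>

lemma frobenius_one_add:
  assumes F: "F \<subseteq> carrier R" "card F = q" "1 \<le> q" "\<And>c. c \<in> F \<Longrightarrow> c [^] q = c" "\<And>c. c \<in> F \<Longrightarrow> c \<oplus> \<one> \<in> F"
    and x: "x \<in> carrier R"
  shows "(x \<oplus> \<one>) [^] q = x [^] q \<oplus> \<one>"
proof -
  have "shift_coeffs q \<noteq> []" using F(3) length_shift_coeffs[of q] by (metis list.size(3) not_one_le_zero)
  then obtain r c where rc: "shift_coeffs q = r @ [c]" by (metis rev_exhaust)
  have cc: "set r \<subseteq> carrier R" "c \<in> carrier R" using set_shift_coeffs[of q] rc by auto
  have len: "length (r @ [c \<ominus> \<one>]) = q" using length_shift_coeffs[of q] rc by simp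
  have ev: "eval (r @ [c \<ominus> \<one>]) y = (y \<oplus> \<one>) [^] q \<ominus> (y [^] q \<oplus> \<one>)" if y: "y \<in> carrier R" for y
  proof -
    define s where "s = eval r y"
    have sc: "s \<in> carrier R" using eval_in_carrier[OF cc(1) y] by (simp add: s_def)
    have 1: "eval (r @ [c \<ominus> \<one>]) y = s \<otimes> y \<oplus> (c \<ominus> \<one>)"
      unfolding s_def by (rule eval_append_aux[OF cc(1) _ y]) (use cc in simp)
    have 2: "(y \<oplus> \<one>) [^] q = y [^] q \<oplus> (s \<otimes> y \<oplus> c)"
      unfolding eval_shift_coeffs[OF y] rc eval_append_aux[OF cc y] s_def ..
    define t where "t = y [^] q"
    have "t \<in> carrier R" using y by (simp add: t_def)
    then show ?thesis unfolding 1 2 unfolding t_def[symmetric] unfolding a_minus_def using sc cc(2) y by algebra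
  qed
  have root: "\<forall>y\<in>F. y \<in> carrier R \<and> eval (r @ [c \<ominus> \<one>]) y = \<zero>"
  proof
    fix y assume y: "y \<in> F"
    then have yc: "y \<in> carrier R" using F(1) by auto
    have "(y \<oplus> \<one>) [^] q = y \<oplus> \<one>" "y [^] q = y" using F(4,5) y by auto
    then show "y \<in> carrier R \<and> eval (r @ [c \<ominus> \<one>]) y = \<zero>" using ev[OF yc] yc by simp
  qed
  have z: "d = \<zero>" if "d \<in> set (r @ [c \<ominus> \<one>])" for d
    by (rule coefficients_zero_if_many_roots[OF _ root _ that]) (use cc len F(2) in auto)
  have "eval ds x = \<zero>" if "\<forall>d\<in>set ds. d = \<zero>" for ds
    using that by (induction ds) (use x in auto)
  then have "eval (r @ [c \<ominus> \<one>]) x = \<zero>" using z by blast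
  then show ?thesis using ev[OF x] x by simp
qed

text \<open>Homogeneity: with z = x / y it becomes the case of z and 1.\<close>

lemma frobenius_add:
  assumes F: "F \<subseteq> carrier R" "card F = q" "1 \<le> q" "\<And>c. c \<in> F \<Longrightarrow> c [^] q = c" "\<And>c. c \<in> F \<Longrightarrow> c \<oplus> \<one> \<in> F"
    and x: "x \<in> carrier R" and y: "y \<in> carrier R"
  shows "(x \<oplus> y) [^] q = x [^] q \<oplus> y [^] q"
proof (cases "y = \<zero>")
  case True
  have "\<zero> [^] q = \<zero>" using F(3) by (simp add: nat_pow_zero)
  then show ?thesis using True x by simp
next
  case False
  then have iy: "inv y \<in> carrier R" "y \<otimes> inv y = \<one>" using y field_Units by auto
  define z where "z = x \<otimes> inv y"
  have zc: "z \<in> carrier R" using x iy by (simp add: z_def)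
  have "z \<otimes> y = x \<otimes> (y \<otimes> inv y)" unfolding z_def using x y iy(1) by algebra
  then have zy: "z \<otimes> y = x" using iy x by simp
  have "x \<oplus> y = (z \<oplus> \<one>) \<otimes> y" using zy zc y by (simp add: l_distr)
  then have "(x \<oplus> y) [^] q = (z [^] q \<oplus> \<one>) \<otimes> y [^] q"
    using frobenius_one_add[OF F zc] zc y by (simp add: nat_pow_distrib)
  also have "\<dots> = (z \<otimes> y) [^] q \<oplus> y [^] q" using zc y by (simp add: l_distr nat_pow_distrib)
  finally show ?thesis unfolding zy .
qed

text \<open>The q elements of F already account for all roots of X^q - X.\<close>

lemma frobenius_fixed:
  assumes F: "F \<subseteq> carrier R" "card F = q" "2 \<le> q" "\<And>c. c \<in> F \<Longrightarrow> c [^] q = c"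
    and x: "x \<in> carrier R" "x [^] q = x"
  shows "x \<in> F"
proof (rule ccontr)
  assume n: "x \<notin> F"
  \<comment> \<open>The q + 1 coefficients of X^q - X, leading one first; q \<ge> 2 keeps the
    entries 1 and -1 apart.\<close>
  define p where "p = monom \<one> (q - 2) @ [\<ominus> \<one>, \<zero>]"
  have len: "length p = q + 1" using F(3) by (simp add: p_def monom_def)
  have pc: "set p \<subseteq> carrier R" by (auto simp: p_def monom_def)
  have ev: "eval p y = y [^] q \<ominus> y" if y: "y \<in> carrier R" for y
  proof -
    have "eval p y = eval (monom \<one> (q - 2)) y \<otimes> y [^] length [\<ominus> \<one>, \<zero>] \<oplus> eval [\<ominus> \<one>, \<zero>] y"
      unfolding p_def by (rule eval_append) (use y in \<open>auto simp: monom_def\<close>)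
    also have "\<dots> = y [^] (q - 2) \<otimes> y [^] (2::nat) \<oplus> \<ominus> y"
      using eval_monom[of \<one> y] y by (simp add: numeral_2_eq_2 l_minus)
    also have "y [^] (q - 2) \<otimes> y [^] (2::nat) = y [^] q"
      using nat_pow_mult[OF y, of "q - 2" 2] unfolding le_add_diff_inverse2[OF F(3)] .
    finally show ?thesis by (simp add: a_minus_def)
  qed
  have "\<forall>y\<in>insert x F. y \<in> carrier R \<and> eval p y = \<zero>"
    using ev x F(1,4) by auto
  moreover have "finite F" using F(2,3) by (metis card.infinite not_numeral_le_zero)
  then have "length p \<le> card (insert x F)" using n F(2) len by simp
  moreover have "\<one> \<in> set p" by (simp add: p_def monom_def)
  ultimately have "\<one> = \<zero>" by (rule coefficients_zero_if_many_roots[OF pc])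
  then show False by simp
qed

end

section \<open>The residue field of a valued field\<close>

context valued_subfield begin

abbreviation O_ring :: "('a, 'b) ring_scheme" where "O_ring \<equiv> R\<lparr>carrier := B 0\<rparr>"

definition res_ring :: "'a set ring" where "res_ring = O_ring Quot (B 1)"

definition res :: "'a \<Rightarrow> 'a set" where "res x = B 1 +>\<^bsub>O_ring\<^esub> x"

lemma subring_B0: "subring (B 0) R"
  by (rule subringI) (use B_carrier B0_mult in auto)

lemma B10: "x \<in> B 1 \<Longrightarrow> x \<in> B 0" by (rule B_mono[of 0 1]) simp_all

lemma cring_O: "cring O_ring"
  using subcring_iff[of "B 0"] subcringI'[OF subring_B0] B_carrier by auto

lemma ideal_B1: "ideal (B 1) O_ring"
proof -
  interpret O: cring O_ring by (rule cring_O)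
  show ?thesis
  proof (rule idealI[OF O.ring_axioms])
    show "subgroup (B 1) (add_monoid O_ring)"
    proof (rule group.subgroupI[OF O.a_group])
      show "B 1 \<subseteq> carrier (add_monoid O_ring)" using B10 by auto
      show "B 1 \<noteq> {}" using B_zero by blast
      show "inv\<^bsub>add_monoid O_ring\<^esub> a \<in> B 1" if "a \<in> B 1" for a
        using a_inv_subring[OF subring_B0 B10[OF that]] B_uminus[OF that] by (simp add: a_inv_def)
      show "a \<otimes>\<^bsub>add_monoid O_ring\<^esub> b \<in> B 1" if "a \<in> B 1" "b \<in> B 1" for a b
        using B_add[OF that] by simp
    qed
    show "x \<otimes>\<^bsub>O_ring\<^esub> a \<in> B 1" if "a \<in> B 1" "x \<in> carrier O_ring" for a x using B0_mult(1)[of x a 1] that by simp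
    show "a \<otimes>\<^bsub>O_ring\<^esub> x \<in> B 1" if "a \<in> B 1" "x \<in> carrier O_ring" for a x using B0_mult(2)[of a 1 x] that by simp
  qed
qed

lemma res_hom: "ring_hom_ring O_ring res_ring res"
  unfolding res_ring_def res_def by (rule ideal.rcos_ring_hom_ring[OF ideal_B1])

lemma res_carrier: "carrier res_ring = res ` B 0"
  by (auto simp: res_ring_def res_def FactRing_def A_RCOSETS_def RCOSETS_def a_r_coset_def)

lemma res_zero_iff: assumes "x \<in> B 0" shows "res x = \<zero>\<^bsub>res_ring\<^esub> \<longleftrightarrow> x \<in> B 1"
proof -
  interpret I: ideal "B 1" O_ring by (rule ideal_B1)
  have z: "\<zero>\<^bsub>res_ring\<^esub> = B 1" by (simp add: res_ring_def FactRing_def)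
  show ?thesis unfolding z res_def using I.a_rcos_const I.rcos_const_imp_mem assms by auto
qed

lemma res_facts:
  "x \<in> B 0 \<Longrightarrow> res x \<in> carrier res_ring" "res \<one> = \<one>\<^bsub>res_ring\<^esub>" "res \<zero> = \<zero>\<^bsub>res_ring\<^esub>"
  "x \<in> B 0 \<Longrightarrow> y \<in> B 0 \<Longrightarrow> res (x \<oplus> y) = res x \<oplus>\<^bsub>res_ring\<^esub> res y"
  "x \<in> B 0 \<Longrightarrow> y \<in> B 0 \<Longrightarrow> res (x \<otimes> y) = res x \<otimes>\<^bsub>res_ring\<^esub> res y"
proof -
  interpret H: ring_hom_ring O_ring res_ring res by (rule res_hom)
  show "x \<in> B 0 \<Longrightarrow> res x \<in> carrier res_ring" using H.hom_closed by simp
  show "res \<one> = \<one>\<^bsub>res_ring\<^esub>" using H.hom_one by simp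
  show "res \<zero> = \<zero>\<^bsub>res_ring\<^esub>" using H.hom_zero by simp
  show "x \<in> B 0 \<Longrightarrow> y \<in> B 0 \<Longrightarrow> res (x \<oplus> y) = res x \<oplus>\<^bsub>res_ring\<^esub> res y" using H.hom_add by simp
  show "x \<in> B 0 \<Longrightarrow> y \<in> B 0 \<Longrightarrow> res (x \<otimes> y) = res x \<otimes>\<^bsub>res_ring\<^esub> res y" using H.hom_mult by simp
qed

lemma res_pow: "x \<in> B 0 \<Longrightarrow> res (x [^] (n::nat)) = res x [^]\<^bsub>res_ring\<^esub> n"
  by (induction n) (simp_all add: res_facts B_pow)

lemma res_eq_iff: assumes "x \<in> B 0" "y \<in> B 0" shows "res x = res y \<longleftrightarrow> x \<ominus> y \<in> B 1"
proof -
  interpret H: ring_hom_ring O_ring res_ring res by (rule res_hom)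
  have c: "x \<in> carrier R" "y \<in> carrier R" using assms B_carrier by auto
  have m: "x \<ominus> y \<in> B 0" using assms by auto
  have e: "x = (x \<ominus> y) \<oplus> y" using c unfolding a_minus_def by algebra
  have "res x = res (x \<ominus> y) \<oplus>\<^bsub>res_ring\<^esub> res y" using res_facts(4)[OF m assms(2)] e by simp
  then have "res x = res y \<longleftrightarrow> res (x \<ominus> y) = \<zero>\<^bsub>res_ring\<^esub>"
    using res_facts(1)[OF m] res_facts(1)[OF assms(2)] by simp
  then show ?thesis using res_zero_iff[OF m] by simp
qed

lemma unit_inv: assumes "x \<in> B 0" "x \<notin> B 1" shows "inv x \<in> B 0" "x \<noteq> \<zero>"
proof -
  have x: "x \<in> N" "x \<noteq> \<zero>" "w x = 0" using assms by (auto simp: B_def)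
  then show "inv x \<in> B 0" "x \<noteq> \<zero>" using N_inv[OF x(1,2)] w_inv[OF x(1,2)] by (auto simp: B_def)
qed

lemma B1_prime: assumes "x \<in> B 0" "y \<in> B 0" "x \<otimes> y \<in> B 1" shows "x \<in> B 1 \<or> y \<in> B 1"
proof (rule ccontr)
  assume n: "\<not> ?thesis"
  then have x: "inv x \<in> B 0" "x \<noteq> \<zero>" using unit_inv assms(1) by auto
  have c: "x \<in> carrier R" "y \<in> carrier R" "inv x \<in> carrier R" "inv x \<otimes> x = \<one>"
    using assms x B_carrier N_inv[OF B_N[OF assms(1)] x(2)] by auto
  have "inv x \<otimes> (x \<otimes> y) = (inv x \<otimes> x) \<otimes> y" by (rule m_assoc[symmetric]) (use c in auto)
  then have "y = inv x \<otimes> (x \<otimes> y)" using c by simp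
  then have "y \<in> B 1" using B0_mult(1)[OF x(1) assms(3)] by simp
  then show False using n by simp
qed

lemma res_field: "field res_ring"
proof -
  interpret Q: cring res_ring unfolding res_ring_def by (rule ideal.quotient_is_cring[OF ideal_B1 cring_O])
  show ?thesis
  proof (rule Q.cring_fieldI2)
    show "\<zero>\<^bsub>res_ring\<^esub> \<noteq> \<one>\<^bsub>res_ring\<^esub>" using res_zero_iff[OF B_one] res_facts(2) one_notin_B1 by simp
    fix a assume "a \<in> carrier res_ring" "a \<noteq> \<zero>\<^bsub>res_ring\<^esub>"
    moreover from this obtain x where "x \<in> B 0" "a = res x" unfolding res_carrier by blast
    ultimately have x: "x \<in> B 0" "a = res x" "x \<notin> B 1" using res_zero_iff by simp_all
    note ux = unit_inv[OF x(1,3)]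
    have "x \<otimes> inv x = \<one>" using N_inv(3)[OF B_N[OF x(1)] ux(2)] .
    then have "a \<otimes>\<^bsub>res_ring\<^esub> res (inv x) = \<one>\<^bsub>res_ring\<^esub>" using res_facts(2,5) x ux by metis
    then show "\<exists>b\<in>carrier res_ring. a \<otimes>\<^bsub>res_ring\<^esub> b = \<one>\<^bsub>res_ring\<^esub>" using res_facts(1)[OF ux(1)] by blast
  qed
qed

end

section \<open>The residue field F of K inside that of N\<close>

locale residue_base = local_subfield R N w for R (structure) and N w +
  fixes K :: "'a set"
  assumes subfieldK: "subfield K R" and KN: "K \<subseteq> N"
begin

definition q :: nat where "q = card (res ` (K \<inter> B 0))"

lemma K_closed: "x \<in> K \<Longrightarrow> y \<in> K \<Longrightarrow> x \<otimes> y \<in> K" "x \<in> K \<Longrightarrow> y \<in> K \<Longrightarrow> x \<oplus> y \<in> K"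
  "\<one> \<in> K" "\<zero> \<in> K" "x \<in> K \<Longrightarrow> x \<noteq> \<zero> \<Longrightarrow> inv x \<in> K"
  using subringE[OF subfieldE(1)[OF subfieldK]] subfield_m_inv(1)[OF subfieldK] by auto

lemma finite_res: "finite (carrier res_ring)"
proof -
  obtain T where T: "finite T" "T \<subseteq> B 0" "\<forall>x\<in>B 0. \<exists>t\<in>T. x \<ominus> t \<in> B 1" using finite_reps by blast
  have "res ` B 0 \<subseteq> res ` T"
  proof
    fix z assume "z \<in> res ` B 0"
    then obtain x where x: "x \<in> B 0" "z = res x" by blast
    then obtain t where t: "t \<in> T" "x \<ominus> t \<in> B 1" using T by blast
    then have "res x = res t" using res_eq_iff[OF x(1)] T(2) by auto
    then show "z \<in> res ` T" using t x by blast
  qed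
  then show ?thesis unfolding res_carrier using T(1) finite_surj by blast
qed

sublocale k: field res_ring by (rule res_field)

definition F where "F = res ` (K \<inter> B 0)"

lemma F_carrier: "F \<subseteq> carrier res_ring" using res_facts(1) by (auto simp: F_def)

lemma F_finite: "finite F" by (rule finite_subset[OF F_carrier finite_res])

lemma F_zero_one: "\<zero>\<^bsub>res_ring\<^esub> \<in> F" "\<one>\<^bsub>res_ring\<^esub> \<in> F"
  unfolding F_def using res_facts(2,3) K_closed(3,4) B_one B_zero by (metis IntI imageI)+

lemma F_add: "a \<in> F \<Longrightarrow> b \<in> F \<Longrightarrow> a \<oplus>\<^bsub>res_ring\<^esub> b \<in> F"
proof -
  assume "a \<in> F" "b \<in> F"
  then obtain x y where xy: "x \<in> K" "x \<in> B 0" "y \<in> K" "y \<in> B 0" "a = res x" "b = res y" by (auto simp: F_def)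
  then have "a \<oplus>\<^bsub>res_ring\<^esub> b = res (x \<oplus> y)" using res_facts(4) by simp
  then show ?thesis using xy K_closed(2) B_add unfolding F_def by blast
qed

lemma q_ge_2: "2 \<le> q"
proof -
  have "card {\<zero>\<^bsub>res_ring\<^esub>, \<one>\<^bsub>res_ring\<^esub>} \<le> card F" by (rule card_mono[OF F_finite]) (use F_zero_one in auto)
  then show ?thesis by (simp add: q_def F_def)
qed

text \<open>Lagrange's theorem in the group of nonzero elements of F, which has order q - 1.\<close>

lemma F_pow: assumes "a \<in> F" shows "a [^]\<^bsub>res_ring\<^esub> q = a"
proof (cases "a = \<zero>\<^bsub>res_ring\<^esub>")
  case True
  then show ?thesis using q_ge_2 by (simp add: k.nat_pow_zero)
next
  case False
  define U where "U = F - {\<zero>\<^bsub>res_ring\<^esub>}"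
  let ?G = "Multiplicative_Group.mult_of res_ring"
  have sg: "subgroup U ?G"
  proof (rule group.subgroupI[OF k.field_mult_group])
    show "U \<subseteq> carrier ?G" using F_carrier by (auto simp: U_def)
    show "U \<noteq> {}" using F_zero_one(2) by (auto simp: U_def)
    fix b assume b: "b \<in> U"
    then obtain x where x: "x \<in> K" "x \<in> B 0" "b = res x" by (auto simp: U_def F_def)
    have xn: "x \<notin> B 1" using b x res_zero_iff by (auto simp: U_def)
    note ux = unit_inv[OF x(2) xn]
    have "res x \<otimes>\<^bsub>res_ring\<^esub> res (inv x) = \<one>\<^bsub>res_ring\<^esub>"
      using res_facts(2,5) x(2) ux N_inv(3)[OF B_N[OF x(2)] ux(2)] by metis
    then have inv: "inv\<^bsub>res_ring\<^esub> b = res (inv x)" using k.comm_inv_char res_facts(1) x ux by simp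
    have "b \<in> carrier ?G" using b F_carrier by (auto simp: U_def)
    then have e: "inv\<^bsub>?G\<^esub> b = res (inv x)" using k.m_inv_mult_of inv by simp
    have "inv x \<notin> B 1"
    proof
      assume "inv x \<in> B 1"
      then have "x \<otimes> inv x \<in> B 1" using B0_mult(1)[OF x(2)] by simp
      then show False using N_inv(3)[OF B_N[OF x(2)] ux(2)] one_notin_B1 by simp
    qed
    then show "inv\<^bsub>?G\<^esub> b \<in> U" unfolding e U_def F_def
      using res_zero_iff[OF ux(1)] ux K_closed(5)[OF x(1) ux(2)] by auto
    fix c assume c: "c \<in> U"
    then obtain y where y: "y \<in> K" "y \<in> B 0" "c = res y" by (auto simp: U_def F_def)
    have yn: "y \<notin> B 1" using c y res_zero_iff by (auto simp: U_def)
    have xy: "x \<otimes> y \<in> B 0" "x \<otimes> y \<notin> B 1" using B0_mult(1)[OF x(2) y(2)] B1_prime[OF x(2) y(2)] xn yn by auto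
    have "b \<otimes>\<^bsub>res_ring\<^esub> c = res (x \<otimes> y)" using res_facts(5) x y by simp
    then show "b \<otimes>\<^bsub>?G\<^esub> c \<in> U" using xy res_zero_iff[OF xy(1)] K_closed(1)[OF x(1) y(1)] by (auto simp: U_def F_def)
  qed
  have grp: "group (?G\<lparr>carrier := U\<rparr>)" by (rule subgroup.subgroup_is_group[OF sg k.field_mult_group])
  have "a [^]\<^bsub>?G\<lparr>carrier := U\<rparr>\<^esub> order (?G\<lparr>carrier := U\<rparr>) = \<one>\<^bsub>?G\<lparr>carrier := U\<rparr>\<^esub>"
    by (rule group.pow_order_eq_1[OF grp]) (use assms False in \<open>simp add: U_def\<close>)
  moreover have "a [^]\<^bsub>?G\<lparr>carrier := U\<rparr>\<^esub> (n::nat) = a [^]\<^bsub>res_ring\<^esub> n" for n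
    using monoid.nat_pow_consistent[OF group.is_monoid[OF k.field_mult_group], of a n U]
      Multiplicative_Group.nat_pow_mult_of[of res_ring] by simp
  moreover have "order (?G\<lparr>carrier := U\<rparr>) = q - 1"
    using F_zero_one(1) F_finite by (simp add: order_def U_def q_def F_def)
  ultimately have p: "a [^]\<^bsub>res_ring\<^esub> (q - 1) = \<one>\<^bsub>res_ring\<^esub>" by simp
  have ac: "a \<in> carrier res_ring" using assms F_carrier by auto
  have "a [^]\<^bsub>res_ring\<^esub> q = a [^]\<^bsub>res_ring\<^esub> (q - 1) \<otimes>\<^bsub>res_ring\<^esub> a"
    using q_ge_2 k.nat_pow_Suc[of a "q - 1"] by simp
  then show ?thesis using p ac by simp
qed

lemma card_F: "card F = q" by (simp add: q_def F_def)

lemma pow_q_add: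
  assumes "x \<in> B 0" "y \<in> B 0"
  shows "(x \<oplus> y) [^] q \<ominus> (x [^] q \<oplus> y [^] q) \<in> B 1"
proof -
  have "res ((x \<oplus> y) [^] q) = res (x [^] q \<oplus> y [^] q)"
    using k.frobenius_add[OF F_carrier card_F _ F_pow F_add[OF _ F_zero_one(2)], of "res x" "res y"] q_ge_2 assms
    by (simp add: res_pow res_facts B_pow B_add)
  moreover have "(x \<oplus> y) [^] q \<in> B 0" "x [^] q \<oplus> y [^] q \<in> B 0" using assms B_pow B_add by auto
  ultimately show ?thesis by (simp only: res_eq_iff)
qed

lemma pow_q_base: assumes "c \<in> K" "c \<in> B 0" shows "c [^] q \<ominus> c \<in> B 1"
proof -
  have "res (c [^] q) = res c" using F_pow[of "res c"] assms by (simp add: res_pow F_def)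
  then show ?thesis by (simp only: res_eq_iff[OF B_pow[OF assms(2)] assms(2)])
qed

lemma pow_q_fixed:
  assumes "x \<in> B 0" "x [^] q \<ominus> x \<in> B 1"
  shows "\<exists>y\<in>K. x \<ominus> y \<in> B 1"
proof -
  have "res (x [^] q) = res x" using assms(2) by (simp only: res_eq_iff[OF B_pow[OF assms(1)] assms(1)])
  then have "res x [^]\<^bsub>res_ring\<^esub> q = res x" using res_pow assms by simp
  from k.frobenius_fixed[OF F_carrier card_F q_ge_2 _ res_facts(1)[OF assms(1)] this]
  have "res x \<in> F" using F_pow by blast
  then obtain y where y: "y \<in> K" "y \<in> B 0" "res x = res y" unfolding F_def by blast
  then have "x \<ominus> y \<in> B 1" by (simp only: res_eq_iff[OF assms(1) y(2)])
  then show ?thesis using y(1) by blast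
qed

text \<open>The multiplicative group of the finite residue field of N is cyclic, and a lifts a
  generator. The action of an automorphism on the residue field is then determined by the image of
  a.\<close>

lemma residue_generator:
  "\<exists>a\<in>B 0. \<forall>x\<in>B 0. x \<in> B 1 \<or> (\<exists>i::nat. x \<ominus> a [^] i \<in> B 1)"
proof -
  obtain g where g: "g \<in> carrier (Multiplicative_Group.mult_of res_ring)" "carrier (Multiplicative_Group.mult_of res_ring) = {g [^]\<^bsub>res_ring\<^esub> i | i::nat. i \<in> UNIV}"
    using k.finite_field_mult_group_has_gen[OF finite_res] by blast
  then obtain a where a: "a \<in> B 0" "g = res a" using res_carrier by auto
  have "x \<in> B 1 \<or> (\<exists>i::nat. x \<ominus> a [^] i \<in> B 1)" if x: "x \<in> B 0" for x
  proof (cases "x \<in> B 1")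
    case False
    then have "res x \<in> carrier (Multiplicative_Group.mult_of res_ring)" using res_facts(1)[OF x] res_zero_iff[OF x] by simp
    then obtain i :: nat where "res x = g [^]\<^bsub>res_ring\<^esub> i" using g(2) by auto
    then have "res x = res (a [^] i)" using a res_pow by simp
    then show ?thesis using res_eq_iff[OF x B_pow[OF a(1)]] by auto
  qed simp
  then show ?thesis using a(1) by blast
qed

end

section \<open>Frobenius elements\<close>

text \<open>The fibres of \<open>(i, h) \<mapsto> i \<phi> h i\<^sup>-\<^sup>1\<close> on \<open>I \<times> (I \<inter> H)\<close> have at most
  \<open>\<bar>I \<inter> H\<bar>\<close> elements by the hypothesis \<open>exc\<close>, so the image has at least \<open>\<bar>I\<bar> \<ge> \<bar>\<Phi>\<bar>\<close>
  elements.\<close>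

lemma (in group) conjugates_cover:
  assumes fin: "finite (carrier G)" and I: "subgroup I G" and H: "subgroup H G"
    and \<Phi>: "\<Phi> \<subseteq> carrier G" and \<phi>: "\<phi> \<in> \<Phi>" "\<phi> \<in> H"
    and diff: "\<And>g. g \<in> \<Phi> \<Longrightarrow> inv \<phi> \<otimes> g \<in> I"
    and conj: "\<And>i h. i \<in> I \<Longrightarrow> h \<in> I \<Longrightarrow> h \<in> H \<Longrightarrow> i \<otimes> (\<phi> \<otimes> h) \<otimes> inv i \<in> \<Phi>"
    and exc: "\<And>x h. x \<in> carrier G \<Longrightarrow> h \<in> \<Phi> \<Longrightarrow> h \<in> H \<Longrightarrow> inv x \<otimes> h \<otimes> x \<in> H \<Longrightarrow> x \<in> H"
    and g: "g \<in> \<Phi>"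
  shows "\<exists>i\<in>I. inv i \<otimes> g \<otimes> i \<in> H"
proof -
  note Ic = subgroup.mem_carrier[OF I]
  have \<phi>c: "\<phi> \<in> carrier G" using \<phi> \<Phi> by auto
  \<comment> \<open>In the application I is the inertia group, H the group of automorphisms that fix
    the field E, and \<Phi> the set of Frobenius elements, contained in a coset of I.\<close>
  define W where "W = I \<inter> H"
  define c where "c = (\<lambda>(i, h). i \<otimes> (\<phi> \<otimes> h) \<otimes> inv i)"
  have finI: "finite I" and finW: "finite W" and fin\<Phi>: "finite \<Phi>"
    using fin finite_subset[OF subgroup.subset[OF I]] finite_subset[OF \<Phi>] by (auto simp: W_def)
  have unconj: "inv i \<otimes> c (i, h) \<otimes> i = \<phi> \<otimes> h" if "i \<in> carrier G" "h \<in> carrier G" for i h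
    using that \<phi>c by (simp add: c_def m_assoc) (simp add: m_assoc[symmetric])
  have sub: "c ` (I \<times> W) \<subseteq> \<Phi>" using conj by (auto simp: c_def W_def)
  have fibre: "card {p \<in> I \<times> W. c p = y} \<le> card W" if y: "y \<in> c ` (I \<times> W)" for y
  proof -
    obtain p where p: "y = c p" "p \<in> I \<times> W" by (rule imageE[OF y])
    obtain j k where "p = (j, k)" by (cases p)
    with p have jk: "j \<in> I" "k \<in> W" "y = c (j, k)" by simp_all
    have jc: "j \<in> carrier G" "k \<in> carrier G" using jk Ic by (auto simp: W_def)
    have yc: "y \<in> carrier G" using y sub \<Phi> by auto
    have jH: "inv j \<otimes> y \<otimes> j \<in> H"
      unfolding jk(3) unconj[OF jc] using \<phi>(2) jk(2) subgroup.m_closed[OF H] by (simp add: W_def)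
    have j\<Phi>: "inv j \<otimes> y \<otimes> j \<in> \<Phi>"
      unfolding jk(3) unconj[OF jc]
      using conj[of \<one> k] jk(2) subgroup.one_closed[OF I] \<phi>c jc by (simp add: W_def)
    \<comment> \<open>Relative to the point (j, k) of the fibre, a point (i, h) is determined by
      j^-1 i. Conjugation by this element carries one member of H \<inter> \<Phi> into H, so
      \<open>exc\<close> places it in H.\<close>
    have "inj_on (\<lambda>(i, h). inv j \<otimes> i) {p \<in> I \<times> W. c p = y}"
    proof (rule inj_onI)
      fix p p' assume pp: "p \<in> {p \<in> I \<times> W. c p = y}" "p' \<in> {p \<in> I \<times> W. c p = y}"
        "(\<lambda>(i, h). inv j \<otimes> i) p = (\<lambda>(i, h). inv j \<otimes> i) p'"
      obtain i h where p: "p = (i, h)" by (cases p)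
      obtain i' h' where p': "p' = (i', h')" by (cases p')
      have a: "i \<in> I" "h \<in> W" "c (i, h) = y" "i' \<in> I" "h' \<in> W" "c (i', h') = c (i, h)" "inv j \<otimes> i = inv j \<otimes> i'"
        using pp by (simp_all add: p p')
      have ac: "i \<in> carrier G" "i' \<in> carrier G" "h \<in> carrier G" "h' \<in> carrier G" using a Ic by (auto simp: W_def)
      have ii: "i = i'" using a(7) ac jc by simp
      have "\<phi> \<otimes> h = \<phi> \<otimes> h'" using unconj[OF ac(1,3)] unconj[OF ac(2,4)] a(6) ii by simp
      then show "p = p'" using ii ac \<phi>c by (simp add: p p')
    qed
    moreover have "(\<lambda>(i, h). inv j \<otimes> i) ` {p \<in> I \<times> W. c p = y} \<subseteq> W"
    proof
      fix z assume "z \<in> (\<lambda>(i, h). inv j \<otimes> i) ` {p \<in> I \<times> W. c p = y}"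
      then obtain p where p: "z = (\<lambda>(i, h). inv j \<otimes> i) p" "p \<in> {p \<in> I \<times> W. c p = y}" by (rule imageE)
      obtain i h where "p = (i, h)" by (cases p)
      with p have z: "z = inv j \<otimes> i" and a: "i \<in> I" "h \<in> W" "y = c (i, h)" by simp_all
      have ac: "i \<in> carrier G" "h \<in> carrier G" using a Ic by (auto simp: W_def)
      define x where "x = inv j \<otimes> i"
      have xc: "x \<in> carrier G" using ac jc by (simp add: x_def)
      have ij: "j \<otimes> x = i" using ac jc by (simp add: x_def m_assoc[symmetric])
      have "inv x \<otimes> (inv j \<otimes> y \<otimes> j) \<otimes> x = inv (j \<otimes> x) \<otimes> y \<otimes> (j \<otimes> x)"
        using jc xc yc by (simp add: inv_mult_group m_assoc)
      also have "\<dots> = \<phi> \<otimes> h" unfolding ij a(3) by (rule unconj[OF ac])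
      also have "\<dots> \<in> H" using \<phi>(2) a(2) subgroup.m_closed[OF H] by (simp add: W_def)
      finally have "x \<in> H" by (rule exc[OF xc j\<Phi> jH])
      moreover have "x \<in> I" using a jk subgroup.m_closed[OF I] subgroup.m_inv_closed[OF I] by (simp add: x_def)
      ultimately show "z \<in> W" by (simp add: z W_def x_def)
    qed
    ultimately show ?thesis by (rule card_inj_on_le[OF _ _ finW])
  qed
  have cover: "I \<times> W = (\<Union>y\<in>c ` (I \<times> W). {p \<in> I \<times> W. c p = y})" by auto
  have finc: "finite (c ` (I \<times> W))" using finI finW by simp
  have "card (I \<times> W) \<le> (\<Sum>y\<in>c ` (I \<times> W). card {p \<in> I \<times> W. c p = y})"
    by (subst cover) (rule card_UN_le[OF finc])
  also have "\<dots> \<le> (\<Sum>y\<in>c ` (I \<times> W). card W)" by (rule sum_mono) (rule fibre)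
  finally have "card I * card W \<le> card (c ` (I \<times> W)) * card W" by (simp add: card_cartesian_product)
  moreover have "0 < card W"
    using finW subgroup.one_closed[OF I] subgroup.one_closed[OF H] by (auto simp: W_def card_gt_0_iff)
  ultimately have "card I \<le> card (c ` (I \<times> W))" by simp
  moreover have "card \<Phi> \<le> card I"
  proof (rule card_inj_on_le[OF _ _ finI])
    show "inj_on (\<lambda>g. inv \<phi> \<otimes> g) \<Phi>" using \<Phi> \<phi>c by (auto simp: inj_on_def subset_iff)
    show "(\<lambda>g. inv \<phi> \<otimes> g) ` \<Phi> \<subseteq> I" using diff by auto
  qed
  ultimately have "c ` (I \<times> W) = \<Phi>" using sub fin\<Phi> by (meson card_seteq le_trans)
  then obtain i h where ih: "i \<in> I" "h \<in> W" "g = c (i, h)" using g by auto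
  have "inv i \<otimes> g \<otimes> i = \<phi> \<otimes> h" unfolding ih(3) by (rule unconj) (use ih Ic in \<open>auto simp: W_def\<close>)
  also have "\<dots> \<in> H" using \<phi>(2) ih(2) subgroup.m_closed[OF H] by (simp add: W_def)
  finally show ?thesis using ih(1) by blast
qed

section \<open>The Galois group, and fixed points on a compositum\<close>

context algebraically_closed begin

definition galois_grp :: "'a set \<Rightarrow> 'a set \<Rightarrow> ('a \<Rightarrow> 'a) monoid"
  where "galois_grp K N = \<lparr>carrier = galois_group K N, monoid.mult = compose N, one = (\<lambda>x\<in>N. x)\<rparr>"

lemma galois_one:
  assumes "subfield N L" "K \<subseteq> N" "subfield K L" "root_closed K N"
  shows "(\<lambda>x\<in>N. x) \<in> galois_group K N"
  by (rule galois_groupI[OF assms]) (use subfieldE(3)[OF assms(1)] in \<open>auto intro!: ring_hom_memI\<close>)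

lemma group_galois_grp:
  assumes N: "subfield N L" "K \<subseteq> N" "subfield K L" "root_closed K N"
  shows "group (galois_grp K N)"
proof (rule groupI)
  have Nc: "N \<subseteq> carrier L" by (rule subfieldE(3)[OF N(1)])
  show "x \<otimes>\<^bsub>galois_grp K N\<^esub> y \<in> carrier (galois_grp K N)"
    if "x \<in> carrier (galois_grp K N)" "y \<in> carrier (galois_grp K N)" for x y
    using that galois_compose[OF N] by (simp add: galois_grp_def)
  show "\<one>\<^bsub>galois_grp K N\<^esub> \<in> carrier (galois_grp K N)" using galois_one[OF N] by (simp add: galois_grp_def)
  show "x \<otimes>\<^bsub>galois_grp K N\<^esub> y \<otimes>\<^bsub>galois_grp K N\<^esub> z = x \<otimes>\<^bsub>galois_grp K N\<^esub> (y \<otimes>\<^bsub>galois_grp K N\<^esub> z)"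
    if "x \<in> carrier (galois_grp K N)" "y \<in> carrier (galois_grp K N)" "z \<in> carrier (galois_grp K N)" for x y z
  proof -
    have "z \<in> N \<rightarrow> N" using that(3) galois_groupD(6)[OF _ Nc] by (auto simp: galois_grp_def)
    from compose_assoc[OF this, of x y, symmetric] show ?thesis by (simp add: galois_grp_def)
  qed
  fix x assume "x \<in> carrier (galois_grp K N)"
  then have x: "x \<in> galois_group K N" by (simp add: galois_grp_def)
  note X = galois_groupD[OF x Nc]
  show "\<one>\<^bsub>galois_grp K N\<^esub> \<otimes>\<^bsub>galois_grp K N\<^esub> x = x"
    using Id_compose[of x N N] X(2,6) by (simp add: galois_grp_def)
  obtain r where r: "r \<in> galois_group K N" "\<forall>z\<in>N. r (x z) = z" using galois_inverse[OF N x] by blast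
  have "compose N r x = (\<lambda>x\<in>N. x)" using r(2) by (auto simp: compose_def)
  then show "\<exists>y\<in>carrier (galois_grp K N). y \<otimes>\<^bsub>galois_grp K N\<^esub> x = \<one>\<^bsub>galois_grp K N\<^esub>"
    using r(1) by (auto simp: galois_grp_def)
qed

text \<open>An automorphism is determined by the images of finitely many generators, and each
  generator has a finite orbit.\<close>

lemma finite_galois_group:
  assumes N: "subfield N L" "K \<subseteq> N" "subfield K L" "root_closed K N" "finite_dimension K N"
  shows "finite (galois_group K N)"
proof -
  have Nc: "N \<subseteq> carrier L" by (rule subfieldE(3)[OF N(1)])
  note Ns = subringE[OF subfieldE(1)[OF N(1)]]
  obtain Us where Us: "set Us \<subseteq> N" "finite_extension K Us = N"
    by (rule finite_dimension_generators[OF N(3) subfieldE(1)[OF N(1)] N(2,5)])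
  define D where "D = (\<Union>u\<in>set Us. (\<lambda>\<tau>. \<tau> u) ` galois_group K N)"
  have "finite D" unfolding D_def
    using finite_conjugates(1)[OF N(3,1,2,4)] Us(1) by blast
  then have "finite {xs. set xs \<subseteq> D \<and> length xs = length Us}" by (rule finite_lists_length_eq)
  moreover have "(\<lambda>\<tau>. map \<tau> Us) ` galois_group K N \<subseteq> {xs. set xs \<subseteq> D \<and> length xs = length Us}"
    by (fastforce simp: D_def)
  ultimately have "finite ((\<lambda>\<tau>. map \<tau> Us) ` galois_group K N)" by (rule rev_finite_subset)
  moreover have "inj_on (\<lambda>\<tau>. map \<tau> Us) (galois_group K N)"
  proof (rule inj_onI)
    fix s t assume st: "s \<in> galois_group K N" "t \<in> galois_group K N" "map s Us = map t Us"
    note S = galois_groupD[OF st(1) Nc] and T = galois_groupD[OF st(2) Nc]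
    note hs = hom_facts[OF N(1) S(1)] and ht = hom_facts[OF N(1) T(1)]
    define Z where "Z = {z \<in> N. s z = t z}"
    have "subring Z L"
    proof (rule subringI)
      show "Z \<subseteq> carrier L" using Nc by (auto simp: Z_def)
      show "\<one> \<in> Z" using Ns(3) hs(2) ht(2) by (simp add: Z_def)
      show "\<ominus> h \<in> Z" if "h \<in> Z" for h using that Ns(5) hs(6) ht(6) by (simp add: Z_def)
      show "h1 \<otimes> h2 \<in> Z" if "h1 \<in> Z" "h2 \<in> Z" for h1 h2 using that Ns(6) hs(4) ht(4) by (simp add: Z_def)
      show "h1 \<oplus> h2 \<in> Z" if "h1 \<in> Z" "h2 \<in> Z" for h1 h2 using that Ns(7) hs(5) ht(5) by (simp add: Z_def)
    qed
    moreover have "K \<subseteq> Z" using N(2) S(5) T(5) by (auto simp: Z_def)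
    moreover have "set Us \<subseteq> Z" using Us(1) st(3) by (auto simp: Z_def)
    ultimately have "finite_extension K Us \<subseteq> Z" by (rule finite_extension_subring_incl)
    then have "\<And>z. z \<in> N \<Longrightarrow> s z = t z" using Us(2) by (auto simp: Z_def)
    then show "s = t" using S(2) T(2) by (intro extensionalityI) auto
  qed
  ultimately show ?thesis using finite_imageD by blast
qed

lemma compositum_facts:
  assumes "A \<subseteq> N" "A' \<subseteq> N" "subfield N L"
  shows "subfield (compositum A A') L" "A \<subseteq> compositum A A'" "compositum A A' \<subseteq> N" "A' \<subseteq> compositum A A'"
proof -
  have c: "A \<union> A' \<subseteq> carrier L" using assms(1,2) subfieldE(3)[OF assms(3)] by blast
  show "subfield (compositum A A') L" unfolding compositum_def by (rule generate_field_is_subfield[OF c])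
  show "A \<subseteq> compositum A A'" "A' \<subseteq> compositum A A'" unfolding compositum_def by (auto intro: generate_field.incl)
  show "compositum A A' \<subseteq> N" unfolding compositum_def
    by (rule generate_field_min_subfield1[OF c assms(3)]) (use assms in auto)
qed

lemma compositum_fixed:
  assumes A: "A \<subseteq> N" "A' \<subseteq> N" "subfield N L" and h: "h \<in> galois_group K N"
    and fixed: "\<forall>x\<in>A \<union> A'. h x = x" and x: "x \<in> compositum A A'"
  shows "h x = x"
proof -
  have Nc: "N \<subseteq> carrier L" by (rule subfieldE(3)[OF A(3)])
  have c: "A \<union> A' \<subseteq> carrier L" using A(1,2) Nc by blast
  note H = galois_groupD[OF h Nc]
  note hh = hom_facts[OF A(3) H(1)]
  note Ns = subringE[OF subfieldE(1)[OF A(3)]]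
  define Z where "Z = {z \<in> N. h z = z}"
  have "subfield Z L"
  proof (rule subfieldI')
    show "subring Z L"
    proof (rule subringI)
      show "Z \<subseteq> carrier L" using Nc by (auto simp: Z_def)
      show "\<one> \<in> Z" using Ns(3) hh(2) by (simp add: Z_def)
      show "\<ominus> a \<in> Z" if "a \<in> Z" for a using that Ns(5) hh(6) by (simp add: Z_def)
      show "a \<otimes> b \<in> Z" if "a \<in> Z" "b \<in> Z" for a b using that Ns(6) hh(4) by (simp add: Z_def)
      show "a \<oplus> b \<in> Z" if "a \<in> Z" "b \<in> Z" for a b using that Ns(7) hh(5) by (simp add: Z_def)
    qed
    fix k assume k: "k \<in> Z - {\<zero>}"
    have kN: "k \<in> N - {\<zero>}" "h k = k" using k by (auto simp: Z_def)
    note ik = subfield_m_inv[OF A(3) kN(1)]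
    have c: "k \<in> carrier L" "h (inv k) \<in> carrier L" using kN ik(1) Nc hh(1) by auto
    have "k \<otimes> h (inv k) = \<one>" using hh(4)[of k "inv k"] kN ik hh(2) by simp
    then have "inv k = h (inv k)" using comm_inv_char[OF c] by simp
    then show "inv k \<in> Z" using ik(1) by (simp add: Z_def)
  qed
  then have "compositum A A' \<subseteq> Z" unfolding compositum_def
    by (rule generate_field_min_subfield1[OF c]) (use A fixed in \<open>auto simp: Z_def\<close>)
  then show ?thesis using x by (auto simp: Z_def)
qed

end

section \<open>Automorphisms acting on the valuation and on the residue field\<close>

locale galois_local_field = algebraically_closed R + residue_base R N w K
  for R (structure) and N w K +
  fixes v
  assumes K_local: "local_subfield R K v" and fin_dim: "finite_dimension K N"
    and root_closedN: "root_closed K N" and separableN: "separable_extension K N"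
begin

lemma NsK: "subfield N R" "K \<subseteq> N" "subfield K R" "root_closed K N"
  by (fact subfieldN KN subfieldK root_closedN)+

lemma Nc: "N \<subseteq> carrier R" using N_carrier by auto

lemma totally_ramified_iff_residue:
  assumes "subfield E R" "K \<subseteq> E" "E \<subseteq> N"
  shows "totally_ramified K E \<longleftrightarrow> same_residue K E"
  by (rule local_subfield.totally_ramified_iff[OF K_local local_subfield_axioms KN fin_dim assms])

lemma fixed_in_K:
  assumes "x \<in> N" "\<forall>\<tau>\<in>galois_group K N. \<tau> x = x"
  shows "x \<in> K"
proof -
  obtain Us where Us: "set Us \<subseteq> N" "finite_extension K Us = N"
    by (rule finite_dimension_generators[OF subfieldK subringN KN fin_dim])
  show ?thesis
    by (rule fixed_by_galois[OF subfieldK subfieldN KN fin_dim root_closedN Us(1) _ _ assms(2)])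
      (use Us separableN assms(1) in \<open>auto simp: separable_extension_iff\<close>)
qed

text \<open>Moves the base up to M while N and w stay, so that everything proved over K is available
  over M for the same \<open>B k\<close>.\<close>

lemma intermediate:
  assumes "subfield M R" "K \<subseteq> M" "M \<subseteq> N"
  shows "\<exists>v'. galois_local_field R N w M v'"
proof -
  have fKM: "finite_dimension K M" "finite_dimension M N"
    using finite_dimension_intermediate[OF subfieldK assms(1) subringN assms(2,3) fin_dim] by auto
  obtain v' where v': "local_subfield R M v'"
    using local_subfield.finite_extension_local[OF K_local assms(1,2) fKM(1)] by blast
  have "separable_extension M N"
    using separableN separable_element_mono[OF subfieldK assms(1,2)] N_carrier by (simp add: separable_extension_iff)
  then have "galois_local_field R N w M v'"
    using v' assms fKM(2) root_closed_intermediate[OF root_closedN subfieldK assms(1) subfieldN assms(2,3)]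
      algebraically_closed_axioms local_subfield_axioms
    by (intro galois_local_field.intro galois_local_field_axioms.intro residue_base.intro residue_base_axioms.intro) auto
  then show ?thesis by blast
qed

context
  fixes \<tau> assumes t: "\<tau> \<in> galois_group K N"
begin

lemma galN: "x \<in> N \<Longrightarrow> \<tau> x \<in> N" by (rule galois_groupD(6)[OF t Nc])

lemmas gal_hom = hom_facts[OF subfieldN galois_groupD(1)[OF t Nc]]

lemma gal_nz: "x \<in> N \<Longrightarrow> x \<noteq> \<zero> \<Longrightarrow> \<tau> x \<noteq> \<zero>"
  by (rule hom_nz[OF subfieldN galois_groupD(1)[OF t Nc]])

lemma gal_pow: "x \<in> N \<Longrightarrow> \<tau> (x [^] (n::nat)) = \<tau> x [^] n"
  by (induction n) (auto simp: gal_hom)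

lemma gal_minus: "x \<in> N \<Longrightarrow> y \<in> N \<Longrightarrow> \<tau> (x \<ominus> y) = \<tau> x \<ominus> \<tau> y"
  by (simp add: a_minus_def gal_hom)

text \<open>The pullback of w along \<tau> is again a valuation on N, hence a multiple of w. Since
  \<tau> is onto, the value 1 is attained and the factor is 1.\<close>

lemma w_galois: assumes "x \<in> N" "x \<noteq> \<zero>" shows "w (\<tau> x) = w x"
proof -
  have V: "valued_subfield R N (\<lambda>x. w (\<tau> x))"
  proof (intro valued_subfield.intro valued_subfield_axioms.intro field_axioms subfieldN)
    fix x y assume a: "x \<in> N" "x \<noteq> \<zero>" "y \<in> N" "y \<noteq> \<zero>"
    show "w (\<tau> (x \<otimes> y)) = w (\<tau> x) + w (\<tau> y)"
      using a w_mult[OF galN gal_nz galN gal_nz] by (simp add: gal_hom)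
    assume "x \<oplus> y \<noteq> \<zero>"
    then have "\<tau> x \<oplus> \<tau> y \<noteq> \<zero>" using gal_nz[of "x \<oplus> y"] a gal_hom(5) by simp
    then show "min (w (\<tau> x)) (w (\<tau> y)) \<le> w (\<tau> (x \<oplus> y))"
      using a w_add[OF galN gal_nz galN gal_nz] by (simp add: gal_hom)
  qed
  obtain c where c: "c \<ge> 0" "\<forall>x\<in>N. x \<noteq> \<zero> \<longrightarrow> w (\<tau> x) = c * w x"
    using valuation_unique[OF V] by blast
  obtain y where y: "y \<in> N" "y \<noteq> \<zero>" "w y = 1" using w_surj by blast
  obtain z where z: "z \<in> N" "y = \<tau> z" using galois_groupD(3)[OF t Nc] y(1) by blast
  have "z \<noteq> \<zero>" using z(2) y(2) gal_hom(3) by auto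
  then have "c * w z = 1" using c(2) z y(3) by auto
  then have "c = 1" using c(1) by (metis zmult_eq_1_iff neg_0_le_iff_le not_one_le_zero)
  then show ?thesis using c assms by simp
qed

lemma B_galois: "x \<in> N \<Longrightarrow> \<tau> x \<in> B k \<longleftrightarrow> x \<in> B k"
  by (cases "x = \<zero>") (auto simp: B_def gal_hom galN gal_nz w_galois)

lemma B_galois_minus: "x \<in> N \<Longrightarrow> y \<in> N \<Longrightarrow> \<tau> x \<ominus> \<tau> y \<in> B k \<longleftrightarrow> x \<ominus> y \<in> B k"
  using B_galois[of "x \<ominus> y"] gal_minus by simp

end

definition frob :: "('a \<Rightarrow> 'a) \<Rightarrow> bool"
  where "frob g \<longleftrightarrow> (\<forall>x\<in>B 0. g x \<ominus> x [^] q \<in> B 1)"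

text \<open>On a fixed x the Frobenius congruence says that the residue of x is a root of X^q - X,
  that is, an element of the residue field of K.\<close>

lemma same_residue_if_frob:
  assumes "E \<subseteq> N" "frob g" "\<forall>x\<in>E. g x = x"
  shows "same_residue K E"
  unfolding same_residue_def
proof
  fix x assume x: "x \<in> E \<inter> B 0"
  then have "x \<ominus> x [^] q \<in> B 1" using assms(2,3) by (auto simp: frob_def)
  then have "x [^] q \<ominus> x \<in> B 1" using B_minus_sym x B_N by (meson IntD2 N_pow)
  then show "\<exists>y\<in>K. x \<ominus> y \<in> B 1" using pow_q_fixed x by blast
qed

text \<open>The residues of the coefficients lie in the field with q elements and are fixed by the
  q-th power. As the q-th power is additive modulo \<open>B 1\<close>, f(x^q) is congruent to
  f(x)^q.\<close>

lemma eval_pow_q: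
  assumes "set cs \<subseteq> E" "E \<subseteq> N" "set cs \<subseteq> B 0" "same_residue K E" "x \<in> B 0"
  shows "eval cs x \<in> B 0 \<and> eval cs (x [^] q) \<ominus> eval cs x [^] q \<in> B 1"
  using assms(1,3)
proof (induction cs)
  case Nil
  have "\<zero> [^] q = \<zero>" using q_ge_2 by (simp add: nat_pow_zero)
  then show ?case by (simp add: a_minus_def)
next
  case (Cons c cs)
  have xB: "x [^] (n::nat) \<in> B 0" for n by (rule B_pow[OF assms(5)])
  have c: "c \<in> E" "c \<in> B 0" "c \<in> N" using Cons assms(2) by auto
  have IH: "eval cs x \<in> B 0" "eval cs (x [^] q) \<ominus> eval cs x [^] q \<in> B 1" using Cons by auto
  have "eval ds y \<in> B 0" if "set ds \<subseteq> B 0" "y \<in> B 0" for ds y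
    using that by (induction ds) (auto intro!: B_add B0_mult B_pow)
  then have e2: "eval cs (x [^] q) \<in> B 0" using Cons.prems(2) xB by simp
  define n where "n = length cs"
  define t where "t = c \<otimes> x [^] n"
  define e where "e = eval cs x"
  have tB: "t \<in> B 0" unfolding t_def by (rule B0_mult(1)[OF c(2) xB])
  have eB: "e \<in> B 0" using IH by (simp add: e_def)
  obtain d where d: "d \<in> K" "c \<ominus> d \<in> B 1" using assms(4) c unfolding same_residue_def by blast
  have dN: "d \<in> N" using d KN by auto
  have dB: "d \<in> B 0"
  proof -
    have cc: "c \<in> carrier R" "d \<in> carrier R" using c dN N_carrier by auto
    have "c \<ominus> (c \<ominus> d) \<in> B 0" by (rule B_minus[OF c(2) B10[OF d(2)]])
    moreover have "c \<ominus> (c \<ominus> d) = d" using cc unfolding a_minus_def by algebra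
    ultimately show ?thesis by simp
  qed
  have cq: "c [^] q \<ominus> c \<in> B 1"
  proof -
    have "c [^] q \<ominus> d [^] q \<in> B 1" by (rule B_pow_cong[OF c(2) dB d(2)])
    moreover have "d [^] q \<ominus> d \<in> B 1" by (rule pow_q_base[OF d(1) dB])
    moreover have "d \<ominus> c \<in> B 1" using d(2) B_minus_sym c dN by blast
    ultimately show ?thesis using B_minus_trans c(3) dN N_pow by meson
  qed
  have s: "(t \<oplus> e) [^] q \<ominus> (t [^] q \<oplus> e [^] q) \<in> B 1" by (rule pow_q_add[OF tB eB])
  have cc: "c \<in> carrier R" "x \<in> carrier R" using c assms(5) N_carrier B_carrier by auto
  have tq: "t [^] q = c [^] q \<otimes> (x [^] q) [^] n"
    unfolding t_def using cc by (simp add: nat_pow_distrib nat_pow_pow mult.commute)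
  define y where "y = (x [^] q) [^] n"
  have yB: "y \<in> B 0" unfolding y_def by (rule B_pow[OF xB])
  define f where "f = eval cs (x [^] q)"
  have car: "t [^] q \<in> carrier R" "e [^] q \<in> carrier R" "(t \<oplus> e) [^] q \<in> carrier R" "y \<in> carrier R" "f \<in> carrier R"
    "c [^] q \<in> carrier R"
    using tB eB yB e2 cc B_carrier by (auto simp: f_def)
  have sum: "(c \<otimes> y \<oplus> f) \<ominus> (t \<oplus> e) [^] q =
     \<ominus> ((c [^] q \<ominus> c) \<otimes> y) \<oplus> ((f \<ominus> e [^] q) \<ominus> ((t \<oplus> e) [^] q \<ominus> (t [^] q \<oplus> e [^] q)))"
    unfolding tq y_def[symmetric] unfolding a_minus_def using car cc by algebra
  have "f \<ominus> e [^] q \<in> B 1" using IH by (simp add: f_def e_def)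
  from B_add[OF B_uminus[OF B0_mult(2)[OF cq yB]] B_minus[OF this s]]
  have "(c \<otimes> y \<oplus> f) \<ominus> (t \<oplus> e) [^] q \<in> B 1" unfolding sum .
  moreover have "eval (c # cs) (x [^] q) = c \<otimes> y \<oplus> f" by (simp add: y_def f_def n_def)
  moreover have "eval (c # cs) x = t \<oplus> e" by (simp add: t_def e_def n_def)
  ultimately show ?case using B_add[OF tB eB] by simp
qed

text \<open>\<open>B 1\<close> is a prime ideal, so it contains a factor of any product that it
  contains.\<close>

lemma foldr_B1:
  assumes "z \<in> B 0" "set ys \<subseteq> B 0" "foldr (\<lambda>y r. (z \<ominus> y) \<otimes> r) ys \<one> \<in> B 1"
  shows "\<exists>y\<in>set ys. z \<ominus> y \<in> B 1"
  using assms(2,3)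
proof (induction ys)
  case Nil
  then show ?case using one_notin_B1 by simp
next
  case (Cons y ys)
  have "set xs \<subseteq> B 0 \<Longrightarrow> foldr (\<lambda>y r. (z \<ominus> y) \<otimes> r) xs \<one> \<in> B 0" for xs
    using assms(1) by (induction xs) (auto intro!: B0_mult)
  then have "foldr (\<lambda>y r. (z \<ominus> y) \<otimes> r) ys \<one> \<in> B 0" using Cons by simp
  then have "z \<ominus> y \<in> B 1 \<or> foldr (\<lambda>y r. (z \<ominus> y) \<otimes> r) ys \<one> \<in> B 1"
    using Cons.prems assms(1) by (intro B1_prime) auto
  then show ?case using Cons by auto
qed

text \<open>The orbit polynomial of a lift \<open>a\<close> of a generator of the residue field has coefficients that are
  congruent to elements of \<open>K\<close>, so it vanishes at \<open>a\<^sup>q\<close> modulo the maximal ideal, and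
  \<open>a\<^sup>q\<close> is congruent to a conjugate of \<open>a\<close>.\<close>

lemma frobenius_lift:
  assumes E: "subfield E R" "K \<subseteq> E" "E \<subseteq> N" and f: "same_residue K E"
  shows "\<exists>g\<in>galois_group E N. frob g"
proof -
  obtain v' where "galois_local_field R N w E v'" using intermediate[OF E] by blast
  then interpret E: galois_local_field R N w E v' .
  obtain a where a: "a \<in> B 0" "\<forall>x\<in>B 0. x \<in> B 1 \<or> (\<exists>i::nat. x \<ominus> a [^] i \<in> B 1)"
    using residue_generator by blast
  have aN: "a \<in> N" using a(1) B_N by simp
  obtain ys where ys: "distinct ys" "set ys = (\<lambda>\<tau>. \<tau> a) ` galois_group E N" "a \<in> set ys" "set (vieta ys) \<subseteq> E"
    by (rule orbit_polynomial[OF E(1) subfieldN E(3) E.fin_dim E.root_closedN E.fixed_in_K aN])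
  have ysB: "set ys \<subseteq> B 0" using ys(2) E.B_galois[of _ a 0] aN a(1) by auto
  have ysc: "set ys \<subseteq> carrier R" using ysB B_carrier by auto
  define vs where "vs = vieta ys"
  have vsB: "set vs \<subseteq> B 0" unfolding vs_def by (rule set_vieta[OF subring_B0 ysB])
  define n where "n = length ys"
  define z where "z = a [^] q"
  have zB: "z \<in> B 0" unfolding z_def by (rule B_pow[OF a(1)])
  have vq: "eval (\<one> # vs) a \<in> B 0 \<and> eval (\<one> # vs) (a [^] q) \<ominus> eval (\<one> # vs) a [^] q \<in> B 1"
    by (rule eval_pow_q[OF _ E(3) _ f a(1)]) (use ys(4) vsB E.K_closed(3) in \<open>auto simp: vs_def\<close>)
  have vc: "set vs \<subseteq> carrier R" using vsB B_carrier by auto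
  have mon: "eval (\<one> # vs) x = x [^] n \<oplus> eval vs x" if "x \<in> carrier R" for x
    using that eval_in_carrier[OF vc that] by (simp add: vs_def n_def)
  have "eval (\<one> # vs) a = \<zero>"
    using mon[OF B_carrier[OF a(1)]] vieta_root[OF ysc ys(3)] by (simp add: vs_def n_def)
  then have "eval (\<one> # vs) z \<in> B 1"
    using vq q_ge_2 eval_in_carrier[of "\<one> # vs" z] vc B_carrier[OF zB] by (simp add: nat_pow_zero z_def a_minus_def)
  then have "foldr (\<lambda>y r. (z \<ominus> y) \<otimes> r) ys \<one> \<in> B 1"
    using mon[OF B_carrier[OF zB]] eval_vieta[OF ysc B_carrier[OF zB]] by (simp add: vs_def n_def)
  then obtain y where y: "y \<in> set ys" "z \<ominus> y \<in> B 1" using foldr_B1[OF zB ysB] by blast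
  obtain g where g: "g \<in> galois_group E N" "y = g a" using y(1) ys(2) by auto
  \<comment> \<open>Acting as the q-th power on a, g does so on the powers of a, which represent all
    nonzero residues.\<close>
  have "g x \<ominus> x [^] q \<in> B 1" if x: "x \<in> B 0" for x
  proof -
    have xN: "x \<in> N" using x B_N by simp
    from a(2)[rule_format, OF x] show ?thesis
    proof
      assume x1: "x \<in> B 1"
      have "x [^] q = x [^] (q - 1) \<otimes> x" using q_ge_2 nat_pow_Suc[of x "q - 1"] by simp
      then have "x [^] q \<in> B 1" using B0_mult(1)[OF B_pow[OF x] x1] by simp
      then show ?thesis using B_minus E.B_galois[OF g(1) xN] x1 by simp
    next
      assume "\<exists>i::nat. x \<ominus> a [^] i \<in> B 1"
      then obtain i :: nat where i: "x \<ominus> a [^] i \<in> B 1" by blast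
      have gaB: "g a \<in> B 0" using E.B_galois[OF g(1) aN] a(1) by simp
      have 1: "g x \<ominus> g a [^] i \<in> B 1"
        using i E.B_galois_minus[OF g(1) xN N_pow[OF aN], of i 1] E.gal_pow[OF g(1) aN] by simp
      have "g a \<ominus> z \<in> B 1" using y g(2) B_minus_sym B_N[OF zB] B_N[OF gaB] by simp
      then have 2: "g a [^] i \<ominus> z [^] i \<in> B 1" by (rule B_pow_cong[OF gaB zB])
      have 3: "(a [^] i) [^] q \<ominus> x [^] q \<in> B 1"
        by (rule B_pow_cong[OF B_pow[OF a(1)] x]) (use i B_minus_sym xN N_pow[OF aN] in blast)
      have "(a [^] i) [^] q = z [^] i" using B_carrier[OF a(1)] by (simp add: z_def nat_pow_pow mult.commute)
      then have 3: "z [^] i \<ominus> x [^] q \<in> B 1" using 3 by simp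
      have N: "g x \<in> N" "g a [^] i \<in> N" "z [^] i \<in> N" "x [^] q \<in> N"
        using E.galN[OF g(1) xN] N_pow[OF E.galN[OF g(1) aN]] N_pow[OF B_N[OF zB]] N_pow[OF xN] by auto
      show ?thesis by (rule B_minus_trans[OF 1 B_minus_trans[OF 2 3 N(2-4)] N(1,2,4)])
    qed
  qed
  then show ?thesis using g(1) by (auto simp: frob_def)
qed

end

section \<open>Exceptional extensions in towers\<close>

context galois_local_field begin

lemma galois_inv:
  assumes "\<tau> \<in> galois_group K N"
  obtains \<rho> where "\<rho> \<in> galois_group K N" "\<And>x. x \<in> N \<Longrightarrow> \<rho> (\<tau> x) = x" "\<And>x. x \<in> N \<Longrightarrow> \<tau> (\<rho> x) = x"
  using galois_inverse[OF NsK assms] by blast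

text \<open>The q-th power commutes with the action of every automorphism on the residue field, so
  conjugation does not change it.\<close>

lemma frob_conjugate:
  assumes t: "\<tau> \<in> galois_group K N" and g: "frob g"
    and r: "\<rho> \<in> galois_group K N" "\<And>x. x \<in> N \<Longrightarrow> \<tau> (\<rho> x) = x"
    and gN: "\<And>x. x \<in> N \<Longrightarrow> g x \<in> N" and h: "\<And>x. x \<in> N \<Longrightarrow> h x = \<tau> (g (\<rho> x))"
  shows "frob h"
  unfolding frob_def
proof
  fix x assume x: "x \<in> B 0"
  have xN: "x \<in> N" using x B_N by simp
  have rN: "\<rho> x \<in> N" by (rule galN[OF r(1) xN])
  have "\<rho> x \<in> B 0" using B_galois[OF r(1) xN] x by simp
  then have "g (\<rho> x) \<ominus> \<rho> x [^] q \<in> B 1" using g by (simp add: frob_def)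
  then have "\<tau> (g (\<rho> x)) \<ominus> \<tau> (\<rho> x [^] q) \<in> B 1" using B_galois_minus[OF t gN[OF rN] N_pow[OF rN]] by simp
  then show "h x \<ominus> x [^] q \<in> B 1" using h[OF xN] gal_pow[OF t rN] r(2)[OF xN] by simp
qed

text \<open>The count of \<open>conjugates_cover\<close> with the inertia group as I. Its hypothesis
  \<open>exc\<close> is where exceptionality enters: a Frobenius element h for which h and x^-1 h x
  both fix E fixes the compositum of E and x(E), which is then totally ramified, so x must be
  trivial on E.\<close>

lemma frob_fixes_conjugate:
  assumes E: "subfield E R" "K \<subseteq> E" "E \<subseteq> N" and res: "same_residue K E"
    and exc: "\<And>\<tau>. \<tau> \<in> galois_group K N \<Longrightarrow> \<exists>x\<in>E. \<tau> x \<noteq> x \<Longrightarrow> \<not> totally_ramified K (compositum E (\<tau> ` E))"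
    and g: "g \<in> galois_group K N" "frob g"
  shows "\<exists>i\<in>galois_group K N. \<forall>x\<in>E. g (i x) = i x"
proof -
  let ?G = "galois_grp K N"
  interpret G: group ?G by (rule group_galois_grp[OF NsK])
  have car: "carrier ?G = galois_group K N" by (simp add: galois_grp_def)
  have mult: "(x \<otimes>\<^bsub>?G\<^esub> y) z = x (y z)" if "z \<in> N" for x y z
    using that by (simp add: galois_grp_def compose_def)
  have one: "\<one>\<^bsub>?G\<^esub> z = z" if "z \<in> N" for z using that by (simp add: galois_grp_def)
  have invl: "(inv\<^bsub>?G\<^esub> x) (x z) = z" and invr: "x ((inv\<^bsub>?G\<^esub> x) z) = z"
    if "x \<in> galois_group K N" "z \<in> N" for x z
    using mult[OF that(2), of "inv\<^bsub>?G\<^esub> x" x] mult[OF that(2), of x "inv\<^bsub>?G\<^esub> x"] G.l_inv[of x] G.r_inv[of x]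
      one[OF that(2)] that(1) car by auto
  have inv: "inv\<^bsub>?G\<^esub> x \<in> galois_group K N" if "x \<in> galois_group K N" for x
    using G.inv_closed[of x] that car by simp
  obtain \<phi> where \<phi>: "\<phi> \<in> galois_group E N" "frob \<phi>" using frobenius_lift[OF E res] by blast
  have HG: "galois_group E N \<subseteq> galois_group K N" using E(2) by (auto simp: galois_group_def)
  have memH: "x \<in> galois_group E N \<longleftrightarrow> x \<in> galois_group K N \<and> (\<forall>y\<in>E. x y = y)" for x
    using E(2) by (auto simp: galois_group_def)
  have EN: "\<And>y. y \<in> E \<Longrightarrow> y \<in> N" using E(3) by auto
  define I where "I = {x \<in> galois_group K N. \<forall>z\<in>B 0. x z \<ominus> z \<in> B 1}"
  define \<Phi> where "\<Phi> = {x \<in> galois_group K N. frob x}"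
  have subI: "subgroup I ?G"
  proof (rule G.subgroupI)
    show "I \<subseteq> carrier ?G" by (auto simp: I_def car)
    have "\<one>\<^bsub>?G\<^esub> \<in> I" unfolding I_def
    proof (intro CollectI conjI ballI)
      show "\<one>\<^bsub>?G\<^esub> \<in> galois_group K N" using G.one_closed car by simp
      fix z assume "z \<in> B 0"
      then show "\<one>\<^bsub>?G\<^esub> z \<ominus> z \<in> B 1" using one[OF B_N] B_carrier[of z] by (simp add: a_minus_def r_neg)
    qed
    then show "I \<noteq> {}" by blast
    fix x assume x: "x \<in> I"
    have xG: "x \<in> galois_group K N" using x by (simp add: I_def)
    show "inv\<^bsub>?G\<^esub> x \<in> I" unfolding I_def
    proof (intro CollectI conjI ballI)
      show "inv\<^bsub>?G\<^esub> x \<in> galois_group K N" by (rule inv[OF xG])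
      fix z assume z: "z \<in> B 0"
      define y where "y = (inv\<^bsub>?G\<^esub> x) z"
      have y: "y \<in> B 0" "x y = z" using B_galois[OF inv[OF xG] B_N[OF z]] z invr[OF xG B_N[OF z]] by (auto simp: y_def)
      then have "z \<ominus> y \<in> B 1" using x by (auto simp: I_def)
      then show "(inv\<^bsub>?G\<^esub> x) z \<ominus> z \<in> B 1" using B_minus_sym[OF B_N[OF z] B_N[OF y(1)]] by (simp add: y_def)
    qed
    fix y assume y: "y \<in> I"
    show "x \<otimes>\<^bsub>?G\<^esub> y \<in> I" unfolding I_def
    proof (intro CollectI conjI ballI)
      have yG: "y \<in> galois_group K N" using y by (simp add: I_def)
      show "x \<otimes>\<^bsub>?G\<^esub> y \<in> galois_group K N" using G.m_closed[of x y] xG yG car by simp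
      fix z assume z: "z \<in> B 0"
      have yz: "y z \<in> B 0" using B_galois[OF yG B_N[OF z]] z by simp
      have 1: "x (y z) \<ominus> y z \<in> B 1" using x yz by (simp add: I_def)
      have 2: "y z \<ominus> z \<in> B 1" using y z by (simp add: I_def)
      show "(x \<otimes>\<^bsub>?G\<^esub> y) z \<ominus> z \<in> B 1"
        unfolding mult[OF B_N[OF z]]
        by (rule B_minus_trans[OF 1 2 galN[OF xG B_N[OF yz]] B_N[OF yz] B_N[OF z]])
    qed
  qed
  have subH: "subgroup (galois_group E N) ?G"
  proof (rule G.subgroupI)
    show "galois_group E N \<subseteq> carrier ?G" using HG car by simp
    show "galois_group E N \<noteq> {}" using \<phi> by auto
    fix x assume x: "x \<in> galois_group E N"
    then have xG: "x \<in> galois_group K N" "\<forall>y\<in>E. x y = y" using memH by auto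
    have "(inv\<^bsub>?G\<^esub> x) y = y" if y: "y \<in> E" for y
      using invl[OF xG(1) EN[OF y]] xG(2) y by simp
    then show "inv\<^bsub>?G\<^esub> x \<in> galois_group E N" using inv[OF xG(1)] memH by simp
    fix y assume y: "y \<in> galois_group E N"
    then have "x \<otimes>\<^bsub>?G\<^esub> y \<in> galois_group K N" using G.m_closed[of x y] xG HG car by auto
    moreover have "(x \<otimes>\<^bsub>?G\<^esub> y) z = z" if "z \<in> E" for z
      using mult[OF EN[OF that]] xG(2) y memH that by simp
    ultimately show "x \<otimes>\<^bsub>?G\<^esub> y \<in> galois_group E N" using memH by simp
  qed
  have "\<exists>i\<in>I. inv\<^bsub>?G\<^esub> i \<otimes>\<^bsub>?G\<^esub> g \<otimes>\<^bsub>?G\<^esub> i \<in> galois_group E N"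
  proof (rule G.conjugates_cover[where \<Phi> = \<Phi> and \<phi> = \<phi>])
    show "finite (carrier ?G)" using finite_galois_group[OF NsK fin_dim] car by simp
    show "subgroup I ?G" by (rule subI)
    show "subgroup (galois_group E N) ?G" by (rule subH)
    show "\<Phi> \<subseteq> carrier ?G" by (auto simp: \<Phi>_def car)
    show "\<phi> \<in> \<Phi>" using \<phi> HG by (auto simp: \<Phi>_def)
    show "\<phi> \<in> galois_group E N" by (rule \<phi>)
    show "g \<in> \<Phi>" using g by (simp add: \<Phi>_def)
  next
    have \<phi>G: "\<phi> \<in> galois_group K N" using \<phi> HG by auto
    fix f assume f: "f \<in> \<Phi>"
    then have fG: "f \<in> galois_group K N" "frob f" by (auto simp: \<Phi>_def)
    show "inv\<^bsub>?G\<^esub> \<phi> \<otimes>\<^bsub>?G\<^esub> f \<in> I" unfolding I_def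
    proof (intro CollectI conjI ballI)
      show "inv\<^bsub>?G\<^esub> \<phi> \<otimes>\<^bsub>?G\<^esub> f \<in> galois_group K N" using G.m_closed[of "inv\<^bsub>?G\<^esub> \<phi>" f] inv[OF \<phi>G] fG car by simp
      fix z assume z: "z \<in> B 0"
      have zN: "z \<in> N" using z B_N by simp
      have N: "f z \<in> N" "\<phi> z \<in> N" "z [^] q \<in> N" using galN[OF fG(1) zN] galN[OF \<phi>G zN] zN by auto
      have "f z \<ominus> z [^] q \<in> B 1" using fG(2) z by (simp add: frob_def)
      moreover have "\<phi> z \<ominus> z [^] q \<in> B 1" using \<phi>(2) z by (simp add: frob_def)
      then have "z [^] q \<ominus> \<phi> z \<in> B 1" using B_minus_sym[OF N(2,3)] by blast
      ultimately have "f z \<ominus> \<phi> z \<in> B 1" by (rule B_minus_trans[OF _ _ N(1,3,2)])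
      then have "(inv\<^bsub>?G\<^esub> \<phi>) (f z) \<ominus> (inv\<^bsub>?G\<^esub> \<phi>) (\<phi> z) \<in> B 1"
        using B_galois_minus[OF inv[OF \<phi>G] N(1,2)] by simp
      then show "(inv\<^bsub>?G\<^esub> \<phi> \<otimes>\<^bsub>?G\<^esub> f) z \<ominus> z \<in> B 1" unfolding mult[OF zN] invl[OF \<phi>G zN] .
    qed
  next
    have \<phi>G: "\<phi> \<in> galois_group K N" using \<phi> HG by auto
    fix i h assume i: "i \<in> I" and h: "h \<in> I" "h \<in> galois_group E N"
    have iG: "i \<in> galois_group K N" and hG: "h \<in> galois_group K N" using i h by (auto simp: I_def)
    have "frob (\<phi> \<otimes>\<^bsub>?G\<^esub> h)" unfolding frob_def
    proof
      fix z assume z: "z \<in> B 0"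
      have zN: "z \<in> N" using z B_N by simp
      have hz: "h z \<in> B 0" "h z \<in> N" using B_galois[OF hG zN] z galN[OF hG zN] by auto
      have N: "\<phi> (h z) \<in> N" "h z [^] q \<in> N" "z [^] q \<in> N" using galN[OF \<phi>G hz(2)] hz zN by auto
      have 1: "\<phi> (h z) \<ominus> h z [^] q \<in> B 1" using \<phi>(2) hz by (simp add: frob_def)
      have "h z \<ominus> z \<in> B 1" using h z by (simp add: I_def)
      then have 2: "h z [^] q \<ominus> z [^] q \<in> B 1" by (rule B_pow_cong[OF hz(1) z])
      show "(\<phi> \<otimes>\<^bsub>?G\<^esub> h) z \<ominus> z [^] q \<in> B 1" unfolding mult[OF zN] by (rule B_minus_trans[OF 1 2 N])
    qed
    moreover have \<phi>h: "\<phi> \<otimes>\<^bsub>?G\<^esub> h \<in> galois_group K N" using G.m_closed[of \<phi> h] \<phi>G hG car by simp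
    ultimately have "frob (i \<otimes>\<^bsub>?G\<^esub> (\<phi> \<otimes>\<^bsub>?G\<^esub> h) \<otimes>\<^bsub>?G\<^esub> inv\<^bsub>?G\<^esub> i)"
      using frob_conjugate[OF iG _ inv[OF iG] invr[OF iG] galN[OF \<phi>h]] mult galN[OF inv[OF iG]] by simp
    moreover have "i \<otimes>\<^bsub>?G\<^esub> (\<phi> \<otimes>\<^bsub>?G\<^esub> h) \<otimes>\<^bsub>?G\<^esub> inv\<^bsub>?G\<^esub> i \<in> galois_group K N"
      using G.m_closed iG \<phi>h inv[OF iG] car by simp
    ultimately show "i \<otimes>\<^bsub>?G\<^esub> (\<phi> \<otimes>\<^bsub>?G\<^esub> h) \<otimes>\<^bsub>?G\<^esub> inv\<^bsub>?G\<^esub> i \<in> \<Phi>" by (simp add: \<Phi>_def)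
  next
    fix x h assume x: "x \<in> carrier ?G" and h: "h \<in> \<Phi>" "h \<in> galois_group E N"
      and xhx: "inv\<^bsub>?G\<^esub> x \<otimes>\<^bsub>?G\<^esub> h \<otimes>\<^bsub>?G\<^esub> x \<in> galois_group E N"
    have xG: "x \<in> galois_group K N" using x car by simp
    have hG: "h \<in> galois_group K N" "frob h" "\<forall>y\<in>E. h y = y" using h memH by (auto simp: \<Phi>_def)
    have xE: "x ` E \<subseteq> N" using galN[OF xG] EN by auto
    have hx: "h (x y) = x y" if y: "y \<in> E" for y
    proof -
      have yN: "y \<in> N" by (rule EN[OF y])
      have xyN: "x y \<in> N" by (rule galN[OF xG yN])
      have "(inv\<^bsub>?G\<^esub> x) (h (x y)) = y" using xhx memH y mult[OF yN] mult[OF xyN] by auto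
      then have "x y = x ((inv\<^bsub>?G\<^esub> x) (h (x y)))" by simp
      then show ?thesis using invr[OF xG galN[OF hG(1) xyN]] by simp
    qed
    note C = compositum_facts[OF E(3) xE subfieldN]
    have "\<forall>z\<in>compositum E (x ` E). h z = z"
      using compositum_fixed[OF E(3) xE subfieldN hG(1)] hG(3) hx by auto
    then have "same_residue K (compositum E (x ` E))" by (rule same_residue_if_frob[OF C(3) hG(2)])
    then have "totally_ramified K (compositum E (x ` E))"
      using totally_ramified_iff_residue[OF C(1) _ C(3)] E(2) C(2) by auto
    then show "x \<in> galois_group E N" using exc[OF xG] xG memH by auto
  qed
  then obtain i where i: "i \<in> I" "inv\<^bsub>?G\<^esub> i \<otimes>\<^bsub>?G\<^esub> g \<otimes>\<^bsub>?G\<^esub> i \<in> galois_group E N" by blast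
  have iG: "i \<in> galois_group K N" using i by (simp add: I_def)
  have "g (i x) = i x" if x: "x \<in> E" for x
  proof -
    have xN: "x \<in> N" by (rule EN[OF x])
    have ixN: "i x \<in> N" by (rule galN[OF iG xN])
    have "(inv\<^bsub>?G\<^esub> i) (g (i x)) = x" using i(2) memH x mult[OF xN] mult[OF ixN] by auto
    then have "i x = i ((inv\<^bsub>?G\<^esub> i) (g (i x)))" by simp
    then show ?thesis using invr[OF iG galN[OF g(1) ixN]] by simp
  qed
  then show ?thesis using iG by blast
qed

lemma same_residue_trans:
  assumes "K \<subseteq> M" "M \<subseteq> E" "M \<subseteq> N" "E \<subseteq> N"
  shows "same_residue K E \<longleftrightarrow> same_residue K M \<and> same_residue M E"
proof
  assume "same_residue K E"
  then show "same_residue K M \<and> same_residue M E"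
    using assms unfolding same_residue_def by blast
next
  assume h: "same_residue K M \<and> same_residue M E"
  show "same_residue K E" unfolding same_residue_def
  proof
    fix x assume x: "x \<in> E \<inter> B 0"
    then obtain y where y: "y \<in> M" "x \<ominus> y \<in> B 1" using h unfolding same_residue_def by blast
    have N: "x \<in> N" "y \<in> N" using x y assms B_N by auto
    have c: "x \<in> carrier R" "y \<in> carrier R" using N N_carrier by auto
    have "x \<ominus> (x \<ominus> y) \<in> B 0" using x B10[OF y(2)] by auto
    moreover have "x \<ominus> (x \<ominus> y) = y" using c unfolding a_minus_def by algebra
    ultimately have "y \<in> M \<inter> B 0" using y by simp
    then obtain z where z: "z \<in> K" "y \<ominus> z \<in> B 1" using h unfolding same_residue_def by blast
    have "x \<ominus> z \<in> B 1" by (rule B_minus_trans[OF y(2) z(2) N]) (use z KN in auto)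
    then show "\<exists>y\<in>K. x \<ominus> y \<in> B 1" using z by blast
  qed
qed

lemma exceptional_iff':
  assumes E: "subfield E R" "K \<subseteq> E" "E \<subseteq> N"
  shows "exceptional K E \<longleftrightarrow> same_residue K E \<and>
    (\<forall>\<tau>\<in>galois_group K N. (\<exists>x\<in>E. \<tau> x \<noteq> x) \<longrightarrow> \<not> same_residue K (compositum E (\<tau> ` E)))"
proof -
  have "separable_extension K E" using separableN E(3) unfolding separable_extension_iff by auto
  then have "exceptional K E \<longleftrightarrow> totally_ramified K E \<and>
    (\<forall>\<tau>\<in>galois_group K N. (\<exists>x\<in>E. \<tau> x \<noteq> x) \<longrightarrow> \<not> totally_ramified K (compositum E (\<tau> ` E)))"
    by (rule exceptional_iff[OF subfieldK E(1,2) _ subfieldN E(3) fin_dim root_closedN])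
  moreover have "totally_ramified K (compositum E (\<tau> ` E)) \<longleftrightarrow> same_residue K (compositum E (\<tau> ` E))"
    if t: "\<tau> \<in> galois_group K N" for \<tau>
  proof -
    have "\<tau> ` E \<subseteq> N" using galN[OF t] E(3) by auto
    note C = compositum_facts[OF E(3) this subfieldN]
    show ?thesis by (rule totally_ramified_iff_residue[OF C(1) _ C(3)]) (use C(2) E(2) in auto)
  qed
  ultimately show ?thesis using totally_ramified_iff_residue[OF E] by auto
qed

theorem exceptional_tower:
  assumes M: "subfield M R" "K \<subseteq> M" and E: "subfield E R" "M \<subseteq> E" "E \<subseteq> N"
  shows "exceptional K E \<longleftrightarrow> exceptional M E \<and> exceptional K M"
proof -
  have MN: "M \<subseteq> N" and KE: "K \<subseteq> E" using assms by auto
  obtain v' where "galois_local_field R N w M v'" using intermediate[OF M MN] by blast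
  then interpret M: galois_local_field R N w M v' .
  note exK = exceptional_iff'[OF E(1) KE E(3)]
  note exM = M.exceptional_iff'[OF E]
  note exKM = exceptional_iff'[OF M MN]
  have sub: "galois_group M N \<subseteq> galois_group K N" using M(2) by (auto simp: galois_group_def)
  have memM: "x \<in> galois_group M N \<longleftrightarrow> x \<in> galois_group K N \<and> (\<forall>y\<in>M. x y = y)" for x
    using M(2) by (auto simp: galois_group_def)
  note tower = same_residue_trans[OF M(2) E(2) MN E(3)]
  have comp: "subfield (compositum A (\<tau> ` A)) R" "A \<subseteq> compositum A (\<tau> ` A)" "compositum A (\<tau> ` A) \<subseteq> N"
      "\<tau> ` A \<subseteq> compositum A (\<tau> ` A)" "\<tau> ` A \<subseteq> N"
    if "A \<subseteq> N" "\<tau> \<in> galois_group K N" for A \<tau>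
  proof -
    show t: "\<tau> ` A \<subseteq> N" using galN[OF that(2)] that(1) by auto
    show "subfield (compositum A (\<tau> ` A)) R" "A \<subseteq> compositum A (\<tau> ` A)" "compositum A (\<tau> ` A) \<subseteq> N"
      "\<tau> ` A \<subseteq> compositum A (\<tau> ` A)" using compositum_facts[OF that(1) t subfieldN] by auto
  qed
  show ?thesis
  proof
    assume ex: "exceptional K E"
    then have resE: "same_residue K E"
      and moveE: "\<And>\<tau>. \<tau> \<in> galois_group K N \<Longrightarrow> \<exists>x\<in>E. \<tau> x \<noteq> x \<Longrightarrow> \<not> same_residue K (compositum E (\<tau> ` E))"
      using exK by auto
    have resKM: "same_residue K M" and resME: "same_residue M E" using resE tower by auto
    have moveM: "\<not> same_residue M (compositum E (\<tau> ` E))" if t: "\<tau> \<in> galois_group M N" "\<exists>x\<in>E. \<tau> x \<noteq> x" for \<tau>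
    proof -
      have tK: "\<tau> \<in> galois_group K N" using t sub by auto
      note C = comp[OF E(3) tK]
      have "M \<subseteq> compositum E (\<tau> ` E)" using E(2) C(2) by auto
      then show ?thesis using moveE[OF tK t(2)] resKM same_residue_trans[OF M(2) _ MN C(3)] by auto
    qed
    have "exceptional M E" using exM resME moveM by auto
    moreover have "\<not> same_residue K (compositum M (s ` M))"
      if s: "s \<in> galois_group K N" "\<exists>x\<in>M. s x \<noteq> x" for s
    proof
      assume resP: "same_residue K (compositum M (s ` M))"
      note P = comp[OF MN s(1)]
      have KP: "K \<subseteq> compositum M (s ` M)" using M(2) P(2) by auto
      obtain g where g: "g \<in> galois_group (compositum M (s ` M)) N" "frob g"
        using frobenius_lift[OF P(1) KP P(3) resP] by blast
      have gK: "g \<in> galois_group K N" and gP: "\<And>x. x \<in> compositum M (s ` M) \<Longrightarrow> g x = x"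
        using g(1) KP by (auto simp: galois_group_def)
      have gM: "g \<in> galois_group M N" using gK gP P(2) memM by auto
      \<comment> \<open>M and K have the same residue field, so Frobenius elements over K that fix M
        are Frobenius elements over M.\<close>
      have qM: "M.q = q"
      proof -
        have "res ` (M \<inter> B 0) = res ` (K \<inter> B 0)"
        proof
          show "res ` (K \<inter> B 0) \<subseteq> res ` (M \<inter> B 0)" using M(2) by auto
          show "res ` (M \<inter> B 0) \<subseteq> res ` (K \<inter> B 0)"
          proof
            fix z assume "z \<in> res ` (M \<inter> B 0)"
            then obtain x where x: "x \<in> M" "x \<in> B 0" "z = res x" by auto
            obtain y where y: "y \<in> K" "x \<ominus> y \<in> B 1" using resKM x unfolding same_residue_def by auto
            have c: "x \<in> carrier R" "y \<in> carrier R" using x y KN N_carrier B_carrier by auto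
            have "x \<ominus> (x \<ominus> y) \<in> B 0" using x B10[OF y(2)] by auto
            moreover have "x \<ominus> (x \<ominus> y) = y" using c unfolding a_minus_def by algebra
            ultimately have yB: "y \<in> B 0" by simp
            then have "z = res y" using res_eq_iff[OF x(2) yB] y(2) x(3) by simp
            then show "z \<in> res ` (K \<inter> B 0)" using y(1) yB by auto
          qed
        qed
        then show ?thesis by (simp add: M.q_def q_def)
      qed
      have frobM: "M.frob h \<longleftrightarrow> frob h" for h by (simp add: M.frob_def frob_def qM)
      have excM: "\<not> totally_ramified M (compositum E (\<tau> ` E))" if t: "\<tau> \<in> galois_group M N" "\<exists>x\<in>E. \<tau> x \<noteq> x" for \<tau>
      proof -
        have tK: "\<tau> \<in> galois_group K N" using t sub by auto
        note C = comp[OF E(3) tK]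
        have "M \<subseteq> compositum E (\<tau> ` E)" using E(2) C(2) by auto
        then show ?thesis using moveM[OF t] M.totally_ramified_iff_residue[OF C(1) _ C(3)] by simp
      qed
      note lift = M.frob_fixes_conjugate[OF E resME excM]
      obtain i where i: "i \<in> galois_group M N" "\<forall>x\<in>E. g (i x) = i x"
        using lift[OF _ _ gM] g(2) frobM by blast
      obtain s' where s': "s' \<in> galois_group K N" "\<And>x. x \<in> N \<Longrightarrow> s' (s x) = x" "\<And>x. x \<in> N \<Longrightarrow> s (s' x) = x"
        by (rule galois_inv[OF s(1)]) blast
      \<comment> \<open>The conjugate of g by s is trivial on M because g fixes s(M).\<close>
      define g' where "g' = compose N s' (compose N g s)"
      have g': "g' x = s' (g (s x))" if "x \<in> N" for x using that by (simp add: g'_def compose_def)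
      have g'K: "g' \<in> galois_group K N" unfolding g'_def
        by (intro galois_compose[OF NsK] s' s gK)
      have "g' m = m" if m: "m \<in> M" for m
      proof -
        have mN: "m \<in> N" using m MN by auto
        have "s m \<in> compositum M (s ` M)" using P(4) m by blast
        then show ?thesis using g'[OF mN] gP s'(2)[OF mN] by simp
      qed
      then have g'M: "g' \<in> galois_group M N" using g'K memM by simp
      have "frob g'" by (rule frob_conjugate[OF s'(1) g(2) s(1) s'(2) galN[OF gK] g'])
      then obtain j where j: "j \<in> galois_group M N" "\<forall>x\<in>E. g' (j x) = j x"
        using lift[OF _ _ g'M] frobM by blast
      have iK: "i \<in> galois_group K N" and jK: "j \<in> galois_group K N" using i j sub by auto
      obtain i' where i': "i' \<in> galois_group K N" "\<And>x. x \<in> N \<Longrightarrow> i' (i x) = x" "\<And>x. x \<in> N \<Longrightarrow> i (i' x) = x"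
        by (rule galois_inv[OF iK]) blast
      \<comment> \<open>g fixes i(E) and s j(E); applying i^-1 turns these two fields into E and
        \<tau>(E).\<close>
      define \<tau> where "\<tau> = compose N i' (compose N s j)"
      have \<tau>: "\<tau> x = i' (s (j x))" if "x \<in> N" for x using that by (simp add: \<tau>_def compose_def)
      have \<tau>K: "\<tau> \<in> galois_group K N" unfolding \<tau>_def by (intro galois_compose[OF NsK] i' s jK)
      \<comment> \<open>The Frobenius element that witnesses total ramification of the compositum of
        E and \<tau>(E): g conjugated by i.\<close>
      define h where "h = compose N i' (compose N g i)"
      have h: "h x = i' (g (i x))" if "x \<in> N" for x using that by (simp add: h_def compose_def)
      have hK: "h \<in> galois_group K N" unfolding h_def by (intro galois_compose[OF NsK] i' gK iK)
      have hfrob: "frob h" by (rule frob_conjugate[OF i'(1) g(2) iK i'(2) galN[OF gK] h])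
      have hE: "h x = x" if x: "x \<in> E" for x using h[of x] i(2) i'(2)[of x] x E(3) by auto
      have h\<tau>: "h (\<tau> x) = \<tau> x" if x: "x \<in> E" for x
      proof -
        have xN: "x \<in> N" using x E(3) by auto
        have jN: "j x \<in> N" by (rule galN[OF jK xN])
        have sjN: "s (j x) \<in> N" by (rule galN[OF s(1) jN])
        have "s' (g (s (j x))) = j x" using j(2) x g'[OF jN] by auto
        then have "s (s' (g (s (j x)))) = s (j x)" by simp
        then have gs: "g (s (j x)) = s (j x)" using s'(3)[OF galN[OF gK sjN]] by simp
        have "h (\<tau> x) = i' (g (i (i' (s (j x)))))" using h[OF galN[OF \<tau>K xN]] \<tau>[OF xN] by simp
        also have "\<dots> = \<tau> x" unfolding i'(3)[OF sjN] gs \<tau>[OF xN] ..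
        finally show ?thesis .
      qed
      note C = comp[OF E(3) \<tau>K]
      have "\<forall>z\<in>compositum E (\<tau> ` E). h z = z"
        using compositum_fixed[OF E(3) C(5) subfieldN hK] hE h\<tau> by auto
      then have "same_residue K (compositum E (\<tau> ` E))" by (rule same_residue_if_frob[OF C(3) hfrob])
      \<comment> \<open>Exceptionality of E/K makes \<tau> trivial on E. As i and j are trivial on
        M, so is s, contrary to its choice.\<close>
      then have fixE: "\<forall>x\<in>E. \<tau> x = x" using moveE[OF \<tau>K] by blast
      have "s m = m" if m: "m \<in> M" for m
      proof -
        have mN: "m \<in> N" and mE: "m \<in> E" using m MN E(2) by auto
        have "j m = m" "i m = m" using i(1) j(1) memM m by auto
        then have "i' (s m) = m" using fixE mE \<tau>[OF mN] by auto
        then have "i (i' (s m)) = m" using \<open>i m = m\<close> by simp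
        then show ?thesis using i'(3)[OF galN[OF s(1) mN]] by simp
      qed
      then show False using s(2) by blast
    qed
    ultimately show "exceptional M E \<and> exceptional K M" using exKM resKM by auto
  next
    assume "exceptional M E \<and> exceptional K M"
    then have resME: "same_residue M E" and resKM: "same_residue K M"
      and moveM: "\<And>\<tau>. \<tau> \<in> galois_group M N \<Longrightarrow> \<exists>x\<in>E. \<tau> x \<noteq> x \<Longrightarrow> \<not> same_residue M (compositum E (\<tau> ` E))"
      and moveKM: "\<And>\<tau>. \<tau> \<in> galois_group K N \<Longrightarrow> \<exists>x\<in>M. \<tau> x \<noteq> x \<Longrightarrow> \<not> same_residue K (compositum M (\<tau> ` M))"
      using exM exKM by auto
    have "\<not> same_residue K (compositum E (\<tau> ` E))" if t: "\<tau> \<in> galois_group K N" "\<exists>x\<in>E. \<tau> x \<noteq> x" for \<tau>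
    proof
      assume r: "same_residue K (compositum E (\<tau> ` E))"
      note C = comp[OF E(3) t(1)]
      \<comment> \<open>If \<tau> moves M, the smaller compositum over M inherits the residue field
        of K, contrary to exceptionality of M/K. Otherwise \<tau> is an automorphism over M, and
        exceptionality of E/M applies.\<close>
      show False
      proof (cases "\<exists>x\<in>M. \<tau> x \<noteq> x")
        case True
        have "compositum M (\<tau> ` M) \<subseteq> compositum E (\<tau> ` E)"
          using compositum_facts(3)[of M "compositum E (\<tau> ` E)" "\<tau> ` M"] C E(2) by blast
        then have "same_residue K (compositum M (\<tau> ` M))" using r unfolding same_residue_def by blast
        then show False using moveKM[OF t(1) True] by simp
      next
        case False
        then have tM: "\<tau> \<in> galois_group M N" using t(1) memM by auto
        have "M \<subseteq> compositum E (\<tau> ` E)" using E(2) C(2) by auto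
        then have "same_residue M (compositum E (\<tau> ` E))"
          using r same_residue_trans[OF M(2) _ MN C(3)] by blast
        then show False using moveM[OF tM t(2)] by simp
      qed
    qed
    then show "exceptional K E" using exK tower resME resKM by auto
  qed
qed

end

theorem theorem4p6:
  fixes \<Omega> :: "('a, 'b) ring_scheme" (structure) and K M L :: "'a set"
  assumes "algebraically_closed \<Omega>"
    and "subfield K \<Omega>" and "subfield M \<Omega>" and "subfield L \<Omega>"
    and "K \<subseteq> M" and "M \<subseteq> L"
    and "local_field (\<Omega>\<lparr>carrier := K\<rparr>)" and "local_field (\<Omega>\<lparr>carrier := L\<rparr>)"
    and "ring.finite_dimension \<Omega> K L"
    and "ring.separable_extension \<Omega> K L"
  shows "ring.exceptional \<Omega> K L \<longleftrightarrow> ring.exceptional \<Omega> M L \<and> ring.exceptional \<Omega> K M"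
proof -
  interpret algebraically_closed \<Omega> by fact
  have KL: "K \<subseteq> L" using assms by auto
  \<comment> \<open>The Galois closure of the top extension serves for all three extensions.\<close>
  define N where "N = galois_closure K L"
  note N = galois_closure_props[OF assms(2,4) KL assms(9,10), folded N_def]
  have KN: "K \<subseteq> N" using KL N(2) by auto
  obtain v where v: "local_valuation (\<Omega>\<lparr>carrier := K\<rparr>) v" using assms(7) by (auto simp: local_field_def)
  have "valued_subfield \<Omega> K v"
    using discrete_valuation_valued[OF assms(2)] local_valuation.axioms(1)[OF v] by blast
  then have vK: "local_subfield \<Omega> K v" using valued_subfield.local_valuation_iff v by blast
  obtain w where w: "local_subfield \<Omega> N w"
    using local_subfield.finite_extension_local[OF vK N(1) KN N(3)] by blast
  interpret galois_local_field \<Omega> N w K v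
    by (intro galois_local_field.intro galois_local_field_axioms.intro residue_base.intro
        residue_base_axioms.intro algebraically_closed_axioms w vK assms(2) KN N(3-5))
  show ?thesis by (rule exceptional_tower[OF assms(3,5,4,6) N(2)])
qed

end
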